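(* Consider the $d$-dimensional additive monotone regression model on the fixed lattice design described in the context, with $\sigma>0$, and let $j\in\{1,\dots,d\}$ with $\beta_j=1/3$. Put $a_j=f_j^{*\prime}(x_{0,j})>0$. Let $\widehat v_j\le\widehat u_j$ be the lower and upper endpoints of the largest interval of consecutive points of $\mathcal X_j$ containing $x_{0,j}$ on which $\widehat f_j$ is constant, and let $\widehat N_j=\sum_{i=1}^n\mathbf 1\{x_{i,j}\in[\widehat v_j,\widehat u_j]\}$. For $a>0$ define $$\mathbb L_j^{\mathrm{crit}}(a)=\sqrt{r_a^*+\ell_a^*}\ \mathbb G_a,$$ with $\mathbb G_a,r_a^*,\ell_a^*$ as in the context. Then, as $n\to\infty$ along the design sequence, $$\sqrt{\widehat N_j}\,\bigl(\widehat f_j(x_{0,j})-f_j^*(x_{0,j})\bigr)\ \text{ converges in distribution to }\ \mathbb L_j^{\mathrm{crit}}(a_j).$$ Moreover, the distribution of $\mathbb L_j^{\mathrm{crit}}(a)/\sigma$ depends on $a$: the map sending $a\in(0,\infty)$ to the law of $\mathbb L_j^{\mathrm{crit}}(a)/\sigma$ is not constant. (Hence normalization by $\sqrt{\widehat N_j}$ is not pivotal when $\beta_j=1/3$.)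
   Context: Design. The design points are the full lattice $\mathcal X=\{X_1,\dots,X_n\}=\prod_{l=1}^d\mathcal X_l\subset\mathbb R^d$ with $\mathcal X_l=\{k/n_l:k=1,\dots,n_l\}$, so $n=\prod_{l=1}^d n_l$; write $X_i=(x_{i,1},\dots,x_{i,d})^T$. Asymptotics are along a sequence of such designs in which $n_l\to\infty$ for every $l$ and $n_l=n^{\beta_l}$ exactly, with fixed exponents $\beta_l\in(0,1)$, $\sum_{l=1}^d\beta_l=1$. The fixed point $x_0=(x_{0,1},\dots,x_{0,d})^T\in(0,1)^d$ belongs to $\mathcal X$ for every design in the sequence. Model. $Y_i=\mu^*+f_1^*(x_{i,1})+\cdots+f_d^*(x_{i,d})+\varepsilon_i$, $i=1,\dots,n$, where $\mu^*\in\mathbb R$ and the $\varepsilon_i$ are i.i.d. with a fixed distribution of mean zero and finite variance $\sigma^2$. Each $f_j^*:[0,1]\to\mathbb R$ is nondecreasing and satisfies the identifiability constraint $\sum_{i=1}^n f_j^*(x_{i,j})=0$; it depends on $n$ only through the centering constant, i.e. $f_j^*(x)=g_j(x)-n_j^{-1}\sum_{k=1}^{n_j}g_j(k/n_j)$ for a fixed nondecreasing $g_j:[0,1]\to\mathbb R$. Local smoothness. For each $j$, $g_j$ (equivalently $f_j^*$) is differentiable at $x_{0,j}$ with derivative $f_j^{*\prime}(x_{0,j})=g_j'(x_{0,j})>0$, in the sense that for all $L_0>0$, $\lim_{\delta\searrow0}\delta^{-1}\sup_{x\in[0,1],|x-x_{0,j}|\le L_0\delta}|f_j^*(x)-f_j^*(x_{0,j})-f_j^{*\prime}(x_{0,j})(x-x_{0,j})|=0$.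 Estimator. $(\widehat\mu,\widehat f_1,\dots,\widehat f_d)$ is a minimizer of $\sum_{i=1}^n(Y_i-\mu-f_1(x_{i,1})-\cdots-f_d(x_{i,d}))^2$ over $\mu\in\mathbb R$ and nondecreasing $f_1,\dots,f_d:[0,1]\to\mathbb R$, normalized so that $\sum_{i=1}^n\widehat f_j(x_{i,j})=0$ for every $j$ (values at design points are then uniquely determined). Limit variables. Let $\{Z_i\}_{i\in\mathbb Z\setminus\{0\}}$ be i.i.d. standard normal, $S(0)=0$, $S(m)=\sum_{i=1}^m Z_i$ and $S(-m)=-\sum_{i=1}^m Z_{-i}$ for $m\ge1$. For $a>0$, $$\mathbb G_a=\inf_{r\in\mathbb Z_{\ge0}}\ \sup_{\ell\in\mathbb Z_{\ge1}}\left\{\frac{\sigma S(r)-\sigma S(-\ell)}{r+\ell}+\frac{a(r-\ell+1)}2\right\},$$ and $r_a^*$, $\ell_a^*$ denote the almost surely unique minimizing and maximizing arguments: $r_a^*$ attains the outer infimum and $\ell_a^*$ attains the inner supremum at $r=r_a^*$. *)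

theory Defs
  imports "HOL-Probability.Probability"
begin

definition grid :: "nat \<Rightarrow> real set" where
  "grid N = (\<lambda>k. real k / real N) ` {1..N}"

text \<open>The dimension is \<open>CARD('d)\<close>. The design points are pairwise distinct, so sums over
  \<open>i = 1, \<dots>, n\<close> are written as sums over the points of the lattice, and responses and errors
  are indexed by design points.\<close>

definition lattice_design :: "('d::finite \<Rightarrow> nat) \<Rightarrow> (real^'d) set" where
  "lattice_design N = {x. \<forall>l. x $ l \<in> grid (N l)}"

lemma finite_card_lattice_design:
  fixes N :: "'d::finite \<Rightarrow> nat"
  shows "finite (lattice_design N)" and "card (lattice_design N) = (\<Prod>l\<in>UNIV. N l)"
proof -
  have card_grid: "card (grid n) = n" for n
    unfolding grid_def by (subst card_image) (auto simp: inj_on_def)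
  have fin_grid: "finite (grid n)" for n
    by (simp add: grid_def)
  have bij: "bij_betw vec_lambda (PiE UNIV (\<lambda>l. grid (N l))) (lattice_design N)"
    by (rule bij_betw_byWitness[where f' = vec_nth]) (auto simp: lattice_design_def)
  have "finite (PiE UNIV (\<lambda>l. grid (N l)))"
    by (rule finite_PiE) (auto simp: fin_grid)
  with bij show "finite (lattice_design N)"
    using bij_betw_finite by blast
  show "card (lattice_design N) = (\<Prod>l\<in>UNIV. N l)"
    using bij_betw_same_card[OF bij] by (simp add: card_PiE card_grid)
qed

definition centered :: "nat \<Rightarrow> (real \<Rightarrow> real) \<Rightarrow> real \<Rightarrow> real" where
  "centered N g x = g x - (\<Sum>k=1..N. g (real k / real N)) / real N"

definition locally_linear_at :: "(real \<Rightarrow> real) \<Rightarrow> real \<Rightarrow> real \<Rightarrow> bool" where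
  "locally_linear_at f c x \<longleftrightarrow> (\<forall>L>0.
     ((\<lambda>\<delta>. (SUP y\<in>{y\<in>{0..1}. \<bar>y - x\<bar> \<le> L * \<delta>}. \<bar>f y - f x - c * (y - x)\<bar>) / \<delta>)
       \<longlongrightarrow> 0) (at_right 0))"

definition additive_response ::
  "('d::finite \<Rightarrow> nat) \<Rightarrow> real \<Rightarrow> ('d \<Rightarrow> real \<Rightarrow> real) \<Rightarrow> (real^'d \<Rightarrow> real) \<Rightarrow> real^'d \<Rightarrow> real" where
  "additive_response N \<mu> g e x = \<mu> + (\<Sum>l\<in>UNIV. centered (N l) (g l) (x $ l)) + e x"

definition rss ::
  "('d::finite \<Rightarrow> nat) \<Rightarrow> (real^'d \<Rightarrow> real) \<Rightarrow> real \<Rightarrow> ('d \<Rightarrow> real \<Rightarrow> real) \<Rightarrow> real" where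
  "rss N Y \<mu> f = (\<Sum>x\<in>lattice_design N. (Y x - \<mu> - (\<Sum>l\<in>UNIV. f l (x $ l)))\<^sup>2)"

definition additive_isotonic_lse ::
  "('d::finite \<Rightarrow> nat) \<Rightarrow> (real^'d \<Rightarrow> real) \<Rightarrow> real \<Rightarrow> ('d \<Rightarrow> real \<Rightarrow> real) \<Rightarrow> bool" where
  "additive_isotonic_lse N Y \<mu> f \<longleftrightarrow>
     (\<forall>l. mono_on {0..1} (f l)) \<and>
     (\<forall>\<mu>' f'. (\<forall>l. mono_on {0..1} (f' l)) \<longrightarrow> rss N Y \<mu> f \<le> rss N Y \<mu>' f') \<and>
     (\<forall>l. (\<Sum>x\<in>lattice_design N. f l (x $ l)) = 0)"

definition block_lower :: "real set \<Rightarrow> (real \<Rightarrow> real) \<Rightarrow> real \<Rightarrow> real" where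
  "block_lower X f x0 = Min {v\<in>X. v \<le> x0 \<and> (\<forall>x\<in>X. v \<le> x \<and> x \<le> x0 \<longrightarrow> f x = f x0)}"

definition block_upper :: "real set \<Rightarrow> (real \<Rightarrow> real) \<Rightarrow> real \<Rightarrow> real" where
  "block_upper X f x0 = Max {u\<in>X. x0 \<le> u \<and> (\<forall>x\<in>X. x0 \<le> x \<and> x \<le> u \<longrightarrow> f x = f x0)}"

definition block_count ::
  "('d::finite \<Rightarrow> nat) \<Rightarrow> 'd \<Rightarrow> (real \<Rightarrow> real) \<Rightarrow> real \<Rightarrow> real" where
  "block_count N j f x0 =
     (\<Sum>x\<in>lattice_design N.
        indicator {block_lower (grid (N j)) f x0..block_upper (grid (N j)) f x0} (x $ j))"

text \<open>The functions below take one realization \<open>z\<close> of the sequence \<open>Z\<close>; \<open>z 0\<close> is never used.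
  The real-valued suprema and infima are over sets that are almost surely bounded.\<close>

definition two_sided_walk :: "(int \<Rightarrow> real) \<Rightarrow> int \<Rightarrow> real" where
  "two_sided_walk z m = (if m \<ge> 0 then (\<Sum>i=1..m. z i) else - (\<Sum>i=1..-m. z (- i)))"

definition crit_obj :: "real \<Rightarrow> real \<Rightarrow> (int \<Rightarrow> real) \<Rightarrow> nat \<Rightarrow> nat \<Rightarrow> real" where
  "crit_obj \<sigma> a z r l =
     (\<sigma> * two_sided_walk z (int r) - \<sigma> * two_sided_walk z (- int l)) / (real r + real l)
     + a * (real r - real l + 1) / 2"

definition crit_sup :: "real \<Rightarrow> real \<Rightarrow> (int \<Rightarrow> real) \<Rightarrow> nat \<Rightarrow> real" where
  "crit_sup \<sigma> a z r = (SUP l\<in>{1..}. crit_obj \<sigma> a z r l)"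

definition crit_G :: "real \<Rightarrow> real \<Rightarrow> (int \<Rightarrow> real) \<Rightarrow> real" where
  "crit_G \<sigma> a z = (INF r. crit_sup \<sigma> a z r)"

text \<open>The optimizing arguments are almost surely unique; \<open>LEAST\<close> selects them measurably and
  makes a choice only on a null event.\<close>

definition crit_r :: "real \<Rightarrow> real \<Rightarrow> (int \<Rightarrow> real) \<Rightarrow> nat" where
  "crit_r \<sigma> a z = (LEAST r. crit_sup \<sigma> a z r = crit_G \<sigma> a z)"

definition crit_l :: "real \<Rightarrow> real \<Rightarrow> (int \<Rightarrow> real) \<Rightarrow> nat" where
  "crit_l \<sigma> a z =
     (LEAST l. l \<ge> 1 \<and> crit_obj \<sigma> a z (crit_r \<sigma> a z) l = crit_sup \<sigma> a z (crit_r \<sigma> a z))"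

definition crit_L :: "real \<Rightarrow> real \<Rightarrow> (int \<Rightarrow> real) \<Rightarrow> real" where
  "crit_L \<sigma> a z = sqrt (real (crit_r \<sigma> a z) + real (crit_l \<sigma> a z)) * crit_G \<sigma> a z"

text \<open>The measurability conjuncts are needed because \<^const>\<open>distr\<close> is meaningless for
  non-measurable maps.\<close>

definition converges_in_distribution ::
  "(nat \<Rightarrow> 'a measure) \<Rightarrow> (nat \<Rightarrow> 'a \<Rightarrow> real) \<Rightarrow> 'b measure \<Rightarrow> ('b \<Rightarrow> real) \<Rightarrow> bool" where
  "converges_in_distribution M T P L \<longleftrightarrow>
     (\<forall>m. T m \<in> borel_measurable (M m)) \<and> L \<in> borel_measurable P \<and>
     weak_conv_m (\<lambda>m. distr (M m) borel (T m)) (distr P borel L)"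

end

(* On a full lattice the least squares problem decouples: the fitted component in direction j is
   the isotonic regression of the row means, whose noise is an average of n_j^2 errors when
   beta_j = 1/3. After scaling by n_j this noise is of the same order as the increments of the drift
   between neighbouring grid points, so the limit is an isotonic regression problem on the integers
   with Gaussian noise and slope a_j. Skorohod's theorem, applied to the law of a single row mean,
   couples all the problems with their limit coordinatewise; the strict saddle property of the
   min-max point then transfers from the limit to the finite problems.

   As the slope tends to infinity the optimal block becomes a single point and the normalized limit
   becomes standard normal, whereas for a fixed large slope a pooled block of two points produces a
   tail that is heavier than the normal one; so the limit law depends on the slope. *)
theory Submission
  imports Defs "HOL-Real_Asymp.Real_Asymp"
begin

section \<open>Isotonic regression\<close>

text \<open>Coordinatewise convergence is less than an argmin needs: the number of rows grows, and
  the coupling controls far rows in no uniform way. The missing compactness comes from a linear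
  growth bound on the partial sums of the noise. It holds with probability near one, its constant
  depends only on second moments and so serves all designs at once, and the quadratic drift beats it
  outside a bounded window. Measurability of the estimator is not given. The statistic is therefore
  identified with the min-max formula in the row means; this also allows laws to be compared on the
  coupled space, and carries over the fact that the formula solves the optimality conditions. The
  estimated intercept shifts all rescaled row means by their average noise, a common shift of order
  n_j^(-1/2) that leaves the blocks unchanged. For the dependence on the slope, a pooled block lifts
  the statistic above sqrt 2 * \<alpha> on an event at least as likely, up to a constant factor, as
  one normal variable exceeding \<alpha> + 1; the normal tail at sqrt 2 * \<alpha> is of smaller
  order.\<close>

text \<open>Kuhn-Tucker conditions of least squares over nondecreasing sequences. Equivalently, the
  partial sums of \<open>h\<close> form the greatest convex minorant of those of \<open>y\<close>:
  they lie below, with equality at the end and at each kink.\<close>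

definition isotonic_kkt :: "nat \<Rightarrow> (nat \<Rightarrow> real) \<Rightarrow> (nat \<Rightarrow> real) \<Rightarrow> bool" where
  "isotonic_kkt n y h \<longleftrightarrow> mono_on {1..n} h \<and> (\<forall>k\<le>n. 0 \<le> (\<Sum>i=1..k. y i - h i)) \<and>
     (\<Sum>i=1..n. y i - h i) = 0 \<and>
     (\<forall>k\<in>{1..<n}. h k < h (Suc k) \<longrightarrow> (\<Sum>i=1..k. y i - h i) = 0)"

lemma sum_telescope_interval:
  fixes f :: "nat \<Rightarrow> real"
  assumes "t \<le> w"
  shows "(\<Sum>i=1..w. f i) = (\<Sum>i=1..t. f i) + (\<Sum>i\<in>{t<..w}. f i)"
proof -
  have "{1..w} = {1..t} \<union> {t<..w}" using assms by auto
  then show ?thesis by (metis (no_types, lifting) sum.union_disjoint finite_atLeastAtMost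
    finite_greaterThanAtMost ivl_disj_int_two(8) atLeastAtMost_iff disjoint_iff greaterThanAtMost_iff not_le)
qed

text \<open>Tilting by the level \<open>c\<close> turns statements about averages into comparisons
  of endpoints: the average of \<open>y\<close> over \<open>{t<..u}\<close> is at least
  \<open>c\<close> exactly when the excess sum at \<open>u\<close> is at least that at
  \<open>t\<close>.\<close>

definition excess_sum :: "(nat \<Rightarrow> real) \<Rightarrow> real \<Rightarrow> nat \<Rightarrow> real" where
  "excess_sum y c k = (\<Sum>i=1..k. y i - c)"

lemma excess_sum_split:
  assumes "t \<le> w"
  shows "excess_sum y c w = excess_sum y c t + (\<Sum>i\<in>{t<..w}. y i - c)"
  unfolding excess_sum_def by (rule sum_telescope_interval[OF assms])

text \<open>The witness \<open>w\<close> is the right end of the level block containing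
  \<open>k\<close>. The residual sum vanishes there and is nonnegative at \<open>t\<close>, so over
  \<open>{t<..w}\<close> the data sum to no more than the fit, whose values do not exceed
  \<open>h k\<close>.\<close>

lemma isotonic_kkt_below:
  assumes kkt: "isotonic_kkt n y h" and k: "k \<in> {1..n}"
  shows "h k \<le> c \<Longrightarrow> \<exists>w\<in>{k..n}. \<forall>t<w. excess_sum y c w \<le> excess_sum y c t"
    and "h k < c \<Longrightarrow> \<exists>w\<in>{k..n}. \<forall>t<w. excess_sum y c w < excess_sum y c t"
proof -
  define w where "w = Max {i\<in>{k..n}. h i \<le> h k}"
  have mono: "h i \<le> h i'" if "1 \<le> i" "i \<le> i'" "i' \<le> n" for i i'
    using kkt that by (auto simp: isotonic_kkt_def mono_on_def)
  have w: "w \<in> {i\<in>{k..n}. h i \<le> h k}" unfolding w_def by (rule Max_in) (use k in auto)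
  have "Suc w \<notin> {i\<in>{k..n}. h i \<le> h k}"
  proof
    assume "Suc w \<in> {i\<in>{k..n}. h i \<le> h k}"
    then have "Suc w \<le> w" unfolding w_def by (intro Max_ge) auto
    then show False by simp
  qed
  with w k have jump: "w = n \<or> h w < h (Suc w)" by auto
  have seg: "excess_sum y c w \<le> excess_sum y c t + real (w - t) * (h k - c)" if t: "t < w" for t
  proof -
    have "(\<Sum>i=1..w. y i - h i) = 0"
      using kkt w k jump by (cases "w = n") (auto simp: isotonic_kkt_def)
    moreover have "0 \<le> (\<Sum>i=1..t. y i - h i)"
      using kkt w t by (auto simp: isotonic_kkt_def)
    ultimately have "(\<Sum>i\<in>{t<..w}. y i - c) \<le> (\<Sum>i\<in>{t<..w}. h i - c)"
      using sum_telescope_interval[of t w "\<lambda>i. y i - h i"] t by (simp add: sum_subtractf)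
    also have "\<dots> \<le> (\<Sum>i\<in>{t<..w}. h k - c)"
    proof (rule sum_mono)
      fix i assume "i \<in> {t<..w}"
      then have "h i \<le> h w" using w by (intro mono) auto
      then show "h i - c \<le> h k - c" using w by auto
    qed
    finally show ?thesis using excess_sum_split[of t w y c] t by simp
  qed
  show "\<exists>w\<in>{k..n}. \<forall>t<w. excess_sum y c w \<le> excess_sum y c t" if "h k \<le> c"
  proof (intro bexI[of _ w] allI impI)
    fix t assume t: "t < w"
    have "real (w - t) * (h k - c) \<le> 0" using that by (intro mult_nonneg_nonpos) auto
    then show "excess_sum y c w \<le> excess_sum y c t" using seg[OF t] by linarith
  qed (use w in auto)
  show "\<exists>w\<in>{k..n}. \<forall>t<w. excess_sum y c w < excess_sum y c t" if "h k < c"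
  proof (intro bexI[of _ w] allI impI)
    fix t assume t: "t < w"
    have "real (w - t) * (h k - c) < 0" using that t by (intro mult_pos_neg) auto
    then show "excess_sum y c w < excess_sum y c t" using seg[OF t] by linarith
  qed (use w in auto)
qed

text \<open>The mirror image: \<open>t\<close> is the position just before the level block
  containing \<open>k\<close>, possibly 0, where the residual sum vanishes; from there on the fit is
  at least \<open>h k\<close>.\<close>

lemma isotonic_kkt_above:
  assumes kkt: "isotonic_kkt n y h" and k: "k \<in> {1..n}"
  shows "c \<le> h k \<Longrightarrow> \<exists>t<k. \<forall>w\<in>{t<..n}. excess_sum y c t \<le> excess_sum y c w"
    and "c < h k \<Longrightarrow> \<exists>t<k. \<forall>w\<in>{t<..n}. excess_sum y c t < excess_sum y c w"
proof -
  define v where "v = Min {i\<in>{1..k}. h k \<le> h i}"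
  define t where "t = v - 1"
  have mono: "h i \<le> h i'" if "1 \<le> i" "i \<le> i'" "i' \<le> n" for i i'
    using kkt that by (auto simp: isotonic_kkt_def mono_on_def)
  have v: "v \<in> {i\<in>{1..k}. h k \<le> h i}" unfolding v_def by (rule Min_in) (use k in auto)
  then have vt: "v = Suc t" by (auto simp: t_def)
  have "t \<notin> {i\<in>{1..k}. h k \<le> h i}"
  proof
    assume "t \<in> {i\<in>{1..k}. h k \<le> h i}"
    then have "v \<le> t" unfolding v_def by (intro Min_le) auto
    then show False using vt by simp
  qed
  with v k have t: "t < k" "t < n" "t = 0 \<or> h t < h (Suc t)" by (auto simp: vt)
  have seg: "excess_sum y c t + real (w - t) * (h k - c) \<le> excess_sum y c w" if w: "w \<in> {t<..n}" for w
  proof -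
    have "real (w - t) * (h k - c) = (\<Sum>i\<in>{t<..w}. h k - c)" by simp
    also have "\<dots> \<le> (\<Sum>i\<in>{t<..w}. h i - c)"
    proof (rule sum_mono)
      fix i assume "i \<in> {t<..w}"
      then have "h v \<le> h i" using w vt by (intro mono) auto
      then show "h k - c \<le> h i - c" using v by auto
    qed
    finally have "real (w - t) * (h k - c) \<le> (\<Sum>i\<in>{t<..w}. h i - c)" .
    moreover have "(\<Sum>i=1..t. y i - h i) = 0"
      using kkt t by (cases "t = 0") (auto simp: isotonic_kkt_def)
    moreover have "0 \<le> (\<Sum>i=1..w. y i - h i)"
      using kkt w by (auto simp: isotonic_kkt_def)
    ultimately have "real (w - t) * (h k - c) \<le> (\<Sum>i\<in>{t<..w}. y i - c)"
      using sum_telescope_interval[of t w "\<lambda>i. y i - h i"] w by (simp add: sum_subtractf)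
    then show ?thesis using excess_sum_split[of t w y c] w by simp
  qed
  show "\<exists>t<k. \<forall>w\<in>{t<..n}. excess_sum y c t \<le> excess_sum y c w" if "c \<le> h k"
  proof (intro exI[of _ t] conjI ballI t)
    fix w assume w: "w \<in> {t<..n}"
    have "0 \<le> real (w - t) * (h k - c)" using that by (intro mult_nonneg_nonneg) auto
    then show "excess_sum y c t \<le> excess_sum y c w" using seg[OF w] by linarith
  qed
  show "\<exists>t<k. \<forall>w\<in>{t<..n}. excess_sum y c t < excess_sum y c w" if "c < h k"
  proof (intro exI[of _ t] conjI ballI t)
    fix w assume w: "w \<in> {t<..n}"
    have "0 < real (w - t) * (h k - c)" using that w by (intro mult_pos_pos) auto
    then show "excess_sum y c t < excess_sum y c w" using seg[OF w] by linarith
  qed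
qed

definition min_max_average :: "nat \<Rightarrow> (nat \<Rightarrow> real) \<Rightarrow> nat \<Rightarrow> real" where
  "min_max_average n y k = (MIN u\<in>{k..n}. MAX t\<in>{..<k}. (\<Sum>i\<in>{t<..u}. y i) / real (u - t))"

text \<open>The two witnesses at level \<open>c = h k\<close> settle both inequalities: the right
  end of the block is a good choice in the minimum, the position before the block a good choice in
  the maximum. The formula makes the fit a fixed measurable function of the data.\<close>

lemma isotonic_kkt_min_max:
  assumes kkt: "isotonic_kkt n y h" and k: "k \<in> {1..n}"
  shows "h k = min_max_average n y k"
proof -
  have iff: "(s / n \<le> c) = (U \<le> T)" "(c \<le> s / n) = (T \<le> U)"
    if "0 < n" "U = T + (s - n * c)" for s n c U T :: real
    using that by (auto simp: pos_divide_le_eq pos_le_divide_eq mult.commute)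
  define A where "A u t = (\<Sum>i\<in>{t<..u}. y i) / real (u - t)" for u t
  have pos: "A u t \<le> c \<longleftrightarrow> excess_sum y c u \<le> excess_sum y c t"
    "c \<le> A u t \<longleftrightarrow> excess_sum y c t \<le> excess_sum y c u" if "t < u" for u t c
  proof -
    have "excess_sum y c u = excess_sum y c t + ((\<Sum>i\<in>{t<..u}. y i) - real (u - t) * c)"
      using excess_sum_split[of t u y c] that
      unfolding sum_subtractf[of y "\<lambda>_. c" "{t<..u}"] by simp
    then show "A u t \<le> c \<longleftrightarrow> excess_sum y c u \<le> excess_sum y c t"
      "c \<le> A u t \<longleftrightarrow> excess_sum y c t \<le> excess_sum y c u"
      unfolding A_def using that by (intro iff; simp)+
  qed
  obtain w where w0: "w \<in> {k..n}" "\<And>t. t < w \<Longrightarrow> excess_sum y (h k) w \<le> excess_sum y (h k) t"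
    using isotonic_kkt_below(1)[OF kkt k, of "h k"] by blast
  then have w: "w \<in> {k..n}" "\<And>t. t < w \<Longrightarrow> A w t \<le> h k"
    using pos(1) by blast+
  obtain t where t0: "t < k" "\<And>w. w \<in> {t<..n} \<Longrightarrow> excess_sum y (h k) t \<le> excess_sum y (h k) w"
    using isotonic_kkt_above(1)[OF kkt k, of "h k"] by blast
  then have t: "t < k" "\<And>w. w \<in> {t<..n} \<Longrightarrow> h k \<le> A w t"
    using pos(2) by (blast, metis greaterThanAtMost_iff)
  have "(MIN u\<in>{k..n}. MAX t\<in>{..<k}. A u t) = h k"
  proof (rule antisym)
    have "(MIN u\<in>{k..n}. MAX t\<in>{..<k}. A u t) \<le> (MAX t\<in>{..<k}. A w t)"
      using w by (intro Min_le) auto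
    also have "\<dots> \<le> h k"
      using w t by (intro Max.boundedI) auto
    finally show "(MIN u\<in>{k..n}. MAX t\<in>{..<k}. A u t) \<le> h k" .
    show "h k \<le> (MIN u\<in>{k..n}. MAX t\<in>{..<k}. A u t)"
    proof (rule Min.boundedI)
      fix a assume "a \<in> (\<lambda>u. MAX t\<in>{..<k}. A u t) ` {k..n}"
      then obtain u where u: "u \<in> {k..n}" "a = (MAX t\<in>{..<k}. A u t)" by auto
      have "h k \<le> A u t" using t u by auto
      also have "\<dots> \<le> a" unfolding u(2) using t by (intro Max_ge) auto
      finally show "h k \<le> a" .
    qed (use k in auto)
  qed
  then show ?thesis by (simp add: min_max_average_def A_def)
qed

text \<open>If the excess path at level \<open>c\<close> is minimal exactly at \<open>p\<close> and
  \<open>u\<close>, the block is \<open>{p<..u}\<close>. A value different from \<open>c\<close>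
  inside would force an excess below the minimum, and the value \<open>c\<close> outside would
  produce a third minimizer. This lets a block be read off from strict inequalities that survive a
  limit.\<close>

lemma isotonic_kkt_block:
  assumes kkt: "isotonic_kkt n y h" and p: "p < k" "k \<le> u" "u \<le> n"
    and eq: "excess_sum y c p = excess_sum y c u"
    and min: "\<And>t. t \<le> n \<Longrightarrow> t \<noteq> p \<Longrightarrow> t \<noteq> u \<Longrightarrow> excess_sum y c u < excess_sum y c t"
  shows "h k = c" "{i\<in>{1..n}. h i = h k} = {p<..u}"
proof -
  note below = isotonic_kkt_below[OF kkt, where c = c]
  note above = isotonic_kkt_above[OF kkt, where c = c]
  have ge: "excess_sum y c u \<le> excess_sum y c t" if "t \<le> n" for t
    using min[of t] eq that by fastforce
  have mid: "h i = c" if i: "i \<in> {p<..u}" for i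
  proof -
    have i': "i \<in> {1..n}" using i p by auto
    have "\<not> c < h i"
    proof
      assume "c < h i"
      then obtain t where t: "t < i" "\<And>w. w \<in> {t<..n} \<Longrightarrow> excess_sum y c t < excess_sum y c w"
        using above(2)[OF i'] by blast
      have "excess_sum y c t < excess_sum y c u" using t i p by auto
      then show False using ge[of t] t i p by auto
    qed
    moreover have "\<not> h i < c"
    proof
      assume "h i < c"
      then obtain w where w: "w \<in> {i..n}" "\<And>t. t < w \<Longrightarrow> excess_sum y c w < excess_sum y c t"
        using below(2)[OF i'] by blast
      have "excess_sum y c w < excess_sum y c p" using w i by auto
      then show False using ge[of w] eq w by auto
    qed
    ultimately show ?thesis by linarith
  qed
  have out: "h i \<noteq> c" if i: "i \<in> {1..n}" "i \<notin> {p<..u}" for i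
  proof
    assume hc: "h i = c"
    consider "u < i" | "i \<le> p" using i by force
    then show False
    proof cases
      case 1
      obtain w where w: "w \<in> {i..n}" "\<And>t. t < w \<Longrightarrow> excess_sum y c w \<le> excess_sum y c t"
        using below(1)[OF i(1)] hc by blast
      have "excess_sum y c w \<le> excess_sum y c u" using w 1 by auto
      then show False using min[of w] w 1 p by auto
    next
      case 2
      obtain t where t: "t < i" "\<And>w. w \<in> {t<..n} \<Longrightarrow> excess_sum y c t \<le> excess_sum y c w"
        using above(1)[OF i(1)] hc by blast
      have "excess_sum y c t \<le> excess_sum y c p" using t 2 p by auto
      then show False using min[of t] t(1) 2 p eq by auto
    qed
  qed
  show hk: "h k = c" using mid p by auto
  have "i \<in> {p<..u} \<longleftrightarrow> i \<in> {1..n} \<and> h i = c" for i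
    using mid[of i] out[of i] p by (cases "i \<in> {p<..u}") auto
  then show "{i\<in>{1..n}. h i = h k} = {p<..u}"
    unfolding hk by blast
qed

section \<open>Reduction of the additive problem to row means\<close>

definition lattice_row :: "('d::finite \<Rightarrow> nat) \<Rightarrow> 'd \<Rightarrow> nat \<Rightarrow> (real^'d) set" where
  "lattice_row N j k = {x \<in> lattice_design N. x $ j = real k / real (N j)}"

lemma finite_lattice_row [simp]: "finite (lattice_row N j k)"
  by (simp add: lattice_row_def finite_card_lattice_design(1))

lemma grid_memI: "k \<in> {1..n} \<Longrightarrow> real k / real n \<in> grid n"
  by (auto simp: grid_def)

lemma lattice_row_inject:
  assumes "x \<in> lattice_row N j k" "x \<in> lattice_row N j k'" "k \<in> {1..N j}"
  shows "k = k'"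
  using assms by (auto simp: lattice_row_def)

lemma disjoint_lattice_rows: "disjoint_family_on (lattice_row N j) {1..N j}"
  unfolding disjoint_family_on_def using lattice_row_inject[of _ N j] by blast

lemma lattice_design_rows: "lattice_design N = (\<Union>k\<in>{1..N j}. lattice_row N j k)"
  by (auto simp: lattice_row_def lattice_design_def grid_def)

lemma sum_lattice_rows:
  fixes \<phi> :: "real^'d::finite \<Rightarrow> real"
  shows "(\<Sum>x\<in>lattice_design N. \<phi> x) = (\<Sum>k=1..N j. \<Sum>x\<in>lattice_row N j k. \<phi> x)"
  unfolding lattice_design_rows[of N j]
  by (rule sum.UNION_disjoint) (use lattice_row_inject[of _ N j] in \<open>auto simp: disjoint_iff\<close>)

text \<open>Overwriting coordinate \<open>j\<close> carries one row onto another and leaves all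
  other coordinates alone. The decoupling of the additive problem rests on this property of the full
  lattice.\<close>

lemma bij_betw_lattice_row:
  assumes "k \<in> {1..N j}" "k' \<in> {1..N j}"
  shows "bij_betw (\<lambda>x. \<chi> i. if i = j then real k' / real (N j) else x $ i)
    (lattice_row N j k) (lattice_row N j k')"
  by (rule bij_betw_byWitness[where f' = "\<lambda>x. \<chi> i. if i = j then real k / real (N j) else x $ i"])
     (use assms in \<open>auto simp: lattice_row_def lattice_design_def vec_eq_iff grid_memI\<close>)

lemma sum_lattice_row_other:
  fixes \<phi> :: "real \<Rightarrow> real"
  assumes "k \<in> {1..N j}" "k' \<in> {1..N j}" "l \<noteq> j"
  shows "(\<Sum>x\<in>lattice_row N j k. \<phi> (x $ l)) = (\<Sum>x\<in>lattice_row N j k'. \<phi> (x $ l))"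
  using sum.reindex_bij_betw[OF bij_betw_lattice_row[of k N j k', OF assms(1,2)], of "\<lambda>x. \<phi> (x $ l)"] assms(3)
  by simp

text \<open>The rows have equal sums and these add up to zero, so each of them is zero.\<close>

lemma sum_lattice_row_other_zero:
  fixes \<phi> :: "real \<Rightarrow> real"
  assumes "(\<Sum>x\<in>lattice_design N. \<phi> (x $ l)) = 0" "k \<in> {1..N j}" "l \<noteq> j"
  shows "(\<Sum>x\<in>lattice_row N j k. \<phi> (x $ l)) = 0"
proof -
  have "0 = (\<Sum>k'=1..N j. \<Sum>x\<in>lattice_row N j k'. \<phi> (x $ l))"
    using assms(1) by (simp add: sum_lattice_rows[of _ N j])
  also have "\<dots> = (\<Sum>k'=1..N j. \<Sum>x\<in>lattice_row N j k. \<phi> (x $ l))"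
    using assms by (intro sum.cong refl sum_lattice_row_other) auto
  finally show ?thesis using assms(2) by auto
qed

lemma card_lattice_row:
  assumes "k \<in> {1..N j}"
  shows "N j * card (lattice_row N j k) = (\<Prod>l\<in>UNIV. N l)"
proof -
  have "card (lattice_design N) = (\<Sum>k'=1..N j. card (lattice_row N j k'))"
    unfolding lattice_design_rows[of N j]
    by (rule card_UN_disjoint) (use lattice_row_inject[of _ N j] in \<open>auto simp: disjoint_iff\<close>)
  also have "\<dots> = (\<Sum>k'=1..N j. card (lattice_row N j k))"
    by (intro sum.cong refl bij_betw_same_card[OF bij_betw_lattice_row]) (use assms in auto)
  finally show ?thesis by (simp add: finite_card_lattice_design)
qed

lemma sum_centered: "(\<Sum>k=1..n. centered n g (real k / real n)) = 0"
  by (cases "n = 0") (simp_all add: centered_def sum_subtractf)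

lemma sum_lattice_centered:
  "(\<Sum>x\<in>lattice_design N. centered (N l) g (x $ l)) = 0"
proof -
  have "(\<Sum>x\<in>lattice_design N. centered (N l) g (x $ l)) =
      (\<Sum>k=1..N l. real (card (lattice_row N l k)) * centered (N l) g (real k / real (N l)))"
    unfolding sum_lattice_rows[of _ N l] by (intro sum.cong refl) (simp add: lattice_row_def)
  also have "\<dots> = (\<Sum>k=1..N l. real (\<Prod>l\<in>UNIV. N l) / real (N l) * centered (N l) g (real k / real (N l)))"
  proof (intro sum.cong refl)
    fix k assume k: "k \<in> {1..N l}"
    have "real (card (lattice_row N l k)) = real (\<Prod>l\<in>UNIV. N l) / real (N l)"
      unfolding card_lattice_row[where N = N and j = l, OF k, symmetric] using k by auto
    then show "real (card (lattice_row N l k)) * centered (N l) g (real k / real (N l)) =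
      real (\<Prod>l\<in>UNIV. N l) / real (N l) * centered (N l) g (real k / real (N l))" by simp
  qed
  also have "\<dots> = real (\<Prod>l\<in>UNIV. N l) / real (N l) * (\<Sum>k=1..N l. centered (N l) g (real k / real (N l)))"
    by (rule sum_distrib_left[symmetric])
  also have "\<dots> = 0" by (simp only: sum_centered mult_zero_right)
  finally show ?thesis .
qed

text \<open>First-order condition at the left end of an interval: the right derivative of the
  quadratic at 0 is \<open>- 2 * B\<close>.\<close>

lemma quadratic_min_at_zero:
  fixes A B \<delta> :: real
  assumes "0 < \<delta>" and "\<And>t. 0 \<le> t \<Longrightarrow> t \<le> \<delta> \<Longrightarrow> 0 \<le> t\<^sup>2 * A - 2 * t * B"
  shows "B \<le> 0"
proof (rule ccontr)
  assume "\<not> B \<le> 0"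
  then have B: "0 < B" by simp
  \<comment> \<open>The sign of \<open>A\<close> is open, so the step is taken small against
    \<open>\<bar>A\<bar> + 1\<close>; then \<open>t * A \<le> B\<close> and the linear term
    wins.\<close>
  define t where "t = min \<delta> (B / (\<bar>A\<bar> + 1))"
  have t: "0 < t" "t \<le> \<delta>" "t * (\<bar>A\<bar> + 1) \<le> B"
    using assms(1) B by (auto simp: t_def min_def pos_divide_le_eq pos_le_divide_eq)
  have "t * A \<le> B"
    using t mult_left_mono[of A "\<bar>A\<bar> + 1" t] by linarith
  then have "t * (t * A - 2 * B) < 0" using t B by (intro mult_pos_neg) auto
  with assms(2)[of t] t show False by (simp add: power2_eq_square algebra_simps)
qed

text \<open>The competitor changes one component and need not be centred, since minimality ranges
  over all monotone tuples. Its values are prescribed at design points only, which leaves freedom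
  between them to keep it monotone.\<close>

lemma lse_residual_variation:
  fixes N :: "'d::finite \<Rightarrow> nat"
  assumes lse: "additive_isotonic_lse N Y \<mu> f"
    and mono: "mono_on {0..1} h"
    and h: "\<And>x. x \<in> lattice_design N \<Longrightarrow> h (x $ j) = f j (x $ j) + (if x \<in> S then t else 0)"
    and S: "S \<subseteq> lattice_design N"
  shows "0 \<le> t\<^sup>2 * real (card S) - 2 * t * (\<Sum>x\<in>S. Y x - \<mu> - (\<Sum>l\<in>UNIV. f l (x $ l)))"
proof -
  let ?R = "\<lambda>x. Y x - \<mu> - (\<Sum>l\<in>UNIV. f l (x $ l))"
  define f' where "f' = f(j := h)"
  have fin: "finite S" using S finite_card_lattice_design(1) finite_subset by blast
  have "\<forall>l. mono_on {0..1} (f' l)"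
    using lse mono by (auto simp: additive_isotonic_lse_def f'_def)
  then have "rss N Y \<mu> f \<le> rss N Y \<mu> f'"
    using lse by (auto simp: additive_isotonic_lse_def)
  also have "rss N Y \<mu> f' = (\<Sum>x\<in>lattice_design N. (?R x)\<^sup>2 + (if x \<in> S then t\<^sup>2 - 2 * t * ?R x else 0))"
    unfolding rss_def
  proof (intro sum.cong refl)
    fix x assume x: "x \<in> lattice_design N"
    have "(\<Sum>l\<in>UNIV. f' l (x $ l)) = h (x $ j) + (\<Sum>l\<in>UNIV - {j}. f l (x $ l))"
      by (subst sum.remove[of _ j]) (auto simp: f'_def intro!: sum.cong)
    moreover have "(\<Sum>l\<in>UNIV. f l (x $ l)) = f j (x $ j) + (\<Sum>l\<in>UNIV - {j}. f l (x $ l))"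
      by (subst sum.remove[of _ j]) auto
    ultimately have "(\<Sum>l\<in>UNIV. f' l (x $ l)) = (\<Sum>l\<in>UNIV. f l (x $ l)) + (if x \<in> S then t else 0)"
      using h[OF x] by simp
    then show "(Y x - \<mu> - (\<Sum>l\<in>UNIV. f' l (x $ l)))\<^sup>2 = (?R x)\<^sup>2 + (if x \<in> S then t\<^sup>2 - 2 * t * ?R x else 0)"
      by (simp add: power2_eq_square algebra_simps)
  qed
  also have "\<dots> = rss N Y \<mu> f + (\<Sum>x\<in>S. t\<^sup>2 - 2 * t * ?R x)"
    unfolding sum.distrib rss_def using S
    by (simp add: sum.inter_restrict[symmetric] finite_card_lattice_design(1) Int_absorb1)
  also have "(\<Sum>x\<in>S. t\<^sup>2 - 2 * t * ?R x) = t\<^sup>2 * real (card S) - 2 * t * (\<Sum>x\<in>S. ?R x)"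
    unfolding sum_subtractf[of "\<lambda>_. t\<^sup>2"] sum_distrib_left[of "2 * t" ?R] by simp
  finally show ?thesis by linarith
qed

text \<open>Translating the part of one component to the right of a grid point upwards is always
  admissible, and downwards it is admissible at a jump. The residual sums therefore satisfy the
  optimality conditions of the isotonic regression of the row means, because on a full lattice
  the other components do not contribute to the row sums.\<close>

lemma lse_isotonic_kkt:
  fixes N :: "'d::finite \<Rightarrow> nat"
  assumes lse: "additive_isotonic_lse N Y \<mu> f" and pos: "\<And>l. 1 \<le> N l"
    and J: "\<And>k. k \<in> {1..N j} \<Longrightarrow> real (card (lattice_row N j k)) = J" "0 < J"
  shows "isotonic_kkt (N j) (\<lambda>k. (\<Sum>x\<in>lattice_row N j k. Y x) / J - \<mu>) (\<lambda>k. f j (real k / real (N j)))"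
    and "(\<Sum>k=1..N j. f j (real k / real (N j))) = 0"
proof -
  let ?R = "\<lambda>x. Y x - \<mu> - (\<Sum>l\<in>UNIV. f l (x $ l))"
  let ?n = "N j"
  define y where "y k = (\<Sum>x\<in>lattice_row N j k. Y x) / J - \<mu>" for k
  define h where "h k = f j (real k / real ?n)" for k
  have n: "1 \<le> ?n" by (rule pos)
  have mono: "mono_on {0..1} (f j)" using lse by (simp add: additive_isotonic_lse_def)
  have monoh: "h i \<le> h i'" if "i \<le> i'" "i' \<le> ?n" for i i'
    unfolding h_def using mono by (rule mono_onD) (use n that in \<open>auto simp: divide_right_mono\<close>)
  have zero: "(\<Sum>x\<in>lattice_design N. f l (x $ l)) = 0" for l
    using lse by (simp add: additive_isotonic_lse_def)
  have row: "(\<Sum>x\<in>lattice_row N j k. ?R x) = J * (y k - h k)" if k: "k \<in> {1..?n}" for k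
  proof -
    have "(\<Sum>x\<in>lattice_row N j k. \<Sum>l\<in>UNIV. f l (x $ l)) = (\<Sum>l\<in>UNIV. \<Sum>x\<in>lattice_row N j k. f l (x $ l))"
      by (rule sum.swap)
    also have "\<dots> = (\<Sum>x\<in>lattice_row N j k. f j (x $ j)) + (\<Sum>l\<in>UNIV - {j}. \<Sum>x\<in>lattice_row N j k. f l (x $ l))"
      by (rule sum.remove) auto
    also have "(\<Sum>l\<in>UNIV - {j}. \<Sum>x\<in>lattice_row N j k. f l (x $ l)) = 0"
      by (intro sum.neutral ballI sum_lattice_row_other_zero zero k) auto
    also have "(\<Sum>x\<in>lattice_row N j k. f j (x $ j)) = (\<Sum>x\<in>lattice_row N j k. h k)"
      by (intro sum.cong) (auto simp: lattice_row_def h_def)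
    finally have "(\<Sum>x\<in>lattice_row N j k. \<Sum>l\<in>UNIV. f l (x $ l)) = J * h k"
      using J k by simp
    then show ?thesis
      using J(1)[OF k] J(2)
      unfolding sum_subtractf[of "\<lambda>x. Y x - \<mu>"] sum_subtractf[of Y] by (simp add: y_def algebra_simps)
  qed
  have upper: "(\<Sum>x\<in>{x\<in>lattice_design N. real k / real ?n < x $ j}. ?R x) = J * (\<Sum>i\<in>{k<..?n}. y i - h i)"
    (is "sum _ ?S = _") for k
  proof -
    have "(\<Sum>x\<in>?S. ?R x) = (\<Sum>x\<in>lattice_design N. if x \<in> ?S then ?R x else 0)"
      by (subst sum.inter_restrict[symmetric]) (auto simp: finite_card_lattice_design(1) intro!: sum.cong)
    also have "\<dots> = (\<Sum>i=1..?n. \<Sum>x\<in>lattice_row N j i. if x \<in> ?S then ?R x else 0)"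
      by (rule sum_lattice_rows)
    also have "\<dots> = (\<Sum>i=1..?n. if k < i then J * (y i - h i) else 0)"
    proof (intro sum.cong refl)
      fix i assume i: "i \<in> {1..?n}"
      have "(\<Sum>x\<in>lattice_row N j i. if x \<in> ?S then ?R x else 0) =
          (\<Sum>x\<in>lattice_row N j i. if k < i then ?R x else 0)"
        using n by (intro sum.cong refl) (auto simp: lattice_row_def divide_less_cancel)
      then show "(\<Sum>x\<in>lattice_row N j i. if x \<in> ?S then ?R x else 0) = (if k < i then J * (y i - h i) else 0)"
        using row[OF i] by (cases "k < i") (simp_all only: if_True if_False sum.neutral_const)
    qed
    also have "\<dots> = (\<Sum>i\<in>{k<..?n}. J * (y i - h i))"
      by (simp add: sum.If_cases) (intro sum.cong, auto)
    finally show ?thesis by (simp add: sum_distrib_left)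
  qed
  have up: "(\<Sum>i\<in>{k<..?n}. y i - h i) \<le> 0" if k: "k \<le> ?n" for k
  proof -
    let ?S = "{x\<in>lattice_design N. real k / real ?n < x $ j}"
    have "(\<Sum>x\<in>?S. ?R x) \<le> 0"
    proof (rule quadratic_min_at_zero[where \<delta> = 1 and A = "real (card ?S)"])
      fix t :: real assume t: "0 \<le> t" "t \<le> 1"
      show "0 \<le> t\<^sup>2 * real (card ?S) - 2 * t * (\<Sum>x\<in>?S. ?R x)"
      proof (rule lse_residual_variation[OF lse])
        show "mono_on {0..1} (\<lambda>z. f j z + (if real k / real ?n < z then t else 0))"
        proof (rule mono_onI)
          fix r s :: real assume "r \<in> {0..1}" "s \<in> {0..1}" "r \<le> s"
          moreover have "f j r \<le> f j s" using mono_onD[OF mono] calculation by blast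
          ultimately show "f j r + (if real k / real ?n < r then t else 0) \<le> f j s + (if real k / real ?n < s then t else 0)"
            using t by auto
        qed
      qed auto
    qed simp
    then show ?thesis unfolding upper using J(2) by (simp add: mult_le_0_iff)
  qed
  have down: "0 \<le> (\<Sum>i\<in>{k<..?n}. y i - h i)" if k: "k < ?n" and jump: "k = 0 \<or> h k < h (Suc k)" for k
  proof -
    let ?S = "{x\<in>lattice_design N. real k / real ?n < x $ j}"
    \<comment> \<open>A floor for the lowered part and the room above it. For \<open>k = 0\<close>
      the set is the whole lattice and no jump is required: all of the function can be lowered, and
      the room 1 is arbitrary.\<close>
    define b where "b = (if k = 0 then f j 0 - 1 else h k)"
    define \<delta> where "\<delta> = (if k = 0 then 1 else h (Suc k) - h k)"
    have \<delta>: "0 < \<delta>" using jump by (auto simp: \<delta>_def)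
    have b: "f j z \<le> b + \<delta>" if "0 \<le> z" "z \<le> real k / real ?n" for z
    proof (cases "k = 0")
      case True then show ?thesis using that by (simp add: b_def \<delta>_def)
    next
      case False
      have "f j z \<le> h k" unfolding h_def by (rule mono_onD[OF mono]) (use that k order_trans[of z "real k / real ?n" 1] in auto)
      then show ?thesis using False \<delta> by (simp add: b_def)
    qed
    have b2: "b + \<delta> \<le> f j (real i / real ?n)" if "k < i" "i \<le> ?n" for i
    proof (cases "k = 0")
      case True
      have "f j 0 \<le> f j (real i / real ?n)" by (rule mono_onD[OF mono]) (use that in auto)
      then show ?thesis using True by (simp add: b_def \<delta>_def)
    next
      case False
      then show ?thesis using monoh[of "Suc k" i] that by (simp add: b_def \<delta>_def h_def[of i])
    qed
    have "- (\<Sum>x\<in>?S. ?R x) \<le> 0"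
    proof (rule quadratic_min_at_zero[where \<delta> = \<delta> and A = "real (card ?S)"])
      fix t :: real assume t: "0 \<le> t" "t \<le> \<delta>"
      \<comment> \<open>Just to the right of \<open>k / n\<close> the function may lie less than
        \<delta> above its value there, so plain lowering could break monotonicity. Truncation at
        \<open>b\<close> repairs this and, by \<open>b2\<close>, is inactive at the design
        points.\<close>
      define h' where "h' z = (if z \<le> real k / real ?n then f j z - (if k = 0 then t else 0)
        else max b (f j z - t))" for z
      have "0 \<le> (- t)\<^sup>2 * real (card ?S) - 2 * (- t) * (\<Sum>x\<in>?S. ?R x)"
      proof (rule lse_residual_variation[OF lse])
        show "mono_on {0..1} h'"
        proof (rule mono_onI)
          fix r s :: real assume rs: "r \<in> {0..1}" "s \<in> {0..1}" "r \<le> s"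
          have le: "f j r \<le> f j s" using mono_onD[OF mono] rs by blast
          show "h' r \<le> h' s"
          proof (cases "r \<le> real k / real ?n \<and> \<not> s \<le> real k / real ?n")
            case True
            show ?thesis
            proof (cases "k = 0")
              case True
              then show ?thesis using le t \<open>r \<le> real k / real ?n \<and> \<not> s \<le> real k / real ?n\<close> by (auto simp: h'_def)
            next
              case False
              have "f j r \<le> h k" unfolding h_def
                by (rule mono_onD[OF mono]) (use True rs k in \<open>auto simp: field_simps\<close>)
              then show ?thesis using False True by (auto simp: h'_def b_def)
            qed
          next
            case False
            then show ?thesis using le rs by (auto simp: h'_def)
          qed
        qed
      next
        fix x assume x: "x \<in> lattice_design N"
        then have "x $ j \<in> grid ?n" by (simp add: lattice_design_def)
        then obtain i where i: "i \<in> {1..?n}" "x $ j = real i / real ?n"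
          by (auto simp: grid_def)
        have iff: "real i / real ?n \<le> real k / real ?n \<longleftrightarrow> i \<le> k"
          using n by (simp add: divide_le_cancel)
        show "h' (x $ j) = f j (x $ j) + (if x \<in> ?S then - t else 0)"
          using x iff i b2[of i] t by (auto simp: h'_def max_def)
      qed auto
      then show "0 \<le> t\<^sup>2 * real (card ?S) - 2 * t * - (\<Sum>x\<in>?S. ?R x)" by simp
    qed (fact \<delta>)
    then show ?thesis unfolding upper using J(2) by (simp add: zero_le_mult_iff)
  qed
  \<comment> \<open>At \<open>k = 0\<close> both variations are admissible, so the total residual
    vanishes.\<close>
  have total: "(\<Sum>i=1..?n. y i - h i) = 0"
  proof -
    have "{0<..?n} = {1..?n}" by auto
    then show ?thesis using up[of 0] down[of 0] n by (simp only:) linarith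
  qed
  have E: "(\<Sum>i=1..k. y i - h i) = - (\<Sum>i\<in>{k<..?n}. y i - h i)" if "k \<le> ?n" for k
    using sum_telescope_interval[of k ?n "\<lambda>i. y i - h i"] total that by linarith
  show "isotonic_kkt ?n (\<lambda>k. (\<Sum>x\<in>lattice_row N j k. Y x) / J - \<mu>) (\<lambda>k. f j (real k / real ?n))"
    unfolding isotonic_kkt_def y_def[symmetric] h_def[symmetric]
  proof (intro conjI ballI allI impI)
    show "mono_on {1..?n} h" by (rule mono_onI) (use monoh in auto)
    show "0 \<le> (\<Sum>i=1..k. y i - h i)" if "k \<le> ?n" for k
      using E[OF that] up[OF that] by linarith
    show "(\<Sum>i=1..k. y i - h i) = 0" if "k \<in> {1..<?n}" "h k < h (Suc k)" for k
      using E[of k] up[of k] down[of k] that by auto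
  qed (fact total)
  have "0 = (\<Sum>k=1..?n. \<Sum>x\<in>lattice_row N j k. f j (x $ j))"
    using zero[of j] by (simp add: sum_lattice_rows[of _ N j])
  also have "\<dots> = (\<Sum>k=1..?n. J * h k)"
    using J by (intro sum.cong refl) (simp add: lattice_row_def h_def)
  also have "\<dots> = J * (\<Sum>k=1..?n. h k)" by (simp add: sum_distrib_left)
  finally show "(\<Sum>k=1..?n. f j (real k / real ?n)) = 0" using J(2) by (simp add: h_def)
qed

section \<open>Blocks of constancy and the rescaled one-dimensional problem\<close>

text \<open>By monotonicity, points of \<open>X\<close> between \<open>x\<close> and
  \<open>x0\<close> share their value as soon as the two ends do. So the maximal run of consecutive
  points is simply the level set.\<close>

lemma block_interval_iff:
  assumes X: "finite X" "x0 \<in> X" and mono: "mono_on X f" and x: "x \<in> X"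
  shows "x \<in> {block_lower X f x0..block_upper X f x0} \<longleftrightarrow> f x = f x0"
proof -
  let ?A = "{v\<in>X. v \<le> x0 \<and> (\<forall>x\<in>X. v \<le> x \<and> x \<le> x0 \<longrightarrow> f x = f x0)}"
  let ?B = "{u\<in>X. x0 \<le> u \<and> (\<forall>x\<in>X. x0 \<le> x \<and> x \<le> u \<longrightarrow> f x = f x0)}"
  have "block_lower X f x0 \<in> ?A" "block_upper X f x0 \<in> ?B"
    unfolding block_lower_def block_upper_def
    using X by (intro Min_in Max_in; force)+
  then have 1: "f x = f x0" if "x \<in> {block_lower X f x0..block_upper X f x0}"
    using that x by (cases "x \<le> x0") auto
  have 2: "block_lower X f x0 \<le> x \<and> x \<le> block_upper X f x0" if fx: "f x = f x0"
  proof (cases "x \<le> x0")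
    case True
    have "f z = f x0" if "z \<in> X" "x \<le> z" "z \<le> x0" for z
      using mono_onD[OF mono x that(1,2)] mono_onD[OF mono that(1) X(2) that(3)] fx by linarith
    then have A: "x \<in> ?A" using True x by blast
    have "block_lower X f x0 \<le> x"
      unfolding block_lower_def by (rule Min_le[OF _ A]) (use X in simp)
    moreover have "x0 \<le> block_upper X f x0" using \<open>block_upper X f x0 \<in> ?B\<close> by auto
    ultimately show ?thesis using True by auto
  next
    case False
    have "f z = f x0" if "z \<in> X" "x0 \<le> z" "z \<le> x" for z
      using mono_onD[OF mono that(1) x that(3)] mono_onD[OF mono X(2) that(1,2)] fx by linarith
    then have B: "x \<in> ?B" using False x by force
    have "x \<le> block_upper X f x0"
      unfolding block_upper_def by (rule Max_ge[OF _ B]) (use X in simp)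
    moreover have "block_lower X f x0 \<le> x0" using \<open>block_lower X f x0 \<in> ?A\<close> by auto
    ultimately show ?thesis using False by auto
  qed
  show ?thesis
    unfolding atLeastAtMost_iff using 1[unfolded atLeastAtMost_iff] 2 by blast
qed

lemma block_count_eq_card:
  fixes N :: "'d::finite \<Rightarrow> nat"
  assumes k0: "k0 \<in> {1..N j}" and mono: "mono_on {0..1} f"
    and J: "\<And>k. k \<in> {1..N j} \<Longrightarrow> real (card (lattice_row N j k)) = J"
  shows "block_count N j f (real k0 / real (N j)) =
    J * real (card {k\<in>{1..N j}. f (real k / real (N j)) = f (real k0 / real (N j))})"
proof -
  let ?n = "N j" let ?x0 = "real k0 / real ?n"
  let ?I = "{block_lower (grid ?n) f ?x0..block_upper (grid ?n) f ?x0}"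
  have sub: "grid ?n \<subseteq> {0..1}" by (auto simp: grid_def)
  have iff: "real k / real ?n \<in> ?I \<longleftrightarrow> f (real k / real ?n) = f ?x0" if "k \<in> {1..?n}" for k
    using k0 that by (intro block_interval_iff grid_memI mono_on_subset[OF mono sub]) (auto simp: grid_def)
  have "block_count N j f ?x0 = (\<Sum>k=1..?n. \<Sum>x\<in>lattice_row N j k. indicator ?I (x $ j))"
    unfolding block_count_def by (rule sum_lattice_rows)
  also have "\<dots> = (\<Sum>k=1..?n. \<Sum>x\<in>lattice_row N j k. if f (real k / real ?n) = f ?x0 then 1 else 0)"
    using iff by (intro sum.cong refl) (auto simp: lattice_row_def indicator_def)
  also have "\<dots> = (\<Sum>k=1..?n. J * (if f (real k / real ?n) = f ?x0 then 1 else 0))"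
    using J by (intro sum.cong refl) auto
  also have "\<dots> = J * (\<Sum>k=1..?n. if f (real k / real ?n) = f ?x0 then 1 else 0)"
    by (simp add: sum_distrib_left)
  also have "(\<Sum>k=1..?n. if f (real k / real ?n) = f ?x0 then 1 else 0) =
      real (card {k\<in>{1..?n}. f (real k / real ?n) = f ?x0})"
    by (simp add: sum.If_cases Int_def)
  finally show ?thesis .
qed

lemma isotonic_kkt_affine:
  assumes kkt: "isotonic_kkt n y h" and c: "0 < c"
    and y': "\<And>k. k \<in> {1..n} \<Longrightarrow> y' k = c * (y k - b)" and h': "\<And>k. k \<in> {1..n} \<Longrightarrow> h' k = c * (h k - b)"
  shows "isotonic_kkt n y' h'"
proof -
  have E: "(\<Sum>i=1..k. y' i - h' i) = c * (\<Sum>i=1..k. y i - h i)" if "k \<le> n" for k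
    unfolding sum_distrib_left using that by (intro sum.cong) (auto simp: y' h' algebra_simps)
  have "mono_on {1..n} h'"
  proof (rule mono_onI)
    fix r s assume rs: "r \<in> {1..n}" "s \<in> {1..n}" "r \<le> s"
    then have "h r \<le> h s" using kkt by (auto simp: isotonic_kkt_def mono_on_def)
    then show "h' r \<le> h' s" using c rs by (simp add: h')
  qed
  then show ?thesis
    using kkt c E unfolding isotonic_kkt_def by (auto simp: h')
qed

text \<open>A row has n_j^2 points, so \<open>W k\<close> is a row sum divided by its standard
  deviation, and the factor n_j coming from the square root of the block count rescales the
  estimation error. The last term of \<open>y\<close> is the rescaled error of the estimated
  intercept; the centering constants cancel because only differences of \<open>g j\<close>
  occur.\<close>

lemma block_statistic_isotonic:
  fixes N :: "'d::finite \<Rightarrow> nat"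
  assumes lse: "additive_isotonic_lse N (additive_response N \<mu> g e) \<mu>' f"
    and pos: "\<And>l. 1 \<le> N l" and sq: "(\<Prod>l\<in>UNIV. N l) = N j ^ 3"
    and k0: "k0 \<in> {1..N j}" and x0: "x0 = real k0 / real (N j)" and \<sigma>: "\<sigma> > 0"
    and W: "\<And>k. W k = (\<Sum>x\<in>lattice_row N j k. e x) / (\<sigma> * real (N j))"
    and y: "\<And>k. y k = \<sigma> * W k + real (N j) * (g j (real k / real (N j)) - g j x0)
                - \<sigma> * (\<Sum>i=1..N j. W i) / real (N j)"
  shows "\<exists>h. isotonic_kkt (N j) y h \<and>
    sqrt (block_count N j (f j) x0) * (f j x0 - centered (N j) (g j) x0) =
      sqrt (real (card {k\<in>{1..N j}. h k = h k0})) * h k0"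
proof -
  let ?n = "N j" let ?Y = "additive_response N \<mu> g e"
  let ?c = "centered ?n (g j)"
  define J where "J = real ?n ^ 2"
  have n: "1 \<le> ?n" by (rule pos)
  have J: "real (card (lattice_row N j k)) = J" if "k \<in> {1..?n}" for k
  proof -
    have "?n * card (lattice_row N j k) = ?n * ?n ^ 2"
      using card_lattice_row[where N = N and j = j, OF that] sq by (auto simp: power3_eq_cube power2_eq_square)
    then show ?thesis using n by (simp add: J_def)
  qed
  have J0: "0 < J" using n by (simp add: J_def)
  have mono: "mono_on {0..1} (f j)" using lse by (simp add: additive_isotonic_lse_def)
  let ?h = "\<lambda>k. f j (real k / real ?n)"
  have kkt: "isotonic_kkt ?n (\<lambda>k. (\<Sum>x\<in>lattice_row N j k. ?Y x) / J - \<mu>') ?h"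
    and h0: "(\<Sum>k=1..?n. ?h k) = 0"
    using lse_isotonic_kkt[OF lse pos J J0] by auto
  have rowY: "(\<Sum>x\<in>lattice_row N j k. ?Y x) = J * (\<mu> + ?c (real k / real ?n)) + \<sigma> * real ?n * W k"
    if k: "k \<in> {1..?n}" for k
  proof -
    have "(\<Sum>x\<in>lattice_row N j k. \<Sum>l\<in>UNIV. centered (N l) (g l) (x $ l)) =
        (\<Sum>l\<in>UNIV. \<Sum>x\<in>lattice_row N j k. centered (N l) (g l) (x $ l))" by (rule sum.swap)
    also have "\<dots> = (\<Sum>x\<in>lattice_row N j k. ?c (x $ j)) +
        (\<Sum>l\<in>UNIV - {j}. \<Sum>x\<in>lattice_row N j k. centered (N l) (g l) (x $ l))"
      by (rule sum.remove) auto
    also have "(\<Sum>l\<in>UNIV - {j}. \<Sum>x\<in>lattice_row N j k. centered (N l) (g l) (x $ l)) = 0"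
      by (intro sum.neutral ballI sum_lattice_row_other_zero k sum_lattice_centered) auto
    also have "(\<Sum>x\<in>lattice_row N j k. ?c (x $ j)) = (\<Sum>x\<in>lattice_row N j k. ?c (real k / real ?n))"
      by (intro sum.cong) (auto simp: lattice_row_def)
    finally have "(\<Sum>x\<in>lattice_row N j k. \<Sum>l\<in>UNIV. centered (N l) (g l) (x $ l)) = J * ?c (real k / real ?n)"
      using J k by simp
    moreover have "(\<Sum>x\<in>lattice_row N j k. e x) = \<sigma> * real ?n * W k"
      using \<sigma> n by (simp add: W)
    ultimately show ?thesis
      using J k by (simp add: additive_response_def sum.distrib algebra_simps)
  qed
  \<comment> \<open>The total residual is zero and both the fitted and the true component are
    centred, so the intercept error is the grand mean of the noise.\<close>
  have mu: "real ?n * J * (\<mu>' - \<mu>) = \<sigma> * real ?n * (\<Sum>k=1..?n. W k)"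
  proof -
    have "(\<Sum>k=1..?n. (\<Sum>x\<in>lattice_row N j k. ?Y x) / J - \<mu>' - ?h k) = 0"
      using kkt by (simp add: isotonic_kkt_def)
    also have "(\<Sum>k=1..?n. (\<Sum>x\<in>lattice_row N j k. ?Y x) / J - \<mu>' - ?h k) =
        (\<Sum>k=1..?n. (\<mu> - \<mu>') + ?c (real k / real ?n) + \<sigma> * real ?n / J * W k - ?h k)"
      using J0 by (intro sum.cong refl) (simp add: rowY add_divide_distrib)
    also have "\<dots> = real ?n * (\<mu> - \<mu>') + \<sigma> * real ?n / J * (\<Sum>k=1..?n. W k)"
      unfolding sum_subtractf sum.distrib h0 sum_centered by (simp add: sum_distrib_left right_diff_distrib)
    finally show ?thesis using J0 by (simp add: field_simps)
  qed
  define H where "H k = real ?n * (?h k - ?c x0)" for k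
  have yk: "y k = real ?n * ((\<Sum>x\<in>lattice_row N j k. ?Y x) / J - \<mu>' - ?c x0)" if k: "k \<in> {1..?n}" for k
  proof -
    have "(\<Sum>x\<in>lattice_row N j k. ?Y x) / J = \<mu> + ?c (real k / real ?n) + \<sigma> * real ?n * W k / J"
      using J0 by (simp add: rowY[OF k] add_divide_distrib)
    moreover have "real ?n * (\<sigma> * real ?n * W k / J) = \<sigma> * W k"
      using n by (simp add: J_def power2_eq_square)
    moreover have "real ?n * (\<mu>' - \<mu>) = \<sigma> * (\<Sum>k=1..?n. W k) / real ?n"
    proof -
      have "real ?n * (real ?n * (\<mu>' - \<mu>) * real ?n) = real ?n * (\<sigma> * (\<Sum>k=1..?n. W k))"
        using mu by (simp add: J_def power2_eq_square algebra_simps)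
      then have "real ?n * (\<mu>' - \<mu>) * real ?n = \<sigma> * (\<Sum>k=1..?n. W k)" using n by simp
      then show ?thesis using n by (simp add: eq_divide_eq)
    qed
    moreover have gc: "g j (real k / real ?n) - g j x0 = ?c (real k / real ?n) - ?c x0"
      by (simp add: centered_def)
    ultimately show ?thesis
      unfolding y gc by (simp add: algebra_simps)
  qed
  have kktH: "isotonic_kkt ?n y H"
    by (rule isotonic_kkt_affine[OF kkt, of "real ?n" _ "?c x0"]) (use n yk H_def in auto)
  have "block_count N j (f j) x0 = J * real (card {k\<in>{1..?n}. ?h k = ?h k0})"
    unfolding x0 by (rule block_count_eq_card[OF k0 mono J])
  also have "{k\<in>{1..?n}. ?h k = ?h k0} = {k\<in>{1..?n}. H k = H k0}"
    using n by (auto simp: H_def)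
  finally have "sqrt (block_count N j (f j) x0) * (f j x0 - ?c x0) =
      sqrt (real (card {k\<in>{1..?n}. H k = H k0})) * H k0"
    using n by (simp add: J_def real_sqrt_mult H_def x0)
  with kktH show ?thesis by blast
qed

section \<open>The limit problem\<close>

text \<open>By the sign convention of the walk, \<open>S(r) - S(-l)\<close> adds up r + l noise
  variables; this and \<open>left_sum\<close> are its two halves.\<close>

definition right_sum :: "(int \<Rightarrow> real) \<Rightarrow> nat \<Rightarrow> real" where
  "right_sum z r = (\<Sum>i=1..r. z (int i))"

definition left_sum :: "(int \<Rightarrow> real) \<Rightarrow> nat \<Rightarrow> real" where
  "left_sum z l = (\<Sum>i=1..l. z (- int i))"

text \<open>All that the deterministic arguments use about the noise. A linear bound suffices
  against a quadratic drift, and a single \<open>H\<close> can serve all designs up to a small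
  probability.\<close>

definition walk_bounded :: "real \<Rightarrow> (int \<Rightarrow> real) \<Rightarrow> bool" where
  "walk_bounded H z \<longleftrightarrow> (\<forall>r. \<bar>right_sum z r\<bar> \<le> H * real r \<and> \<bar>left_sum z r\<bar> \<le> H * real r)"

lemma sum_int_interval: "(\<Sum>i=1..int r. f i) = (\<Sum>i=1..r. f (int i))"
proof -
  have "{1..int r} = int ` {1..r}"
    using image_int_atLeastAtMost[of 1 r] by simp
  then show ?thesis by (simp add: sum.reindex)
qed

lemma two_sided_walk_simps:
  "two_sided_walk z (int r) = right_sum z r" "two_sided_walk z (- int l) = - left_sum z l"
proof -
  show "two_sided_walk z (int r) = right_sum z r"
    unfolding two_sided_walk_def right_sum_def by (simp only: sum_int_interval) simp
  show "two_sided_walk z (- int l) = - left_sum z l"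
  proof (cases "l = 0")
    case False
    then have "two_sided_walk z (- int l) = - (\<Sum>i=1..int l. z (- i))"
      unfolding two_sided_walk_def by simp
    then show ?thesis unfolding left_sum_def sum_int_interval[of "\<lambda>i. z (- i)"] .
  qed (simp add: two_sided_walk_def left_sum_def)
qed

text \<open>Sums of the limit data \<sigma> * noise + \<open>a\<close> * offset over the two halves
  of a block. The centre, with offset 0, is counted in the left half; hence
  \<open>r * (r + 1) / 2\<close> on the right but \<open>l * (l - 1) / 2\<close> on the
  left.\<close>

definition crit_right :: "real \<Rightarrow> real \<Rightarrow> (int \<Rightarrow> real) \<Rightarrow> nat \<Rightarrow> real" where
  "crit_right \<sigma> a z r = \<sigma> * right_sum z r + a * (real r * (real r + 1) / 2)"

definition crit_left :: "real \<Rightarrow> real \<Rightarrow> (int \<Rightarrow> real) \<Rightarrow> nat \<Rightarrow> real" where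
  "crit_left \<sigma> a z l = \<sigma> * left_sum z l - a * (real l * (real l - 1) / 2)"

lemma crit_obj_walk:
  "crit_obj \<sigma> a z r l = \<sigma> * (right_sum z r + left_sum z l) / (real r + real l) + a * (real r - real l + 1) / 2"
  by (simp add: crit_obj_def two_sided_walk_simps ring_distribs)

text \<open>The deterministic term \<open>a * (r - l + 1) / 2\<close> is the mean of the linear
  drift over the offsets from 1 - l to r. The objective is therefore a block average, as in the
  min-max formula of isotonic regression.\<close>

lemma crit_obj_average:
  assumes "1 \<le> l"
  shows "crit_obj \<sigma> a z r l = (crit_right \<sigma> a z r + crit_left \<sigma> a z l) / (real r + real l)"
proof -
  have "a * (real r - real l + 1) / 2 = (a * (real r * (real r + 1) / 2) - a * (real l * (real l - 1) / 2)) / (real r + real l)"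
    using assms by (simp add: field_simps)
  then have "crit_obj \<sigma> a z r l = (\<sigma> * (right_sum z r + left_sum z l) +
      (a * (real r * (real r + 1) / 2) - a * (real l * (real l - 1) / 2))) / (real r + real l)"
    unfolding crit_obj_walk by (simp only: add_divide_distrib)
  also have "\<sigma> * (right_sum z r + left_sum z l) + (a * (real r * (real r + 1) / 2) - a * (real l * (real l - 1) / 2)) =
      crit_right \<sigma> a z r + crit_left \<sigma> a z l"
    by (simp add: crit_right_def crit_left_def distrib_left)
  finally show ?thesis .
qed

text \<open>Injectivity is stronger than uniqueness of the optimizers, but it splits into countably
  many pairwise events, and it makes both inequalities of the saddle strict.\<close>

definition crit_no_ties :: "real \<Rightarrow> real \<Rightarrow> (int \<Rightarrow> real) \<Rightarrow> bool" where
  "crit_no_ties \<sigma> a z \<longleftrightarrow> (\<forall>r l r' l'. 1 \<le> l \<longrightarrow> 1 \<le> l' \<longrightarrow> crit_obj \<sigma> a z r l = crit_obj \<sigma> a z r' l' \<longrightarrow> r = r' \<and> l = l')"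

lemma nat_attains_min:
  fixes f :: "nat \<Rightarrow> real"
  assumes "\<And>m. K \<le> m \<Longrightarrow> f 0 \<le> f m"
  shows "\<exists>n. \<forall>m. f n \<le> f m"
proof -
  have "finite (f ` {0..K})" "f ` {0..K} \<noteq> {}" by auto
  from Min_in[OF this] obtain n where n: "n \<in> {0..K}" "Min (f ` {0..K}) = f n" by blast
  have le: "f n \<le> f m" if "m \<le> K" for m
    unfolding n(2)[symmetric] by (rule Min_le) (use that in auto)
  have "f n \<le> f m" for m
    using le[of m] le[of 0] assms[of m] by (cases "m \<le> K") auto
  then show ?thesis by blast
qed

context
  fixes \<sigma> a H :: real and z :: "int \<Rightarrow> real"
  assumes \<sigma>: "0 < \<sigma>" and a: "0 < a" and bdd: "walk_bounded H z"
begin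

lemma crit_obj_bounds:
  assumes "1 \<le> l"
  shows "\<bar>crit_obj \<sigma> a z r l - a * (real r - real l + 1) / 2\<bar> \<le> \<sigma> * H"
proof -
  have "\<bar>right_sum z r\<bar> \<le> H * real r" "\<bar>left_sum z l\<bar> \<le> H * real l"
    using bdd by (auto simp: walk_bounded_def)
  then have "\<bar>right_sum z r + left_sum z l\<bar> \<le> H * (real r + real l)"
    unfolding ring_distribs by linarith
  then have "\<sigma> * \<bar>right_sum z r + left_sum z l\<bar> \<le> \<sigma> * (H * (real r + real l))"
    using \<sigma> by simp
  then have "\<sigma> * \<bar>right_sum z r + left_sum z l\<bar> / (real r + real l) \<le> \<sigma> * H"
    using assms by (simp add: pos_divide_le_eq)
  then show ?thesis
    unfolding crit_obj_walk using \<sigma> assms by (simp add: abs_mult)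
qed

lemma crit_sup_bdd: "bdd_above (crit_obj \<sigma> a z r ` {1..})"
proof (rule bdd_aboveI2)
  fix l :: nat assume "l \<in> {1..}"
  then have "1 \<le> l" by simp
  have "a * (real r - real l + 1) \<le> a * (real r + 1)"
    using a by (intro mult_left_mono) auto
  then show "crit_obj \<sigma> a z r l \<le> \<sigma> * H + a * (real r + 1) / 2"
    using crit_obj_bounds[OF \<open>1 \<le> l\<close>, of r] by linarith
qed

lemma crit_obj_le_sup: "1 \<le> l \<Longrightarrow> crit_obj \<sigma> a z r l \<le> crit_sup \<sigma> a z r"
  unfolding crit_sup_def by (rule cSUP_upper[OF _ crit_sup_bdd]) simp

lemma crit_sup_attained: "\<exists>l\<ge>1. crit_sup \<sigma> a z r = crit_obj \<sigma> a z r l"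
proof -
  \<comment> \<open>The drift drops by \<open>a / 2\<close> with each step to the left; beyond
    \<open>K\<close> this outweighs twice the noise bound, so such \<open>l\<close> cannot beat
    \<open>l = 1\<close>.\<close>
  obtain K where K: "\<sigma> * H * 2 + a / 2 \<le> real K * (a / 2)"
    using a reals_Archimedean3[of "a / 2"] by (metis half_gt_zero less_eq_real_def)
  have shift: "a * (real r - real (Suc m) + 1) / 2 = a * real r / 2 - real m * (a / 2)" for m
    by (simp add: field_simps)
  have "\<exists>n. \<forall>m. - crit_obj \<sigma> a z r (Suc n) \<le> - crit_obj \<sigma> a z r (Suc m)"
  proof (rule nat_attains_min)
    fix m assume m: "K \<le> m"
    then have "real K * (a / 2) \<le> real m * (a / 2)" using a by (intro mult_right_mono) auto
    then show "- crit_obj \<sigma> a z r (Suc 0) \<le> - crit_obj \<sigma> a z r (Suc m)"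
      using crit_obj_bounds[of "Suc 0" r] crit_obj_bounds[of "Suc m" r] K a
        shift[of m] shift[of 0] by linarith
  qed
  then obtain n where n: "\<And>m. crit_obj \<sigma> a z r (Suc m) \<le> crit_obj \<sigma> a z r (Suc n)" by auto
  have le: "crit_obj \<sigma> a z r l \<le> crit_obj \<sigma> a z r (Suc n)" if "1 \<le> l" for l
    using n[of "l - 1"] that by simp
  have "crit_sup \<sigma> a z r = crit_obj \<sigma> a z r (Suc n)"
    unfolding crit_sup_def by (rule cSup_eq_maximum) (auto intro: le)
  then show ?thesis by (intro exI[of _ "Suc n"]) simp
qed

text \<open>The choice \<open>l = 1\<close> bounds the supremum at \<open>r\<close> below by
  \<open>a * r / 2 - \<sigma> * H\<close>, which eventually exceeds the value at
  \<open>r = 0\<close>.\<close>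

lemma crit_sup_min: "\<exists>r. \<forall>r'. crit_sup \<sigma> a z r \<le> crit_sup \<sigma> a z r'"
proof -
  obtain K where K: "crit_sup \<sigma> a z 0 + \<sigma> * H \<le> real K * (a / 2)"
    using a reals_Archimedean3[of "a / 2"] by (metis half_gt_zero less_eq_real_def)
  show ?thesis
  proof (rule nat_attains_min)
    fix r assume r: "K \<le> r"
    then have "real K * (a / 2) \<le> real r * (a / 2)" using a by (intro mult_right_mono) auto
    then show "crit_sup \<sigma> a z 0 \<le> crit_sup \<sigma> a z r"
      using crit_obj_bounds[of 1 r] crit_obj_le_sup[of 1 r] K by (simp add: field_simps)
  qed
qed

lemma crit_opt:
  shows "crit_sup \<sigma> a z (crit_r \<sigma> a z) = crit_G \<sigma> a z" "crit_G \<sigma> a z \<le> crit_sup \<sigma> a z r"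
    "1 \<le> crit_l \<sigma> a z" "crit_obj \<sigma> a z (crit_r \<sigma> a z) (crit_l \<sigma> a z) = crit_G \<sigma> a z"
proof -
  obtain r0 where r0: "\<And>r'. crit_sup \<sigma> a z r0 \<le> crit_sup \<sigma> a z r'" using crit_sup_min by blast
  have G: "crit_G \<sigma> a z = crit_sup \<sigma> a z r0"
    unfolding crit_G_def by (rule cInf_eq_minimum) (auto intro: r0)
  show "crit_G \<sigma> a z \<le> crit_sup \<sigma> a z r" using r0 G by simp
  show 1: "crit_sup \<sigma> a z (crit_r \<sigma> a z) = crit_G \<sigma> a z"
    unfolding crit_r_def by (rule LeastI[of _ r0]) (simp add: G)
  obtain l where "1 \<le> l \<and> crit_obj \<sigma> a z (crit_r \<sigma> a z) l = crit_sup \<sigma> a z (crit_r \<sigma> a z)"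
    using crit_sup_attained by metis
  then have "1 \<le> crit_l \<sigma> a z \<and> crit_obj \<sigma> a z (crit_r \<sigma> a z) (crit_l \<sigma> a z) = crit_sup \<sigma> a z (crit_r \<sigma> a z)"
    unfolding crit_l_def by (rule LeastI)
  with 1 show "1 \<le> crit_l \<sigma> a z" "crit_obj \<sigma> a z (crit_r \<sigma> a z) (crit_l \<sigma> a z) = crit_G \<sigma> a z"
    by auto
qed

text \<open>Since the objective is an average over an interval, comparing it with the optimal value
  \<open>c\<close> separates the two endpoints: the min-max point is a saddle of the excess sums.\<close>

lemma crit_saddle:
  fixes c r l
  defines "c \<equiv> crit_G \<sigma> a z" and "r \<equiv> crit_r \<sigma> a z" and "l \<equiv> crit_l \<sigma> a z"
  assumes ties: "crit_no_ties \<sigma> a z"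
  shows "crit_right \<sigma> a z r + crit_left \<sigma> a z l = c * (real r + real l)"
    and "r' \<noteq> r \<Longrightarrow> crit_right \<sigma> a z r - c * real r < crit_right \<sigma> a z r' - c * real r'"
    and "1 \<le> l' \<Longrightarrow> l' \<noteq> l \<Longrightarrow> crit_left \<sigma> a z l' - c * real l' < crit_left \<sigma> a z l - c * real l"
proof -
  define P where "P r = crit_right \<sigma> a z r - c * real r" for r
  define Q where "Q l = crit_left \<sigma> a z l - c * real l" for l
  have iff: "crit_obj \<sigma> a z r l \<le> c \<longleftrightarrow> P r + Q l \<le> 0" "c \<le> crit_obj \<sigma> a z r l \<longleftrightarrow> 0 \<le> P r + Q l"
    if "1 \<le> l" for r l
    using that by (auto simp: crit_obj_average P_def Q_def pos_divide_le_eq pos_le_divide_eq algebra_simps)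
  have l: "1 \<le> l" and obj: "crit_obj \<sigma> a z r l = c"
    unfolding c_def l_def r_def by (rule crit_opt)+
  have eq: "P r + Q l = 0"
    using iff[OF l, of r] obj by auto
  have Qmax: "Q l' \<le> Q l" if "1 \<le> l'" for l'
  proof -
    have "crit_obj \<sigma> a z r l' \<le> c"
      using crit_obj_le_sup[OF that, of r] crit_opt(1) by (simp add: c_def r_def)
    then show ?thesis using iff(1)[OF that] eq by auto
  qed
  \<comment> \<open>Against the best response \<open>l'\<close> to \<open>r'\<close> the objective
    is still at least \<open>c\<close>, so \<open>P r'\<close> is at least \<open>- Q l'\<close>,
    and \<open>Q l'\<close> is at most \<open>Q l = - P r\<close>.\<close>
  have Pmin: "P r \<le> P r'" for r'
  proof -
    obtain l' where l': "1 \<le> l'" "crit_sup \<sigma> a z r' = crit_obj \<sigma> a z r' l'"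
      using crit_sup_attained by blast
    have "c \<le> crit_obj \<sigma> a z r' l'" using crit_opt(2)[of r'] l' by (simp add: c_def)
    then have "0 \<le> P r' + Q l'" using iff(2)[OF l'(1)] by auto
    then show ?thesis using Qmax[OF l'(1)] eq by linarith
  qed
  have tie: "r' = r \<and> l' = l" if "P r' + Q l' = 0" "1 \<le> l'" for r' l'
  proof -
    have "crit_obj \<sigma> a z r' l' = c"
      using iff[OF that(2), of r'] that(1) by auto
    then show ?thesis using ties obj l that(2) by (auto simp: crit_no_ties_def)
  qed
  show "crit_right \<sigma> a z r + crit_left \<sigma> a z l = c * (real r + real l)"
    using eq by (simp add: P_def Q_def algebra_simps)
  show "crit_right \<sigma> a z r - c * real r < crit_right \<sigma> a z r' - c * real r'" if "r' \<noteq> r"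
    using Pmin[of r'] tie[of r' l] eq l that unfolding P_def[symmetric] by fastforce
  show "crit_left \<sigma> a z l' - c * real l' < crit_left \<sigma> a z l - c * real l" if "1 \<le> l'" "l' \<noteq> l"
    using Qmax[of l'] tie[of r l'] eq that unfolding Q_def[symmetric] by fastforce
qed

text \<open>Converse of \<open>crit_saddle\<close>: a strict saddle of the excess sums at some level
  is the min-max point and the level is its value. It serves to read off the optimum when the slope
  is large.\<close>

lemma crit_eq_of_strict_saddle:
  assumes l: "1 \<le> l" and eq: "crit_right \<sigma> a z r + crit_left \<sigma> a z l = c * (real r + real l)"
    and P: "\<And>r'. r' \<noteq> r \<Longrightarrow> crit_right \<sigma> a z r - c * real r < crit_right \<sigma> a z r' - c * real r'"
    and Q: "\<And>l'. 1 \<le> l' \<Longrightarrow> l' \<noteq> l \<Longrightarrow> crit_left \<sigma> a z l' - c * real l' < crit_left \<sigma> a z l - c * real l"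
  shows "crit_r \<sigma> a z = r" "crit_l \<sigma> a z = l" "crit_G \<sigma> a z = c"
proof -
  have obj: "crit_obj \<sigma> a z r l = c"
    using l eq by (simp add: crit_obj_average)
  have objl: "crit_obj \<sigma> a z r l' < c" if "1 \<le> l'" "l' \<noteq> l" for l'
    using Q[OF that] eq that by (simp add: crit_obj_average pos_divide_less_eq algebra_simps)
  have objr: "c < crit_obj \<sigma> a z r' l" if "r' \<noteq> r" for r'
    using P[OF that] eq l by (simp add: crit_obj_average pos_less_divide_eq algebra_simps)
  have le: "crit_obj \<sigma> a z r l' \<le> c" if "1 \<le> l'" for l'
    using objl[OF that] obj by (cases "l' = l") auto
  have sup: "crit_sup \<sigma> a z r = c"
    unfolding crit_sup_def by (rule cSup_eq_maximum) (use l obj le in \<open>auto simp: image_iff intro!: bexI[of _ l]\<close>)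
  have supr: "c < crit_sup \<sigma> a z r'" if "r' \<noteq> r" for r'
    using objr[OF that] crit_obj_le_sup[OF l, of r'] by linarith
  have sup_le: "c \<le> crit_sup \<sigma> a z r'" for r'
    using supr[of r'] sup by (cases "r' = r") auto
  show G: "crit_G \<sigma> a z = c"
    unfolding crit_G_def by (rule cInf_eq_minimum) (use sup sup_le in \<open>auto simp: image_iff intro!: exI[of _ r]\<close>)
  show r: "crit_r \<sigma> a z = r"
    using crit_opt(1) supr[of "crit_r \<sigma> a z"] G by force
  show "crit_l \<sigma> a z = l"
    using crit_opt(3,4) objl[of "crit_l \<sigma> a z"] G r by force
qed

end

section \<open>Convergence for a fixed realization\<close>

text \<open>Maps a position \<open>k\<close> of a design with centre \<open>k0\<close> to the index of its noise variable in
  the two-sided sequence, which has no index \<open>0\<close>.\<close>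

definition walk_site :: "nat \<Rightarrow> nat \<Rightarrow> int" where
  "walk_site k0 k = (if k0 < k then int k - int k0 else int k - int k0 - 1)"

lemma sum_right_of_site:
  "(\<Sum>i\<in>{k0<..k0 + r}. w (walk_site k0 i)) = right_sum w r"
proof -
  have "(\<Sum>i\<in>{k0<..k0 + r}. w (walk_site k0 i)) = (\<Sum>i=1..r. w (walk_site k0 (k0 + i)))"
    by (rule sum.reindex_bij_witness[of _ "\<lambda>i. k0 + i" "\<lambda>i. i - k0"]) auto
  then show ?thesis by (simp add: walk_site_def right_sum_def)
qed

text \<open>The centre carries index -1, so the left half of length \<open>l\<close> covers the
  positions from \<open>k0 - l + 1\<close> to \<open>k0\<close>.\<close>

lemma sum_left_of_site:
  assumes "l \<le> k0"
  shows "(\<Sum>i\<in>{k0 - l<..k0}. w (walk_site k0 i)) = left_sum w l"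
proof -
  have "(\<Sum>i\<in>{k0 - l<..k0}. w (walk_site k0 i)) = (\<Sum>i=1..l. w (walk_site k0 (k0 + 1 - i)))"
    by (rule sum.reindex_bij_witness[of _ "\<lambda>i. k0 + 1 - i" "\<lambda>i. k0 + 1 - i"]) (use assms in auto)
  also have "\<dots> = (\<Sum>i=1..l. w (- int i))"
    using assms by (intro sum.cong refl arg_cong[of _ _ w]) (auto simp: walk_site_def of_nat_diff)
  finally show ?thesis by (simp add: left_sum_def)
qed

lemma tendsto_right_sum:
  assumes "\<And>i. i \<noteq> 0 \<Longrightarrow> (\<lambda>m. w m i) \<longlonglongrightarrow> z i"
  shows "(\<lambda>m. right_sum (w m) r) \<longlonglongrightarrow> right_sum z r" "(\<lambda>m. left_sum (w m) r) \<longlonglongrightarrow> left_sum z r"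
  unfolding right_sum_def left_sum_def using assms by (intro tendsto_sum; auto)+

lemma sum_real_interval: "(\<Sum>i=1..r. real i) = real r * (real r + 1) / 2"
  by (induction r) (auto simp: field_simps)

lemma sum_real_interval': "(\<Sum>i=1..l. real (i - 1)) = real l * (real l - 1) / 2"
  by (induction l) (auto simp: field_simps)

lemma eventually_less_of_tendsto:
  fixes f g :: "nat \<Rightarrow> real"
  assumes "f \<longlonglongrightarrow> x" "g \<longlonglongrightarrow> y" "x < y"
  shows "\<forall>\<^sub>F m in sequentially. f m < g m"
  using order_tendstoD(1)[OF tendsto_diff[OF assms(2,1)], of 0] assms(3) by simp

context
  fixes w :: "nat \<Rightarrow> int \<Rightarrow> real" and n k0 :: "nat \<Rightarrow> nat" and d :: "nat \<Rightarrow> nat \<Rightarrow> real"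
    and z :: "int \<Rightarrow> real" and \<sigma> a H0 :: real
  assumes \<sigma>: "0 < \<sigma>" and a: "0 < a" and bdd: "walk_bounded H0 z" and ties: "crit_no_ties \<sigma> a z"
    and w: "\<And>i. i \<noteq> 0 \<Longrightarrow> (\<lambda>m. w m i) \<longlonglongrightarrow> z i"
    and k0: "filterlim k0 at_top sequentially" "filterlim (\<lambda>m. n m - k0 m) at_top sequentially"
      "\<And>m. k0 m \<in> {1..n m}"
    and dmono: "\<And>m i k. 1 \<le> i \<Longrightarrow> i \<le> k \<Longrightarrow> k \<le> n m \<Longrightarrow> d m i \<le> d m k"
    and d0: "\<And>m. d m (k0 m) = 0"
    and dR: "\<And>r. (\<lambda>m. d m (k0 m + r)) \<longlonglongrightarrow> a * real r"
    and dL: "\<And>l. (\<lambda>m. d m (k0 m - l)) \<longlonglongrightarrow> - a * real l"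
begin

text \<open>In the limit only finitely many positions matter: beyond a window the drift, which is
  monotone and grows at least linearly up to the edge of the window, dominates the noise.\<close>

lemma isotonic_block_convergence:
  assumes e: "0 < e"
  shows "\<forall>\<^sub>F m in sequentially. \<forall>h. walk_bounded H (w m) \<longrightarrow>
    isotonic_kkt (n m) (\<lambda>k. \<sigma> * w m (walk_site (k0 m) k) + d m k) h \<longrightarrow>
    card {k\<in>{1..n m}. h k = h (k0 m)} = crit_r \<sigma> a z + crit_l \<sigma> a z \<and> \<bar>h (k0 m) - crit_G \<sigma> a z\<bar> < e"
proof -
  define r where "r = crit_r \<sigma> a z"
  define l where "l = crit_l \<sigma> a z"
  define c where "c = crit_G \<sigma> a z"
  define P where "P m r = \<sigma> * right_sum (w m) r + (\<Sum>i=1..r. d m (k0 m + i))" for m r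
  define Q where "Q m l = \<sigma> * left_sum (w m) l + (\<Sum>i=1..l. d m (k0 m - (i - 1)))" for m l
  \<comment> \<open>The level is the average of the finite data over the block that is optimal in
    the limit. With this choice the excess sums at both ends of the block agree exactly, as
    \<open>isotonic_kkt_block\<close> demands; the limit level \<open>c\<close> would give this only
    approximately.\<close>
  define C where "C m = (P m r + Q m l) / (real r + real l)" for m
  have l: "1 \<le> l" unfolding l_def by (rule crit_opt[OF \<sigma> a bdd])
  note saddle = crit_saddle[OF \<sigma> a bdd ties, folded c_def r_def l_def]
  have limP: "(\<lambda>m. P m s) \<longlonglongrightarrow> crit_right \<sigma> a z s" for s
  proof -
    have "(\<lambda>m. P m s) \<longlonglongrightarrow> \<sigma> * right_sum z s + (\<Sum>i=1..s. a * real i)"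
      unfolding P_def by (intro tendsto_intros tendsto_right_sum w dR)
    also have "(\<Sum>i=1..s. a * real i) = a * (real s * (real s + 1) / 2)"
      by (simp only: sum_distrib_left[symmetric] sum_real_interval)
    finally show ?thesis by (simp add: crit_right_def)
  qed
  have limQ: "(\<lambda>m. Q m s) \<longlonglongrightarrow> crit_left \<sigma> a z s" for s
  proof -
    have "(\<lambda>m. Q m s) \<longlonglongrightarrow> \<sigma> * left_sum z s + (\<Sum>i=1..s. - a * real (i - 1))"
      unfolding Q_def by (intro tendsto_intros tendsto_right_sum w dL)
    also have "(\<Sum>i=1..s. - a * real (i - 1)) = - a * (real s * (real s - 1) / 2)"
      by (simp only: sum_distrib_left[symmetric] sum_real_interval')
    finally show ?thesis by (simp add: crit_left_def)
  qed
  have limC: "C \<longlonglongrightarrow> c"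
  proof -
    have "C \<longlonglongrightarrow> (crit_right \<sigma> a z r + crit_left \<sigma> a z l) / (real r + real l)"
      unfolding C_def using l by (intro tendsto_intros limP limQ) auto
    then show ?thesis using l by (simp add: saddle(1))
  qed
  have limPC: "(\<lambda>m. P m s - C m * real s) \<longlonglongrightarrow> crit_right \<sigma> a z s - c * real s"
    and limQC: "(\<lambda>m. Q m s - C m * real s) \<longlonglongrightarrow> crit_left \<sigma> a z s - c * real s" for s
    by (intro tendsto_diff tendsto_mult limP limQ limC tendsto_const)+
  \<comment> \<open>Slope of the noise plus size of the level; the 1 allows for the distance between
    \<open>C m\<close> and \<open>c\<close>.\<close>
  define B where "B = \<sigma> * \<bar>H\<bar> + \<bar>c\<bar> + 1"
  have B: "0 < B" using \<sigma> by (auto simp: B_def intro!: add_nonneg_pos)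
  \<comment> \<open>From distance \<open>q\<close> on the drift is eventually at least
    \<open>a * q / 2\<close> in absolute value. Beyond \<open>2 * q\<close> at least half of the
    terms gain this much, and \<open>q\<close> is so large that their sum exceeds
    \<open>2 * B\<close> per position.\<close>
  obtain q :: nat where q: "8 * B / a < real q" using reals_Archimedean2 by blast
  then have q': "2 * B < a * real q / 4" using a by (simp add: field_simps)
  have aq: "0 < a * real q" using q' B by linarith
  have "\<forall>\<^sub>F m in sequentially. \<forall>s\<in>{0..2 * q} - {r}. P m r - C m * real r < P m s - C m * real s"
    by (intro eventually_ball_finite ballI eventually_less_of_tendsto[OF limPC limPC] saddle(2)) auto
  moreover have "\<forall>\<^sub>F m in sequentially. \<forall>s\<in>{1..2 * q} - {l}. Q m s - C m * real s < Q m l - C m * real l"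
    by (intro eventually_ball_finite ballI eventually_less_of_tendsto[OF limQC limQC] saddle(3)) auto
  moreover have "\<forall>\<^sub>F m in sequentially. a * real q / 2 < d m (k0 m + q)"
    using aq by (intro order_tendstoD(1)[OF dR]) simp
  moreover have "\<forall>\<^sub>F m in sequentially. d m (k0 m - q) < - (a * real q / 2)"
    using aq by (intro order_tendstoD(2)[OF dL]) simp
  moreover have "\<forall>\<^sub>F m in sequentially. dist (C m) c < min 1 e"
    using tendstoD[OF limC, of "min 1 e"] e by simp
  moreover have "\<forall>\<^sub>F m in sequentially. l + 2 * q + 1 \<le> k0 m"
    using k0(1) by (simp add: filterlim_at_top)
  moreover have "\<forall>\<^sub>F m in sequentially. r + 2 * q + 1 \<le> n m - k0 m"
    using k0(2) by (simp add: filterlim_at_top)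
  ultimately show ?thesis
    unfolding r_def[symmetric] l_def[symmetric]
  proof eventually_elim
    case (elim m)
    show ?case
    proof (intro allI impI)
      fix h assume bw: "walk_bounded H (w m)"
        and kkt: "isotonic_kkt (n m) (\<lambda>k. \<sigma> * w m (walk_site (k0 m) k) + d m k) h"
      let ?y = "\<lambda>k. \<sigma> * w m (walk_site (k0 m) k) + d m k"
      let ?F = "excess_sum ?y (C m)"
      have Cm: "\<bar>C m - c\<bar> < 1" "\<bar>C m - c\<bar> < e" using elim(5) by (auto simp: dist_real_def)
      have noiseR: "- (\<sigma> * \<bar>H\<bar> * real s) \<le> \<sigma> * right_sum (w m) s" for s
      proof -
        have "- (\<bar>H\<bar> * real s) \<le> right_sum (w m) s"
          using bw mult_right_mono[of H "\<bar>H\<bar>" "real s"] unfolding walk_bounded_def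
          by (smt (verit) abs_ge_self of_nat_0_le_iff)
        then show ?thesis using mult_left_mono[of "- (\<bar>H\<bar> * real s)" _ \<sigma>] \<sigma> by (simp add: mult.assoc)
      qed
      have noiseL: "\<bar>\<sigma> * left_sum (w m) s\<bar> \<le> \<sigma> * \<bar>H\<bar> * real s" for s
      proof -
        have "\<bar>left_sum (w m) s\<bar> \<le> \<bar>H\<bar> * real s"
          using bw mult_right_mono[of H "\<bar>H\<bar>" "real s"] unfolding walk_bounded_def
          by (smt (verit) abs_ge_self of_nat_0_le_iff)
        then show ?thesis using mult_left_mono[of _ "\<bar>H\<bar> * real s" \<sigma>] \<sigma> by (simp add: mult.assoc abs_mult)
      qed
      have bound: "(\<sigma> * \<bar>H\<bar> + C m) * real s \<le> B * real s" "(\<sigma> * \<bar>H\<bar> - C m) * real s \<le> B * real s" for s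
        using Cm by (auto intro!: mult_right_mono simp: B_def)
      have tail: "2 * B * real s < real (s - q) * (a * real q / 2)" if "2 * q < s" for s
      proof -
        have "2 * B * real s < a * real q / 4 * real s" using q' that by (intro mult_strict_right_mono) auto
        also have "\<dots> = (a * real q / 2) * (real s / 2)" by simp
        also have "\<dots> \<le> (a * real q / 2) * real (s - q)" using that aq by (intro mult_left_mono) auto
        finally show ?thesis by (simp add: mult.commute)
      qed
      have PR: "P m r - C m * real r < P m s - C m * real s" if s: "s \<noteq> r" "s \<le> n m - k0 m" for s
      proof (cases "s \<le> 2 * q")
        case True then show ?thesis using elim(1) s by auto
      next
        case False
        have "(\<Sum>i=1..s. if q < i then a * real q / 2 else 0) \<le> (\<Sum>i=1..s. d m (k0 m + i))"
        proof (rule sum_mono)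
          fix i assume i: "i \<in> {1..s}"
          show "(if q < i then a * real q / 2 else 0) \<le> d m (k0 m + i)"
          proof (cases "q < i")
            case True
            have "d m (k0 m + q) \<le> d m (k0 m + i)" using i True s k0(3)[of m] by (intro dmono) auto
            then show ?thesis using True elim(3) by simp
          next
            case False
            have "d m (k0 m) \<le> d m (k0 m + i)" using i s k0(3)[of m] by (intro dmono) auto
            then show ?thesis using False d0 by simp
          qed
        qed
        also have "(\<Sum>i=1..s. if q < i then a * real q / 2 else 0) = real (s - q) * (a * real q / 2)"
        proof -
          have "{1..s} \<inter> {i. q < i} = {q<..s}" by auto
          then show ?thesis by (simp add: sum.If_cases)
        qed
        finally have "0 < P m s - C m * real s"
          using noiseR[of s] bound(1)[of s, unfolded distrib_right] tail[of s] False
            mult_nonneg_nonneg[of B "real s"] B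
          unfolding P_def not_le by linarith
        \<comment> \<open>Far positions are compared with the optimum through \<open>r = 0\<close>,
          which lies in the window and has excess 0.\<close>
        moreover have "P m r - C m * real r \<le> P m 0 - C m * real 0"
          using bspec[OF elim(1), of 0] by (cases "r = 0") (auto intro: less_imp_le)
        moreover have "P m 0 = 0" by (simp add: P_def right_sum_def)
        ultimately show ?thesis by simp
      qed
      have QL: "Q m s - C m * real s < Q m l - C m * real l" if s: "s \<noteq> l" "1 \<le> s" "s \<le> k0 m" for s
      proof (cases "s \<le> 2 * q")
        case True then show ?thesis using elim(2) s by auto
      next
        case False
        have "(\<Sum>i=1..s. d m (k0 m - (i - 1))) \<le> (\<Sum>i=1..s. if q < i then - (a * real q / 2) else 0)"
        proof (rule sum_mono)
          fix i assume i: "i \<in> {1..s}"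
          show "d m (k0 m - (i - 1)) \<le> (if q < i then - (a * real q / 2) else 0)"
          proof (cases "q < i")
            case True
            have "d m (k0 m - (i - 1)) \<le> d m (k0 m - q)"
              using i True s k0(3)[of m] by (intro dmono) auto
            then show ?thesis using True elim(4) by simp
          next
            case False
            have "d m (k0 m - (i - 1)) \<le> d m (k0 m)" using i s k0(3)[of m] by (intro dmono) auto
            then show ?thesis using False d0 by simp
          qed
        qed
        also have "\<dots> = - (real (s - q) * (a * real q / 2))"
        proof -
          have "{1..s} \<inter> {i. q < i} = {q<..s}" by auto
          then show ?thesis by (simp add: sum.If_cases)
        qed
        finally have 1: "Q m s - C m * real s < - (B * real s)"
          using noiseL[of s] bound(2)[of s, unfolded left_diff_distrib] tail[of s] False
          unfolding Q_def not_le by linarith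
        \<comment> \<open>On the left the smallest admissible length is 1, so the comparison goes
          through the centre alone, whose excess is bounded below by \<open>- B\<close>.\<close>
        have 2: "Q m 1 - C m * real 1 \<le> Q m l - C m * real l"
        proof (cases "l = 1")
          case False
          have "1 \<le> q" using aq by (cases q) auto
          then show ?thesis using bspec[OF elim(2), of 1] False by simp
        qed simp
        have "Q m 1 = \<sigma> * left_sum (w m) 1" by (simp add: Q_def d0)
        then have "- B \<le> Q m 1 - C m * real 1"
          using noiseL[of 1] bound(1)[of 1] by simp
        moreover have "B * 1 \<le> B * real s" using s B by (intro mult_left_mono) auto
        ultimately show ?thesis using 1 2 by linarith
      qed
      have FR: "?F (k0 m + s) = ?F (k0 m) + (P m s - C m * real s)" if "s \<le> n m - k0 m" for s
      proof -
        have "(\<Sum>i\<in>{k0 m<..k0 m + s}. d m i) = (\<Sum>i=1..s. d m (k0 m + i))"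
          by (rule sum.reindex_bij_witness[of _ "\<lambda>i. k0 m + i" "\<lambda>i. i - k0 m"]) auto
        then show ?thesis
          using excess_sum_split[of "k0 m" "k0 m + s" ?y "C m"] sum_right_of_site[of "w m" "k0 m" s]
          by (simp add: P_def sum.distrib sum_subtractf sum_distrib_left[symmetric])
      qed
      have FL: "?F (k0 m - s) = ?F (k0 m) - (Q m s - C m * real s)" if "s \<le> k0 m" for s
      proof -
        have "(\<Sum>i\<in>{k0 m - s<..k0 m}. d m i) = (\<Sum>i=1..s. d m (k0 m - (i - 1)))"
          by (rule sum.reindex_bij_witness[of _ "\<lambda>i. k0 m - (i - 1)" "\<lambda>i. k0 m + 1 - i"]) (use that in auto)
        then show ?thesis
          using excess_sum_split[of "k0 m - s" "k0 m" ?y "C m"] sum_left_of_site[of s "k0 m" "w m"] that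
          by (simp add: Q_def sum.distrib sum_subtractf sum_distrib_left[symmetric])
      qed
      have rl: "l \<le> k0 m" "r \<le> n m - k0 m" using elim by auto
      have eq: "P m r + Q m l = C m * (real r + real l)" using l by (simp add: C_def)
      have block: "h (k0 m) = C m" "{k\<in>{1..n m}. h k = h (k0 m)} = {k0 m - l<..k0 m + r}"
      proof -
        have 1: "k0 m - l < k0 m" using l rl by auto
        have 2: "k0 m + r \<le> n m" using rl k0(3)[of m] by auto
        have 3: "?F (k0 m - l) = ?F (k0 m + r)"
          unfolding FR[OF rl(2)] FL[OF rl(1)] using eq by (simp add: ring_distribs)
        have 4: "?F (k0 m + r) < ?F t" if t: "t \<le> n m" "t \<noteq> k0 m - l" "t \<noteq> k0 m + r" for t
        proof (cases "k0 m \<le> t")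
          case True
          then obtain s where s: "t = k0 m + s" using le_Suc_ex by blast
          then have s': "s \<noteq> r" "s \<le> n m - k0 m" using t by auto
          show ?thesis unfolding s FR[OF rl(2)] FR[OF s'(2)] using PR[OF s'] by simp
        next
          case False
          define s where "s = k0 m - t"
          have s: "t = k0 m - s" "1 \<le> s" "s \<le> k0 m" "s \<noteq> l" using False t by (auto simp: s_def)
          show ?thesis unfolding 3[symmetric] s(1) FL[OF rl(1)] FL[OF s(3)] using QL[OF s(4,2,3)] by simp
        qed
        show "h (k0 m) = C m" "{k\<in>{1..n m}. h k = h (k0 m)} = {k0 m - l<..k0 m + r}"
          using isotonic_kkt_block[OF kkt 1 _ 2 3 4] by auto
      qed
      have "card {k\<in>{1..n m}. h k = h (k0 m)} = r + l" unfolding block(2) using rl by simp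
      then show "card {k\<in>{1..n m}. h k = h (k0 m)} = r + l \<and> \<bar>h (k0 m) - crit_G \<sigma> a z\<bar> < e"
        using Cm(2) by (simp add: block(1) c_def)
    qed
  qed
qed

text \<open>A common shift \<open>t\<close> of the data shifts the fit and leaves the blocks
  unchanged. The bound \<eta> makes the convergence uniform over such shifts, which in the
  application are random.\<close>

lemma isotonic_statistic_convergence:
  assumes \<eta>: "\<eta> \<longlonglongrightarrow> 0" and e: "0 < e"
  shows "\<forall>\<^sub>F m in sequentially. \<forall>h t. walk_bounded H (w m) \<longrightarrow> \<bar>t\<bar> \<le> \<eta> m \<longrightarrow>
    isotonic_kkt (n m) (\<lambda>k. \<sigma> * w m (walk_site (k0 m) k) + d m k - t) h \<longrightarrow>
    \<bar>sqrt (real (card {k\<in>{1..n m}. h k = h (k0 m)})) * h (k0 m) - crit_L \<sigma> a z\<bar> < e"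
proof -
  let ?r = "crit_r \<sigma> a z" and ?l = "crit_l \<sigma> a z"
  define s where "s = sqrt (real ?r + real ?l)"
  have l: "1 \<le> ?l" by (rule crit_opt[OF \<sigma> a bdd])
  have s: "0 < s" using l by (simp add: s_def)
  \<comment> \<open>Half of the error is spent on the shift, half on the convergence of the level;
    the factor \<open>s\<close> is the square root of the block length.\<close>
  define e' where "e' = e / (2 * s)"
  have e': "0 < e'" using s e by (simp add: e'_def)
  have "\<forall>\<^sub>F m in sequentially. \<eta> m < e'" using \<eta> e' by (rule order_tendstoD(2))
  moreover have "\<forall>\<^sub>F m in sequentially. \<forall>h. walk_bounded H (w m) \<longrightarrow>
    isotonic_kkt (n m) (\<lambda>k. \<sigma> * w m (walk_site (k0 m) k) + d m k) h \<longrightarrow>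
    card {k\<in>{1..n m}. h k = h (k0 m)} = ?r + ?l \<and> \<bar>h (k0 m) - crit_G \<sigma> a z\<bar> < e'"
    by (rule isotonic_block_convergence[OF e'])
  ultimately show ?thesis
  proof eventually_elim
    case (elim m)
    show ?case
    proof (intro allI impI)
      fix h t assume bw: "walk_bounded H (w m)" and t: "\<bar>t\<bar> \<le> \<eta> m"
        and kkt: "isotonic_kkt (n m) (\<lambda>k. \<sigma> * w m (walk_site (k0 m) k) + d m k - t) h"
      have "isotonic_kkt (n m) (\<lambda>k. \<sigma> * w m (walk_site (k0 m) k) + d m k) (\<lambda>k. h k + t)"
        using kkt by (auto simp: isotonic_kkt_def mono_on_def algebra_simps)
      from elim(2)[rule_format, OF bw this]
      have *: "card {k\<in>{1..n m}. h k = h (k0 m)} = ?r + ?l" "\<bar>h (k0 m) + t - crit_G \<sigma> a z\<bar> < e'"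
        by simp_all
      have "\<bar>h (k0 m) - crit_G \<sigma> a z\<bar> < 2 * e'" using *(2) t elim(1) by linarith
      then have "s * \<bar>h (k0 m) - crit_G \<sigma> a z\<bar> < s * (2 * e')" using s by simp
      also have "s * (2 * e') = e" using s by (simp add: e'_def)
      also have "s * \<bar>h (k0 m) - crit_G \<sigma> a z\<bar> = \<bar>s * h (k0 m) - crit_L \<sigma> a z\<bar>"
        using s unfolding crit_L_def s_def[symmetric] by (simp add: abs_mult right_diff_distrib[symmetric])
      finally show "\<bar>sqrt (real (card {k\<in>{1..n m}. h k = h (k0 m)})) * h (k0 m) - crit_L \<sigma> a z\<bar> < e"
        unfolding *(1) by (simp add: s_def)
    qed
  qed
qed

end

section \<open>Partial sums and measurability\<close>

context prob_space
begin

lemma expectation_sum_squared: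
  fixes X :: "'i \<Rightarrow> 'a \<Rightarrow> real"
  assumes indep: "indep_vars (\<lambda>_. borel) X I" and sq: "\<And>i. i \<in> I \<Longrightarrow> integrable M (\<lambda>x. (X i x)\<^sup>2)"
    and mean: "\<And>i. i \<in> I \<Longrightarrow> expectation (X i) = 0"
    and var: "\<And>i. i \<in> I \<Longrightarrow> expectation (\<lambda>x. (X i x)\<^sup>2) = 1"
    and J: "finite J" "J \<subseteq> I"
  shows "integrable M (\<lambda>x. (\<Sum>i\<in>J. X i x)\<^sup>2)" "expectation (\<lambda>x. (\<Sum>i\<in>J. X i x)\<^sup>2) = real (card J)"
proof -
  have rv: "random_variable borel (X i)" if "i \<in> I" for i
    using indep that by (auto simp: indep_vars_def)
  have int: "integrable M (X i)" if "i \<in> I" for i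
    using square_integrable_imp_integrable[OF rv[OF that] sq[OF that]] .
  have prod: "integrable M (\<lambda>x. X i x * X k x) \<and> expectation (\<lambda>x. X i x * X k x) = (if i = k then 1 else 0)"
    if "i \<in> I" "k \<in> I" for i k
  proof (cases "i = k")
    case True then show ?thesis using sq[of i] var[of i] that by (simp add: power2_eq_square)
  next
    case False
    have ind: "indep_vars (\<lambda>_. borel) X {i, k}" by (rule indep_vars_subset[OF indep]) (use that in auto)
    have "integrable M (\<lambda>x. \<Prod>l\<in>{i, k}. X l x)"
      by (rule indep_vars_integrable[OF _ ind]) (use int that in auto)
    moreover have "expectation (\<lambda>x. \<Prod>l\<in>{i, k}. X l x) = (\<Prod>l\<in>{i, k}. expectation (X l))"
      by (rule indep_vars_lebesgue_integral[OF _ ind]) (use int that in auto)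
    ultimately show ?thesis using False mean that by simp
  qed
  have expand: "(\<Sum>i\<in>J. X i x)\<^sup>2 = (\<Sum>i\<in>J. \<Sum>k\<in>J. X i x * X k x)" for x
    by (simp add: power2_eq_square sum_product)
  have prod': "integrable M (\<lambda>x. X i x * X k x)" "expectation (\<lambda>x. X i x * X k x) = (if i = k then 1 else 0)"
    if "i \<in> J" "k \<in> J" for i k
    using prod[OF subsetD[OF J(2) that(1)] subsetD[OF J(2) that(2)]] by auto
  show "integrable M (\<lambda>x. (\<Sum>i\<in>J. X i x)\<^sup>2)"
    unfolding expand by (intro Bochner_Integration.integrable_sum prod')
  have "expectation (\<lambda>x. (\<Sum>i\<in>J. X i x)\<^sup>2) = (\<Sum>i\<in>J. \<Sum>k\<in>J. expectation (\<lambda>x. X i x * X k x))"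
    unfolding expand
    by (subst Bochner_Integration.integral_sum, intro Bochner_Integration.integrable_sum prod')
       (auto intro!: sum.cong Bochner_Integration.integral_sum prod')
  also have "\<dots> = (\<Sum>i\<in>J. \<Sum>k\<in>J. if i = k then 1 else 0)"
    by (intro sum.cong refl prod')
  also have "\<dots> = real (card J)"
    using J by simp
  finally show "expectation (\<lambda>x. (\<Sum>i\<in>J. X i x)\<^sup>2) = real (card J)" .
qed

text \<open>No maximal inequality is needed: at the squares \<open>q\<^sup>2\<close> the Chebyshev bounds are summable, and
  the at most \<open>2 q\<close> terms between consecutive squares are bounded by their absolute values.\<close>

lemma linear_bound_partial_sums:
  fixes X :: "nat \<Rightarrow> 'a \<Rightarrow> real"
  assumes X[measurable]: "\<And>i. 1 \<le> i \<Longrightarrow> random_variable borel (X i)"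
    and sq: "\<And>i. 1 \<le> i \<Longrightarrow> integrable M (\<lambda>x. (X i x)\<^sup>2)" "\<And>i. 1 \<le> i \<Longrightarrow> expectation (\<lambda>x. (X i x)\<^sup>2) \<le> 1"
    and S: "\<And>n. integrable M (\<lambda>x. (\<Sum>i=1..n. X i x)\<^sup>2)" "\<And>n. expectation (\<lambda>x. (\<Sum>i=1..n. X i x)\<^sup>2) \<le> real n"
    and c: "0 < c"
  shows "prob {x\<in>space M. \<exists>r. c * real r < \<bar>\<Sum>i=1..r. X i x\<bar>} \<le> 20 * (pi\<^sup>2 / 6) / c\<^sup>2"
proof -
  \<comment> \<open>The allowance \<open>c\<close> times the position is halved: one half for the
    sum up to a square, the other for the terms up to the next square.\<close>
  define A where "A q = {x\<in>space M. c * real ((Suc q)\<^sup>2) / 2 \<le> \<bar>\<Sum>i=1..(Suc q)\<^sup>2. X i x\<bar>}" for q :: nat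
  define B where "B q = {x\<in>space M. c * real ((Suc q)\<^sup>2) / 2 \<le> \<bar>\<Sum>i\<in>{(Suc q)\<^sup>2<..<(Suc (Suc q))\<^sup>2}. \<bar>X i x\<bar>\<bar>}" for q :: nat
  have mS[measurable]: "random_variable borel (\<lambda>x. \<Sum>i=1..n. X i x)" for n
    by (intro borel_measurable_sum X) auto
  have mT[measurable]: "random_variable borel (\<lambda>x. \<Sum>i\<in>{(Suc q)\<^sup>2<..<n}. \<bar>X i x\<bar>)" for q n
    by (intro borel_measurable_sum borel_measurable_abs X) auto
  have [measurable]: "A q \<in> events" "B q \<in> events" for q
    unfolding A_def B_def by measurable
  have ratio: "s / (c * s / 2)\<^sup>2 = 4 / c\<^sup>2 * (1 / s)" if "0 < s" for s :: real
    using that c by (simp add: power2_eq_square)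
  have PA: "prob (A q) \<le> 4 / c\<^sup>2 * (1 / (real q + 1)\<^sup>2)" for q
  proof -
    have "prob (A q) \<le> expectation (\<lambda>x. (\<Sum>i=1..(Suc q)\<^sup>2. X i x)\<^sup>2) / (c * real ((Suc q)\<^sup>2) / 2)\<^sup>2"
      unfolding A_def by (rule second_moment_method[OF mS S(1)]) (use c in simp)
    also have "\<dots> \<le> real ((Suc q)\<^sup>2) / (c * real ((Suc q)\<^sup>2) / 2)\<^sup>2"
      by (intro divide_right_mono S) simp
    also have "\<dots> = 4 / c\<^sup>2 * (1 / (real q + 1)\<^sup>2)"
      using ratio[of "real ((Suc q)\<^sup>2)"] by (simp add: add.commute)
    finally show ?thesis .
  qed
  have PB: "prob (B q) \<le> 16 / c\<^sup>2 * (1 / (real q + 1)\<^sup>2)" for q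
  proof -
    let ?I = "{(Suc q)\<^sup>2<..<(Suc (Suc q))\<^sup>2}"
    have card: "card ?I = 2 * Suc q" by (simp add: power2_eq_square)
    \<comment> \<open>Cauchy-Schwarz over \<open>2 * (q + 1)\<close> terms. The resulting second
      moment is at most \<open>4 * (q + 1)^2\<close>, four times the bound at the square itself;
      hence 16 here against 4 for \<open>A\<close>, and 20 in total.\<close>
    have le: "(\<Sum>i\<in>?I. \<bar>X i x\<bar>)\<^sup>2 \<le> (\<Sum>i\<in>?I. (X i x)\<^sup>2) * real (2 * Suc q)" for x
      using sum_squared_le_sum_of_squares[of "\<lambda>i. \<bar>X i x\<bar>" ?I] unfolding card by simp
    have int: "integrable M (\<lambda>x. (\<Sum>i\<in>?I. (X i x)\<^sup>2) * real (2 * Suc q))"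
      by (intro integrable_mult_left Bochner_Integration.integrable_sum sq(1)) auto
    have int2: "integrable M (\<lambda>x. (\<Sum>i\<in>?I. \<bar>X i x\<bar>)\<^sup>2)"
      by (rule Bochner_Integration.integrable_bound[OF int])
         (use le in \<open>auto intro!: AE_I2 order_trans[OF _ abs_ge_self] borel_measurable_power mT\<close>)
    have "prob (B q) \<le> expectation (\<lambda>x. (\<Sum>i\<in>?I. \<bar>X i x\<bar>)\<^sup>2) / (c * real ((Suc q)\<^sup>2) / 2)\<^sup>2"
      unfolding B_def by (rule second_moment_method[OF mT int2]) (use c in simp)
    also have "expectation (\<lambda>x. (\<Sum>i\<in>?I. \<bar>X i x\<bar>)\<^sup>2) \<le> expectation (\<lambda>x. (\<Sum>i\<in>?I. (X i x)\<^sup>2) * real (2 * Suc q))"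
      by (intro integral_mono int int2 le)
    also have "\<dots> = (\<Sum>i\<in>?I. expectation (\<lambda>x. (X i x)\<^sup>2)) * real (2 * Suc q)"
      by (subst integral_mult_left_zero, subst Bochner_Integration.integral_sum) (auto intro!: sq(1))
    also have "\<dots> \<le> (\<Sum>i\<in>?I. 1) * real (2 * Suc q)"
      by (intro mult_right_mono sum_mono sq(2)) auto
    also have "\<dots> = 4 * real ((Suc q)\<^sup>2)"
      by (simp only: sum_constant card) (simp add: power2_eq_square algebra_simps)
    also have "4 * real ((Suc q)\<^sup>2) / (c * real ((Suc q)\<^sup>2) / 2)\<^sup>2 = 16 / c\<^sup>2 * (1 / (real q + 1)\<^sup>2)"
      using ratio[of "real ((Suc q)\<^sup>2)"] by (simp add: add.commute)
    finally show ?thesis by (simp add: divide_right_mono)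
  qed
  have sub: "{x\<in>space M. \<exists>r. c * real r < \<bar>\<Sum>i=1..r. X i x\<bar>} \<subseteq> (\<Union>q. A q \<union> B q)"
  proof safe
    fix x r assume x: "x \<in> space M" and r: "c * real r < \<bar>\<Sum>i=1..r. X i x\<bar>"
    have "r \<noteq> 0" using r by (intro notI) simp
    define p where "p = floor_sqrt r"
    have p: "p\<^sup>2 \<le> r" "r < (Suc p)\<^sup>2"
      unfolding p_def by (simp_all add: Suc_floor_sqrt_power2_gt)
    have "p \<noteq> 0" using p \<open>r \<noteq> 0\<close> by (intro notI) simp
    then obtain q where q: "p = Suc q" using not0_implies_Suc by blast
    have "x \<in> A q \<union> B q"
    proof (rule ccontr)
      assume "x \<notin> A q \<union> B q"
      then have AB: "\<bar>\<Sum>i=1..p\<^sup>2. X i x\<bar> < c * real (p\<^sup>2) / 2"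
        "(\<Sum>i\<in>{p\<^sup>2<..<(Suc p)\<^sup>2}. \<bar>X i x\<bar>) < c * real (p\<^sup>2) / 2"
        using x by (auto simp: A_def B_def q not_le)
      have "(\<Sum>i=1..r. X i x) = (\<Sum>i=1..p\<^sup>2. X i x) + (\<Sum>i\<in>{p\<^sup>2<..r}. X i x)"
        by (rule sum_telescope_interval[OF p(1)])
      moreover have "\<bar>\<Sum>i\<in>{p\<^sup>2<..r}. X i x\<bar> \<le> (\<Sum>i\<in>{p\<^sup>2<..r}. \<bar>X i x\<bar>)"
        by (rule sum_abs)
      moreover have "(\<Sum>i\<in>{p\<^sup>2<..r}. \<bar>X i x\<bar>) \<le> (\<Sum>i\<in>{p\<^sup>2<..<(Suc p)\<^sup>2}. \<bar>X i x\<bar>)"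
        by (rule sum_mono2) (use p in auto)
      moreover have "c * real (p\<^sup>2) \<le> c * real r"
        using c p(1) by (intro mult_left_mono) (auto simp del: of_nat_power)
      ultimately show False using AB r by linarith
    qed
    then show "x \<in> (\<Union>q. A q \<union> B q)" by blast
  qed
  have PAB: "prob (A q \<union> B q) \<le> 20 / c\<^sup>2 * (1 / (real q + 1)\<^sup>2)" for q
    using measure_Un_le[of "A q" M "B q"] PA[of q] PB[of q] by simp
  have sums: "(\<lambda>q. 20 / c\<^sup>2 * (1 / (real q + 1)\<^sup>2)) sums (20 / c\<^sup>2 * (pi\<^sup>2 / 6))"
    using sums_mult[OF inverse_squares_sums, of "20 / c\<^sup>2"] by (simp add: add.commute)
  have summ: "summable (\<lambda>q. prob (A q \<union> B q))"
    by (rule summable_comparison_test'[OF sums_summable[OF sums], of 0]) (use PAB in auto)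
  have "prob {x\<in>space M. \<exists>r. c * real r < \<bar>\<Sum>i=1..r. X i x\<bar>} \<le> prob (\<Union>q. A q \<union> B q)"
    by (rule finite_measure_mono[OF sub]) auto
  also have "\<dots> \<le> (\<Sum>q. prob (A q \<union> B q))"
    by (rule finite_measure_subadditive_countably[OF _ summ]) auto
  also have "\<dots> \<le> (\<Sum>q. 20 / c\<^sup>2 * (1 / (real q + 1)\<^sup>2))"
    by (intro suminf_le PAB summ sums_summable[OF sums])
  also have "\<dots> = 20 * (pi\<^sup>2 / 6) / c\<^sup>2"
    using sums_unique[OF sums] by simp
  finally show ?thesis .
qed

text \<open>Both halves of the walk are handled by the one-sided bound, which doubles the constant
  20. The bound involves only \<open>c\<close>, so it holds uniformly over all noise laws with these
  moments.\<close>

lemma prob_not_walk_bounded: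
  fixes X :: "int \<Rightarrow> 'a \<Rightarrow> real"
  assumes indep: "indep_vars (\<lambda>_. borel) X (UNIV - {0})"
    and sq: "\<And>i. i \<noteq> 0 \<Longrightarrow> integrable M (\<lambda>x. (X i x)\<^sup>2)"
    and mean: "\<And>i. i \<noteq> 0 \<Longrightarrow> expectation (X i) = 0"
    and var: "\<And>i. i \<noteq> 0 \<Longrightarrow> expectation (\<lambda>x. (X i x)\<^sup>2) = 1"
    and c: "0 < c"
  shows "{x\<in>space M. \<not> walk_bounded c (\<lambda>i. X i x)} \<in> events"
    and "prob {x\<in>space M. \<not> walk_bounded c (\<lambda>i. X i x)} \<le> 40 * (pi\<^sup>2 / 6) / c\<^sup>2"
proof -
  have rv[measurable]: "random_variable borel (X i)" if "i \<noteq> 0" for i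
    using indep that by (auto simp: indep_vars_def)
  have [measurable]: "random_variable borel (\<lambda>x. right_sum (\<lambda>i. X i x) r)"
    "random_variable borel (\<lambda>x. left_sum (\<lambda>i. X i x) r)" for r
    unfolding right_sum_def left_sum_def by (intro borel_measurable_sum rv; simp)+
  let ?R = "{x\<in>space M. \<exists>r. c * real r < \<bar>\<Sum>i=1..r. X (int i) x\<bar>}"
  let ?L = "{x\<in>space M. \<exists>r. c * real r < \<bar>\<Sum>i=1..r. X (- int i) x\<bar>}"
  show ev: "{x\<in>space M. \<not> walk_bounded c (\<lambda>i. X i x)} \<in> events"
    unfolding walk_bounded_def by measurable
  have half: "prob {x\<in>space M. \<exists>r. c * real r < \<bar>\<Sum>i=1..r. X (s i) x\<bar>} \<le> 20 * (pi\<^sup>2 / 6) / c\<^sup>2"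
    if s: "inj s" "\<And>i. 1 \<le> i \<Longrightarrow> s i \<noteq> 0" for s :: "nat \<Rightarrow> int"
  proof (rule linear_bound_partial_sums)
    fix n :: nat
    have inj: "inj_on s {1..n}" using s(1) by (rule inj_on_subset) simp
    have "(\<Sum>i=1..n. X (s i) x) = (\<Sum>i\<in>s ` {1..n}. X i x)" for x
      by (subst sum.reindex[OF inj]) simp
    moreover have "s ` {1..n} \<subseteq> UNIV - {0}" using s(2) by auto
    ultimately show "integrable M (\<lambda>x. (\<Sum>i=1..n. X (s i) x)\<^sup>2)"
      "expectation (\<lambda>x. (\<Sum>i=1..n. X (s i) x)\<^sup>2) \<le> real n"
      using expectation_sum_squared[OF indep sq mean var, of "s ` {1..n}"] card_image[OF inj] by auto
  qed (use sq var c s in auto)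
  have R: "prob ?R \<le> 20 * (pi\<^sup>2 / 6) / c\<^sup>2" by (rule half) (auto simp: inj_def)
  have L: "prob ?L \<le> 20 * (pi\<^sup>2 / 6) / c\<^sup>2" by (rule half) (auto simp: inj_def)
  have eq: "{x\<in>space M. \<not> walk_bounded c (\<lambda>i. X i x)} = ?R \<union> ?L"
    by (auto simp: walk_bounded_def right_sum_def left_sum_def not_le)
  have [measurable]: "?R \<in> events" "?L \<in> events"
    unfolding right_sum_def[of "\<lambda>i. X i _", symmetric] left_sum_def[of "\<lambda>i. X i _", symmetric] by measurable
  show "prob {x\<in>space M. \<not> walk_bounded c (\<lambda>i. X i x)} \<le> 40 * (pi\<^sup>2 / 6) / c\<^sup>2"
    unfolding eq using measure_Un_le[of ?R M ?L] R L by simp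
qed

lemma AE_walk_bounded:
  fixes X :: "int \<Rightarrow> 'a \<Rightarrow> real"
  assumes indep: "indep_vars (\<lambda>_. borel) X (UNIV - {0})"
    and sq: "\<And>i. i \<noteq> 0 \<Longrightarrow> integrable M (\<lambda>x. (X i x)\<^sup>2)"
    and mean: "\<And>i. i \<noteq> 0 \<Longrightarrow> expectation (X i) = 0"
    and var: "\<And>i. i \<noteq> 0 \<Longrightarrow> expectation (\<lambda>x. (X i x)\<^sup>2) = 1"
  shows "AE x in M. \<exists>H. walk_bounded H (\<lambda>i. X i x)"
proof -
  let ?B = "\<lambda>n::nat. {x\<in>space M. \<not> walk_bounded (real (Suc n)) (\<lambda>i. X i x)}"
  note B = prob_not_walk_bounded[OF indep sq mean var]
  have ev: "?B n \<in> events" for n by (rule B(1)) auto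
  have le: "prob (\<Inter>n. ?B n) \<le> 40 * (pi\<^sup>2 / 6) / (real (Suc n))\<^sup>2" for n
  proof -
    have "prob (\<Inter>n. ?B n) \<le> prob (?B n)" by (rule finite_measure_mono) (use ev in auto)
    also have "\<dots> \<le> 40 * (pi\<^sup>2 / 6) / (real (Suc n))\<^sup>2" by (rule B(2)) auto
    finally show ?thesis .
  qed
  have "(\<lambda>n. 40 * (pi\<^sup>2 / 6) / (real (Suc n))\<^sup>2) \<longlonglongrightarrow> 0"
    by real_asymp
  then have "prob (\<Inter>n. ?B n) \<le> 0"
    by (rule LIMSEQ_le_const) (use le in auto)
  then have "prob (\<Inter>n. ?B n) = 0" by (simp add: measure_le_0_iff)
  then have "(\<Inter>n. ?B n) \<in> null_sets M"
    using ev by (auto simp: null_sets_def emeasure_eq_measure)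
  then show ?thesis by (rule AE_I') auto
qed

end

section \<open>Measurability of suprema and of the limit variable\<close>

text \<open>The supremum of a set of reals without upper bound is one fixed, unspecified number.
  Splitting according to boundedness, which is a measurable event for countable families, gives
  measurability everywhere and not merely almost surely.\<close>

lemma borel_measurable_SUP_real:
  fixes f :: "'i::countable \<Rightarrow> 'a \<Rightarrow> real"
  assumes f[measurable]: "\<And>i. i \<in> I \<Longrightarrow> f i \<in> borel_measurable M"
  shows "(\<lambda>x. SUP i\<in>I. f i x) \<in> borel_measurable M"
proof -
  have cnt: "countable I" by auto
  let ?D = "\<lambda>x. \<exists>n::nat. \<forall>i\<in>I. f i x \<le> real n"
  have D[measurable]: "Measurable.pred M ?D" using cnt by measurable
  have bdd: "bdd_above ((\<lambda>i. f i x) ` I)" if "?D x" for x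
    using that by (auto simp: bdd_above_def)
  have eq: "(SUP i\<in>I. f i x) = (if ?D x then SUP i\<in>I. (if ?D x then f i x else 0) else (LEAST z::real. False))" for x
  proof (cases "?D x")
    case False
    have no: "\<not> (\<forall>y\<in>(\<lambda>i. f i x) ` I. y \<le> z)" for z
    proof
      assume "\<forall>y\<in>(\<lambda>i. f i x) ` I. y \<le> z"
      moreover obtain n :: nat where "z \<le> real n" using real_arch_simple by blast
      ultimately have "\<forall>i\<in>I. f i x \<le> real n" by force
      then show False using False by blast
    qed
    have "(\<lambda>z. \<forall>y\<in>(\<lambda>i. f i x) ` I. y \<le> z) = (\<lambda>z. False)"
      by (rule ext) (simp only: no)
    then have "Sup ((\<lambda>i. f i x) ` I) = (LEAST z::real. False)" unfolding Sup_real_def by simp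
    then show ?thesis unfolding if_not_P[OF False] .
  next
    case True
    show ?thesis unfolding if_P[OF True] ..
  qed
  have "(\<lambda>x. SUP i\<in>I. (if ?D x then f i x else 0)) \<in> borel_measurable M"
  proof (rule borel_measurable_cSUP[OF cnt])
    show "bdd_above ((\<lambda>i. if ?D x then f i x else 0) ` I)" for x
      by (cases "?D x") (simp_all only: if_True if_False bdd, auto)
  qed measurable
  then show ?thesis unfolding eq by (intro measurable_If D) auto
qed

lemma borel_measurable_INF_real:
  fixes f :: "'i::countable \<Rightarrow> 'a \<Rightarrow> real"
  assumes f[measurable]: "\<And>i. i \<in> I \<Longrightarrow> f i \<in> borel_measurable M"
  shows "(\<lambda>x. INF i\<in>I. f i x) \<in> borel_measurable M"
proof -
  have "(\<lambda>x. INF i\<in>I. f i x) = (\<lambda>x. - (SUP i\<in>I. - f i x))"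
    by (simp add: Inf_real_def image_image)
  then show ?thesis by (simp add: borel_measurable_SUP_real)
qed

lemma measurable_crit_L:
  assumes z[measurable]: "\<And>i. i \<noteq> 0 \<Longrightarrow> (\<lambda>x. Z x i) \<in> borel_measurable M"
  shows "(\<lambda>x. crit_L \<sigma> a (Z x)) \<in> borel_measurable M"
proof -
  have [measurable]: "(\<lambda>x. right_sum (Z x) r) \<in> borel_measurable M" "(\<lambda>x. left_sum (Z x) r) \<in> borel_measurable M" for r
    unfolding right_sum_def left_sum_def by (intro borel_measurable_sum z; simp)+
  have obj[measurable]: "(\<lambda>x. crit_obj \<sigma> a (Z x) r l) \<in> borel_measurable M" for r l
    unfolding crit_obj_walk by measurable
  have sup[measurable]: "(\<lambda>x. crit_sup \<sigma> a (Z x) r) \<in> borel_measurable M" for r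
    unfolding crit_sup_def by (rule borel_measurable_SUP_real) auto
  have G[measurable]: "(\<lambda>x. crit_G \<sigma> a (Z x)) \<in> borel_measurable M"
    unfolding crit_G_def by (rule borel_measurable_INF_real) auto
  have r[measurable]: "(\<lambda>x. crit_r \<sigma> a (Z x)) \<in> measurable M (count_space UNIV)"
    unfolding crit_r_def by measurable
  have [measurable]: "(\<lambda>x. crit_sup \<sigma> a (Z x) (crit_r \<sigma> a (Z x))) \<in> borel_measurable M"
    by (rule measurable_compose_countable[OF sup r])
  have [measurable]: "(\<lambda>x. crit_obj \<sigma> a (Z x) (crit_r \<sigma> a (Z x)) l) \<in> borel_measurable M" for l
    by (rule measurable_compose_countable[OF obj r])
  have [measurable]: "(\<lambda>x. crit_l \<sigma> a (Z x)) \<in> measurable M (count_space UNIV)"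
    unfolding crit_l_def by measurable
  show ?thesis unfolding crit_L_def by measurable
qed

section \<open>Absence of ties, and weak convergence from convergence in probability\<close>

context prob_space
begin

text \<open>A combination with some nonzero coefficient has a normal density and hence no
  atoms.\<close>

lemma prob_linear_normal_eq:
  fixes Z :: "'i \<Rightarrow> 'a \<Rightarrow> real"
  assumes indep: "indep_vars (\<lambda>_. borel) Z I" and normal: "\<And>i. i \<in> I \<Longrightarrow> distributed M lborel (Z i) std_normal_density"
    and J: "finite J" "J \<subseteq> I" "i0 \<in> J" "c i0 \<noteq> 0"
  shows "AE x in M. (\<Sum>i\<in>J. c i * Z i x) \<noteq> b"
proof -
  \<comment> \<open>Terms with coefficient 0 are dropped, because a normal density needs positive
    variance.\<close>
  define K where "K = {i\<in>J. c i \<noteq> 0}"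
  have K: "finite K" "K \<noteq> {}" "K \<subseteq> I" using J by (auto simp: K_def)
  have eq: "(\<Sum>i\<in>J. c i * Z i x) = (\<Sum>i\<in>K. c i * Z i x)" for x
    unfolding K_def by (rule sum.mono_neutral_right) (use J in auto)
  have "distributed M lborel (\<lambda>x. \<Sum>i\<in>K. c i * Z i x) (normal_density (\<Sum>i\<in>K. 0) (sqrt (\<Sum>i\<in>K. (\<bar>c i\<bar>)\<^sup>2)))"
  proof (rule sum_indep_normal[OF K(1,2)])
    show "indep_vars (\<lambda>i. borel) (\<lambda>i x. c i * Z i x) K"
      by (rule indep_vars_compose2[OF indep_vars_subset[OF indep K(3)]]) auto
    fix i assume i: "i \<in> K"
    then show "0 < \<bar>c i\<bar>" by (simp add: K_def)
    show "distributed M lborel (\<lambda>x. c i * Z i x) (normal_density 0 \<bar>c i\<bar>)"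
      using normal_density_affine[OF normal[of i], of "c i" 0] i K(3) by (auto simp: K_def)
  qed
  then have d: "distributed M lborel (\<lambda>x. \<Sum>i\<in>J. c i * Z i x) (normal_density (\<Sum>i\<in>K. 0) (sqrt (\<Sum>i\<in>K. (\<bar>c i\<bar>)\<^sup>2)))"
    unfolding eq .
  have "AE y in lborel. y \<noteq> b" by (rule AE_lborel_singleton)
  then have "AE y in distr M lborel (\<lambda>x. \<Sum>i\<in>J. c i * Z i x). y \<noteq> b"
    unfolding distributed_distr_eq_density[OF d] by (subst AE_density) auto
  then show ?thesis
    by (rule AE_distrD[OF distributed_measurable[OF d]])
qed

text \<open>Of two distinct blocks, one reaches an extreme index that the other misses. The
  difference of the two objectives then gives this noise variable a nonzero weight and is a
  nondegenerate Gaussian, and there are only countably many pairs.\<close>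

lemma AE_crit_no_ties:
  fixes Z :: "int \<Rightarrow> 'a \<Rightarrow> real"
  assumes indep: "indep_vars (\<lambda>_. borel) Z (UNIV - {0})"
    and normal: "\<And>i. i \<noteq> 0 \<Longrightarrow> distributed M lborel (Z i) std_normal_density" and \<sigma>: "\<sigma> > 0"
  shows "AE x in M. crit_no_ties \<sigma> a (\<lambda>i. Z i x)"
proof -
  define co where "co r l i = (if 1 \<le> i \<and> i \<le> int r \<or> - int l \<le> i \<and> i \<le> -1 then \<sigma> / (real r + real l) else 0)"
    for r l :: nat and i :: int
  have lin: "crit_obj \<sigma> a z r l = (\<Sum>i\<in>{- int K..int K} - {0}. co r l i * z i) + a * (real r - real l + 1) / 2"
    if "r \<le> K" "l \<le> K" for z r l K
  proof -
    have "right_sum z r = (\<Sum>i=1..int r. z i)" unfolding right_sum_def by (rule sum_int_interval[symmetric])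
    moreover have "left_sum z l = (\<Sum>i\<in>{- int l..-1}. z i)"
      unfolding left_sum_def
      by (rule sum.reindex_bij_witness[of _ "\<lambda>i. nat (- i)" "\<lambda>i. - int i"]) auto
    moreover have "(\<Sum>i\<in>{1..int r} \<union> {- int l..-1}. z i) = (\<Sum>i=1..int r. z i) + (\<Sum>i\<in>{- int l..-1}. z i)"
      by (rule sum.union_disjoint) auto
    moreover have "(\<Sum>i\<in>{1..int r} \<union> {- int l..-1}. \<sigma> / (real r + real l) * z i) =
        \<sigma> / (real r + real l) * (\<Sum>i\<in>{1..int r} \<union> {- int l..-1}. z i)"
      by (rule sum_distrib_left[symmetric])
    ultimately have "\<sigma> * (right_sum z r + left_sum z l) / (real r + real l) =
        (\<Sum>i\<in>{1..int r} \<union> {- int l..-1}. \<sigma> / (real r + real l) * z i)"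
      by (simp only: times_divide_eq_left)
    also have "\<dots> = (\<Sum>i\<in>{- int K..int K} - {0}. co r l i * z i)"
      by (rule sum.mono_neutral_cong_left) (use that in \<open>auto simp: co_def\<close>)
    finally show ?thesis unfolding crit_obj_walk by simp
  qed
  have pair: "AE x in M. crit_obj \<sigma> a (\<lambda>i. Z i x) r l \<noteq> crit_obj \<sigma> a (\<lambda>i. Z i x) r' l'"
    if lr: "1 \<le> l" "1 \<le> l'" "(r, l) \<noteq> (r', l')" for r l r' l'
  proof -
    define K where "K = max (max r l) (max r' l')"
    let ?J = "{- int K..int K} - {0}"
    have Kle: "r \<le> K" "l \<le> K" "r' \<le> K" "l' \<le> K" by (auto simp: K_def)
    have "\<exists>i\<in>?J. co r l i - co r' l' i \<noteq> 0"
    proof -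
      consider "r < r'" | "r' < r" | "r = r'" "l < l'" | "r = r'" "l' < l"
        using lr(3) by (metis nat_neq_iff)
      then show ?thesis
      proof cases
        case 1 then show ?thesis using \<sigma> lr by (intro bexI[of _ "int r'"]) (auto simp: co_def K_def)
      next
        case 2 then show ?thesis using \<sigma> lr by (intro bexI[of _ "int r"]) (auto simp: co_def K_def)
      next
        case 3 then show ?thesis using \<sigma> lr by (intro bexI[of _ "- int l'"]) (auto simp: co_def K_def)
      next
        case 4 then show ?thesis using \<sigma> lr by (intro bexI[of _ "- int l"]) (auto simp: co_def K_def)
      qed
    qed
    then obtain i0 where i0: "i0 \<in> ?J" "co r l i0 - co r' l' i0 \<noteq> 0" by blast
    have "AE x in M. (\<Sum>i\<in>?J. (co r l i - co r' l' i) * Z i x) \<noteq>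
        a * (real r' - real l' + 1) / 2 - a * (real r - real l + 1) / 2"
      by (rule prob_linear_normal_eq[OF indep normal]) (use i0 in auto)
    then show ?thesis
    proof eventually_elim
      case (elim x)
      then show ?case
        using lin[OF Kle(1,2), of "\<lambda>i. Z i x"] lin[OF Kle(3,4), of "\<lambda>i. Z i x"]
        unfolding left_diff_distrib sum_subtractf by linarith
    qed
  qed
  have "AE x in M. \<forall>r l r' l'. 1 \<le> l \<longrightarrow> 1 \<le> l' \<longrightarrow> (r, l) \<noteq> (r', l') \<longrightarrow>
      crit_obj \<sigma> a (\<lambda>i. Z i x) r l \<noteq> crit_obj \<sigma> a (\<lambda>i. Z i x) r' l'"
    unfolding AE_all_countable using pair by (auto intro: AE_I2)
  then show ?thesis
    by eventually_elim (auto simp: crit_no_ties_def)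
qed

text \<open>Continuous ramps suffice as test functions. They are uniformly continuous with values
  between 0 and 1, so closeness of arguments costs little and its failure costs at most the
  probability of failure.\<close>

lemma weak_conv_of_conv_in_probability:
  fixes T :: "nat \<Rightarrow> 'a \<Rightarrow> real"
  assumes T[measurable]: "\<And>m. T m \<in> borel_measurable M" and L[measurable]: "L \<in> borel_measurable M"
    and conv: "\<And>e. 0 < e \<Longrightarrow> (\<lambda>m. prob {x\<in>space M. e \<le> \<bar>T m x - L x\<bar>}) \<longlonglongrightarrow> 0"
  shows "weak_conv_m (\<lambda>m. distr M borel (T m)) (distr M borel L)"
proof (rule integral_cts_step_conv_imp_weak_conv)
  show "real_distribution (distr M borel (T m))" for m by (rule real_distribution_distr) simp
  show "real_distribution (distr M borel L)" by (rule real_distribution_distr) simp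
  fix a b :: real assume ab: "a < b"
  have cont: "uniformly_continuous_on UNIV (cts_step a b)" by (rule cts_step_uniformly_continuous[OF ab])
  have [measurable]: "cts_step a b \<in> borel_measurable borel"
    using uniformly_continuous_imp_continuous[OF cont] by (rule borel_measurable_continuous_onI)
  have range: "0 \<le> cts_step a b x" "cts_step a b x \<le> 1" for x using ab by (auto simp: cts_step_def)
  have int: "integrable M (\<lambda>x. cts_step a b (f x))" if [measurable]: "f \<in> borel_measurable M" for f
    by (rule integrable_const_bound[of _ 1]) (use range in \<open>auto simp: abs_le_iff intro!: AE_I2\<close>)
  show "(\<lambda>m. integral\<^sup>L (distr M borel (T m)) (cts_step a b)) \<longlonglongrightarrow> integral\<^sup>L (distr M borel L) (cts_step a b)"
  proof (rule LIMSEQ_I)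
    fix e :: real assume e: "0 < e"
    obtain \<delta> where \<delta>: "0 < \<delta>" "\<And>x x'. dist x' x < \<delta> \<Longrightarrow> dist (cts_step a b x') (cts_step a b x) < e / 2"
      using cont e unfolding uniformly_continuous_on_def by (metis UNIV_I half_gt_zero)
    obtain m0 where m0: "\<And>m. m0 \<le> m \<Longrightarrow> prob {x\<in>space M. \<delta> \<le> \<bar>T m x - L x\<bar>} < e / 2"
      using LIMSEQ_D[OF conv[OF \<delta>(1)], of "e / 2"] e by auto
    show "\<exists>no. \<forall>m\<ge>no. norm (integral\<^sup>L (distr M borel (T m)) (cts_step a b) - integral\<^sup>L (distr M borel L) (cts_step a b)) < e"
    proof (intro exI allI impI)
      fix m assume m: "m0 \<le> m"
      let ?A = "{x\<in>space M. \<delta> \<le> \<bar>T m x - L x\<bar>}"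
      have [measurable]: "?A \<in> events" by measurable
      have intA: "integrable M (indicator ?A :: 'a \<Rightarrow> real)"
        by (rule integrable_const_bound[of _ 1]) auto
      have "norm (integral\<^sup>L (distr M borel (T m)) (cts_step a b) - integral\<^sup>L (distr M borel L) (cts_step a b))
          = norm (expectation (\<lambda>x. cts_step a b (T m x) - cts_step a b (L x)))"
        by (simp add: integral_distr int)
      also have "\<dots> \<le> expectation (\<lambda>x. norm (cts_step a b (T m x) - cts_step a b (L x)))"
        by (rule integral_norm_bound)
      also have "\<dots> \<le> expectation (\<lambda>x. e / 2 + indicator ?A x)"
      proof (rule integral_mono)
        show "integrable M (\<lambda>x. norm (cts_step a b (T m x) - cts_step a b (L x)))"
          by (intro integrable_norm Bochner_Integration.integrable_diff int T L)
        fix x assume x: "x \<in> space M"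
        show "norm (cts_step a b (T m x) - cts_step a b (L x)) \<le> e / 2 + indicator ?A x"
        proof (cases "x \<in> ?A")
          case True
          have "norm (cts_step a b (T m x) - cts_step a b (L x)) \<le> 1"
            using range[of "T m x"] range[of "L x"] by (simp add: abs_le_iff)
          then show ?thesis using True e by simp
        next
          case False
          then have "dist (T m x) (L x) < \<delta>" using x by (simp add: dist_real_def)
          from \<delta>(2)[OF this] show ?thesis using False by (simp add: dist_real_def)
        qed
      next
        show "integrable M (\<lambda>x. e / 2 + indicator ?A x :: real)"
          by (rule integrable_const_bound[of _ "e / 2 + 1"])
             (use e in \<open>auto simp: indicator_def intro!: AE_I2\<close>)
      qed
      also have "\<dots> = e / 2 + prob ?A" by (subst Bochner_Integration.integral_add) (auto simp: prob_space intA)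
      also have "\<dots> < e" using m0[OF m] by simp
      finally show "norm (integral\<^sup>L (distr M borel (T m)) (cts_step a b) - integral\<^sup>L (distr M borel L) (cts_step a b)) < e" .
    qed
  qed
qed

end

section \<open>The statistic as a function of the row means\<close>

lemma min_max_average_measurable:
  assumes y[measurable]: "\<And>i. i \<in> {1..n} \<Longrightarrow> (\<lambda>x. y x i) \<in> borel_measurable M" and k: "k \<in> {1..n}"
  shows "(\<lambda>x. min_max_average n (y x) k) \<in> borel_measurable M"
proof -
  have A: "(\<lambda>x. (\<Sum>i\<in>{t<..u}. y x i) / real (u - t)) \<in> borel_measurable M" if "u \<in> {k..n}" for u t
    by (intro borel_measurable_divide borel_measurable_sum y borel_measurable_const) (use that in auto)
  have "(\<lambda>x. Max ((\<lambda>t. (\<Sum>i\<in>{t<..u}. y x i) / real (u - t)) ` {..<k})) \<in> borel_measurable M" if "u \<in> {k..n}" for u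
    by (rule borel_measurable_Max) (use k A that in auto)
  then show ?thesis
    unfolding min_max_average_def by (intro borel_measurable_Min) (use k in auto)
qed

lemma min_max_average_cong:
  assumes "\<And>i. i \<in> {1..n} \<Longrightarrow> y i = y' i" "k \<in> {1..n}"
  shows "min_max_average n y k = min_max_average n y' k"
proof -
  have "(\<Sum>i\<in>{t<..u}. y i) = (\<Sum>i\<in>{t<..u}. y' i)" if "u \<in> {k..n}" for t u
    by (rule sum.cong[OF refl], rule assms(1)) (use that in auto)
  then have "(MAX t\<in>{..<k}. (\<Sum>i\<in>{t<..u}. y i) / real (u - t)) =
      (MAX t\<in>{..<k}. (\<Sum>i\<in>{t<..u}. y' i) / real (u - t))" if "u \<in> {k..n}" for u
    using that by (simp only:)
  then show ?thesis
    unfolding min_max_average_def by (rule arg_cong[OF image_cong[OF refl]])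
qed

lemma isotonic_kkt_cong:
  assumes "isotonic_kkt n y h" "\<And>i. i \<in> {1..n} \<Longrightarrow> y i = y' i" "\<And>i. i \<in> {1..n} \<Longrightarrow> h i = h' i"
  shows "isotonic_kkt n y' h'"
  by (rule isotonic_kkt_affine[OF assms(1), of 1 _ 0]) (simp_all add: assms(2,3))

text \<open>The rescaled row means around the centre; the last term is the effect of the estimated
  intercept.\<close>

definition noisy_drift :: "nat \<Rightarrow> real \<Rightarrow> (nat \<Rightarrow> real) \<Rightarrow> (nat \<Rightarrow> real) \<Rightarrow> nat \<Rightarrow> real" where
  "noisy_drift n \<sigma> d w k = \<sigma> * w k + d k - \<sigma> * (\<Sum>i=1..n. w i) / real n"

text \<open>The min-max formula is used instead of a solution of the optimality conditions, so that
  the statistic is defined for every noise vector and is measurable in it.\<close>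

definition block_statistic :: "nat \<Rightarrow> nat \<Rightarrow> real \<Rightarrow> (nat \<Rightarrow> real) \<Rightarrow> (nat \<Rightarrow> real) \<Rightarrow> real" where
  "block_statistic n k0 \<sigma> d w = (let h = min_max_average n (noisy_drift n \<sigma> d w) in
     sqrt (real (card {k\<in>{1..n}. h k = h k0})) * h k0)"

text \<open>Existence of a solution comes from the estimator, which lives on the original space.
  Recorded as a measurable property of the noise vector alone, it can be carried to the coupled
  space.\<close>

definition isotonic_noise :: "nat \<Rightarrow> real \<Rightarrow> (nat \<Rightarrow> real) \<Rightarrow> (nat \<Rightarrow> real) \<Rightarrow> bool" where
  "isotonic_noise n \<sigma> d w \<longleftrightarrow> isotonic_kkt n (noisy_drift n \<sigma> d w) (min_max_average n (noisy_drift n \<sigma> d w))"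

lemma noisy_drift_cong:
  assumes "\<And>i. i \<in> {1..n} \<Longrightarrow> w i = w' i" "k \<in> {1..n}"
  shows "noisy_drift n \<sigma> d w k = noisy_drift n \<sigma> d w' k"
  using assms sum.cong[of "{1..n}" "{1..n}" w w'] by (simp add: noisy_drift_def)

text \<open>Laws are compared on products over \<open>{1..n}\<close>, whose elements are restricted
  functions; the statistic reads no other coordinates.\<close>

lemma block_statistic_cong:
  assumes "\<And>i. i \<in> {1..n} \<Longrightarrow> w i = w' i" "k0 \<in> {1..n}"
  shows "block_statistic n k0 \<sigma> d w = block_statistic n k0 \<sigma> d w'"
proof -
  have eq: "min_max_average n (noisy_drift n \<sigma> d w) k = min_max_average n (noisy_drift n \<sigma> d w') k"
    if "k \<in> {1..n}" for k
    using that by (intro min_max_average_cong noisy_drift_cong assms(1))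
  have "{k\<in>{1..n}. min_max_average n (noisy_drift n \<sigma> d w) k = min_max_average n (noisy_drift n \<sigma> d w) k0} =
      {k\<in>{1..n}. min_max_average n (noisy_drift n \<sigma> d w') k = min_max_average n (noisy_drift n \<sigma> d w') k0}"
    using eq assms(2) by auto
  then show ?thesis unfolding block_statistic_def Let_def using eq[OF assms(2)] by simp
qed

lemma isotonic_noise_cong:
  assumes "isotonic_noise n \<sigma> d w" "\<And>i. i \<in> {1..n} \<Longrightarrow> w i = w' i"
  shows "isotonic_noise n \<sigma> d w'"
  using assms(1) unfolding isotonic_noise_def
proof (rule isotonic_kkt_cong)
  show drift: "noisy_drift n \<sigma> d w i = noisy_drift n \<sigma> d w' i" if "i \<in> {1..n}" for i
    by (rule noisy_drift_cong[OF assms(2) that])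
  show "min_max_average n (noisy_drift n \<sigma> d w) i = min_max_average n (noisy_drift n \<sigma> d w') i"
    if "i \<in> {1..n}" for i
    by (rule min_max_average_cong[OF drift that])
qed

lemma noisy_drift_measurable:
  assumes "\<And>i. i \<in> {1..n} \<Longrightarrow> (\<lambda>x. w x i) \<in> borel_measurable M" "k \<in> {1..n}"
  shows "(\<lambda>x. noisy_drift n \<sigma> d (w x) k) \<in> borel_measurable M"
  unfolding noisy_drift_def using assms
  by (intro borel_measurable_diff borel_measurable_add borel_measurable_times borel_measurable_divide
      borel_measurable_sum borel_measurable_const) auto

lemma block_statistic_measurable:
  assumes w: "\<And>i. i \<in> {1..n} \<Longrightarrow> (\<lambda>x. w x i) \<in> borel_measurable M" and k0: "k0 \<in> {1..n}"
  shows "(\<lambda>x. block_statistic n k0 \<sigma> d (w x)) \<in> borel_measurable M"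
proof -
  let ?h = "\<lambda>x. min_max_average n (noisy_drift n \<sigma> d (w x))"
  have h[measurable]: "(\<lambda>x. ?h x k) \<in> borel_measurable M" if "k \<in> {1..n}" for k
    by (rule min_max_average_measurable[OF noisy_drift_measurable[OF w] that])
  have "real (card {k\<in>{1..n}. ?h x k = ?h x k0}) = (\<Sum>k=1..n. if ?h x k = ?h x k0 then 1 else 0)" for x
    by (simp add: sum.If_cases Int_def)
  then have eq: "block_statistic n k0 \<sigma> d (w x) =
      sqrt (\<Sum>k=1..n. if ?h x k = ?h x k0 then 1 else 0) * ?h x k0" for x
    by (simp add: block_statistic_def Let_def)
  show ?thesis
    unfolding eq
  proof (intro borel_measurable_times borel_measurable_sum h[OF k0] measurable_compose[OF _ borel_measurable_sqrt])
    fix k assume k: "k \<in> {1..n}"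
    note [measurable] = h[OF k] h[OF k0]
    show "(\<lambda>x. if ?h x k = ?h x k0 then 1 else 0 :: real) \<in> borel_measurable M" by measurable
  qed
qed

lemma isotonic_noise_measurable:
  assumes w: "\<And>i. i \<in> {1..n} \<Longrightarrow> (\<lambda>x. w x i) \<in> borel_measurable M"
  shows "Measurable.pred M (\<lambda>x. isotonic_noise n \<sigma> d (w x))"
proof -
  let ?y = "\<lambda>x. noisy_drift n \<sigma> d (w x)"
  let ?h = "\<lambda>x. min_max_average n (?y x)"
  have h: "(\<lambda>x. ?h x k) \<in> borel_measurable M" if "k \<in> {1..n}" for k
    by (rule min_max_average_measurable[OF noisy_drift_measurable[OF w] that])
  have s: "(\<lambda>x. \<Sum>i=1..k. ?y x i - ?h x i) \<in> borel_measurable M" if "k \<le> n" for k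
    by (intro borel_measurable_sum borel_measurable_diff h noisy_drift_measurable[OF w]) (use that in auto)
  have eq: "isotonic_noise n \<sigma> d (w x) \<longleftrightarrow> (\<forall>r\<in>{1..n}. \<forall>s\<in>{1..n}. r \<le> s \<longrightarrow> ?h x r \<le> ?h x s) \<and>
      (\<forall>k\<in>{..n}. 0 \<le> (\<Sum>i=1..k. ?y x i - ?h x i)) \<and> (\<Sum>i=1..n. ?y x i - ?h x i) = 0 \<and>
      (\<forall>k\<in>{1..<n}. ?h x k < ?h x (Suc k) \<longrightarrow> (\<Sum>i=1..k. ?y x i - ?h x i) = 0)" for x
    unfolding isotonic_noise_def isotonic_kkt_def by (auto simp: mono_on_def)
  have 1: "Measurable.pred M (\<lambda>x. r \<le> s \<longrightarrow> ?h x r \<le> ?h x s)" if "r \<in> {1..n}" "s \<in> {1..n}" for r s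
  proof -
    note [measurable] = h[OF that(1)] h[OF that(2)]
    show ?thesis by measurable
  qed
  have 2: "Measurable.pred M (\<lambda>x. 0 \<le> (\<Sum>i=1..k. ?y x i - ?h x i))" if "k \<in> {..n}" for k
  proof -
    have "k \<le> n" using that by simp
    note [measurable] = s[OF this]
    show ?thesis by measurable
  qed
  have 3: "Measurable.pred M (\<lambda>x. ?h x k < ?h x (Suc k) \<longrightarrow> (\<Sum>i=1..k. ?y x i - ?h x i) = 0)"
    if "k \<in> {1..<n}" for k
  proof -
    have "k \<in> {1..n}" "Suc k \<in> {1..n}" "k \<le> n" using that by auto
    note [measurable] = h[OF this(1)] h[OF this(2)] s[OF this(3)]
    show ?thesis by measurable
  qed
  have 4: "Measurable.pred M (\<lambda>x. (\<Sum>i=1..n. ?y x i - ?h x i) = 0)"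
  proof -
    note [measurable] = s[OF order_refl]
    show ?thesis by measurable
  qed
  show ?thesis
    unfolding eq by (intro pred_intros_logic pred_intros_finite 1 2 3 4) auto
qed

lemma crit_L_cong:
  assumes "\<And>i. i \<noteq> 0 \<Longrightarrow> z i = z' i"
  shows "crit_L \<sigma> a z = crit_L \<sigma> a z'"
proof -
  have "right_sum z = right_sum z'" "left_sum z = left_sum z'"
    unfolding right_sum_def left_sum_def using assms by (auto intro!: ext sum.cong)
  then have "crit_obj \<sigma> a z = crit_obj \<sigma> a z'" by (intro ext) (simp add: crit_obj_walk)
  then have "crit_sup \<sigma> a z = crit_sup \<sigma> a z'" "crit_obj \<sigma> a z = crit_obj \<sigma> a z'"
    by (auto intro!: ext simp: crit_sup_def)
  then show ?thesis by (simp add: crit_L_def crit_l_def crit_r_def crit_G_def)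
qed

section \<open>Product spaces and transfer between probability spaces\<close>

lemma indep_vars_PiM_coordinates:
  assumes \<Lambda>: "prob_space \<Lambda>" and I: "I \<noteq> {}"
  shows "prob_space.indep_vars (PiM I (\<lambda>_. \<Lambda>)) (\<lambda>_. \<Lambda>) (\<lambda>i \<omega>. \<omega> i) I"
proof -
  interpret P: prob_space "PiM I (\<lambda>_. \<Lambda>)" by (rule prob_space_PiM[OF \<Lambda>])
  have "distr (PiM I (\<lambda>_. \<Lambda>)) (PiM I (\<lambda>_. \<Lambda>)) (\<lambda>x. \<lambda>i\<in>I. x i) = distr (PiM I (\<lambda>_. \<Lambda>)) (PiM I (\<lambda>_. \<Lambda>)) (\<lambda>x. x)"
    by (rule distr_cong) (auto simp: space_PiM PiE_restrict)
  also have "\<dots> = PiM I (\<lambda>_. \<Lambda>)" by (rule distr_id)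
  also have "\<dots> = PiM I (\<lambda>i. distr (PiM I (\<lambda>_. \<Lambda>)) \<Lambda> (\<lambda>\<omega>. \<omega> i))"
    by (rule PiM_cong) (use distr_PiM_component[of I "\<lambda>_. \<Lambda>"] \<Lambda> in auto)
  finally show ?thesis
    by (subst P.indep_vars_iff_distr_eq_PiM'[OF I]) auto
qed

lemma distr_eq_of_indep_same_marginals:
  fixes X :: "'i \<Rightarrow> 'a \<Rightarrow> real" and X' :: "'i \<Rightarrow> 'b \<Rightarrow> real"
  assumes M: "prob_space M" "prob_space.indep_vars M (\<lambda>_. borel) X I"
    and M': "prob_space M'" "prob_space.indep_vars M' (\<lambda>_. borel) X' I"
    and eq: "\<And>i. i \<in> I \<Longrightarrow> distr M borel (X i) = distr M' borel (X' i)" and I: "I \<noteq> {}"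
  shows "distr M (PiM I (\<lambda>_. borel)) (\<lambda>x. \<lambda>i\<in>I. X i x) = distr M' (PiM I (\<lambda>_. borel)) (\<lambda>x. \<lambda>i\<in>I. X' i x)"
proof -
  have rv: "X i \<in> borel_measurable M" "X' i \<in> borel_measurable M'" if "i \<in> I" for i
    using M M' that by (auto simp: prob_space.indep_vars_def)
  have "distr M (PiM I (\<lambda>_. borel)) (\<lambda>x. \<lambda>i\<in>I. X i x) = PiM I (\<lambda>i. distr M borel (X i))"
    using prob_space.indep_vars_iff_distr_eq_PiM'[OF M(1) I, where M' = "\<lambda>_. borel" and X = X] M(2) rv by blast
  also have "\<dots> = PiM I (\<lambda>i. distr M' borel (X' i))"
    by (rule PiM_cong) (auto simp: eq)
  also have "\<dots> = distr M' (PiM I (\<lambda>_. borel)) (\<lambda>x. \<lambda>i\<in>I. X' i x)"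
    using prob_space.indep_vars_iff_distr_eq_PiM'[OF M'(1) I, where M' = "\<lambda>_. borel" and X = X'] M'(2) rv by metis
  finally show ?thesis .
qed

lemma transfer_of_distr_eq:
  assumes eq: "distr M S X = distr M' S X'"
    and X[measurable]: "X \<in> measurable M S" "X' \<in> measurable M' S"
  shows "f \<in> borel_measurable S \<Longrightarrow> distr M borel (\<lambda>x. f (X x)) = distr M' borel (\<lambda>x. f (X' x))"
    and "Measurable.pred S Q \<Longrightarrow> AE x in M. Q (X x) \<Longrightarrow> AE x in M'. Q (X' x)"
proof -
  show "distr M borel (\<lambda>x. f (X x)) = distr M' borel (\<lambda>x. f (X' x))" if [measurable]: "f \<in> borel_measurable S"
  proof -
    have "distr M borel (\<lambda>x. f (X x)) = distr (distr M S X) borel f"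
      by (subst distr_distr[OF that X(1)]) (simp add: comp_def)
    also have "\<dots> = distr M' borel (\<lambda>x. f (X' x))"
      unfolding eq by (subst distr_distr[OF that X(2)]) (simp add: comp_def)
    finally show ?thesis .
  qed
  show "AE x in M'. Q (X' x)" if [measurable]: "Measurable.pred S Q" and ae: "AE x in M. Q (X x)"
  proof -
    have S: "{x \<in> space S. Q x} \<in> sets S" by measurable
    have "AE x in distr M S X. Q x" using ae by (subst AE_distr_iff[OF X(1) S])
    then show ?thesis unfolding eq by (subst (asm) AE_distr_iff[OF X(2) S])
  qed
qed

section \<open>The law of a normalized row sum\<close>

text \<open>The errors of different designs live on unrelated spaces. Realizing the law on one
  infinite product makes the row sums part of a single i.i.d. sequence, to which the central limit
  theorem applies.\<close>

definition normalized_sum_law :: "real measure \<Rightarrow> real \<Rightarrow> nat \<Rightarrow> real measure" where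
  "normalized_sum_law \<nu> \<sigma> n = distr (PiM UNIV (\<lambda>_::nat. \<nu>)) borel (\<lambda>\<omega>. (\<Sum>i<n. \<omega> i) / sqrt (real n * \<sigma>\<^sup>2))"

context
  fixes \<nu> :: "real measure" and \<sigma> :: real
  assumes \<nu>: "prob_space \<nu>" "sets \<nu> = sets borel"
    and mom: "integrable \<nu> (\<lambda>e. e\<^sup>2)" "(LINT e|\<nu>. e) = 0" "(LINT e|\<nu>. e\<^sup>2) = \<sigma>\<^sup>2" and \<sigma>: "0 < \<sigma>"
begin

lemma coordinates_indep:
  "prob_space.indep_vars (PiM UNIV (\<lambda>_::nat. \<nu>)) (\<lambda>_. borel) (\<lambda>i \<omega>. \<omega> i) UNIV"
proof -
  interpret P: prob_space "PiM UNIV (\<lambda>_::nat. \<nu>)" by (rule prob_space_PiM[OF \<nu>(1)])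
  have "P.indep_vars (\<lambda>_. borel) (\<lambda>i \<omega>. (\<lambda>e. e) (\<omega> i)) UNIV"
    by (rule P.indep_vars_compose2[OF indep_vars_PiM_coordinates[OF \<nu>(1)]])
       (use \<nu>(2) measurable_cong_sets[OF \<nu>(2) refl] in auto)
  then show ?thesis by simp
qed

lemma coordinates_distr: "distr (PiM UNIV (\<lambda>_::nat. \<nu>)) borel (\<lambda>\<omega>. \<omega> i) = \<nu>"
proof -
  have "distr (PiM UNIV (\<lambda>_::nat. \<nu>)) borel (\<lambda>\<omega>. \<omega> i) = distr (PiM UNIV (\<lambda>_::nat. \<nu>)) \<nu> (\<lambda>\<omega>. \<omega> i)"
    by (rule distr_cong) (simp_all add: \<nu>(2))
  then show ?thesis using distr_PiM_component[of UNIV "\<lambda>_. \<nu>" i] \<nu>(1) by simp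
qed

lemma normalized_sum_law_real_distribution: "real_distribution (normalized_sum_law \<nu> \<sigma> n)"
proof -
  interpret P: prob_space "PiM UNIV (\<lambda>_::nat. \<nu>)" by (rule prob_space_PiM[OF \<nu>(1)])
  have [measurable]: "(\<lambda>\<omega>. \<omega> i) \<in> borel_measurable (PiM UNIV (\<lambda>_::nat. \<nu>))" for i
    using coordinates_indep by (auto simp: P.indep_vars_def)
  show ?thesis unfolding normalized_sum_law_def by (rule P.real_distribution_distr) measurable
qed

lemma coordinate_moments:
  fixes i :: nat
  defines "\<Omega> \<equiv> PiM UNIV (\<lambda>_::nat. \<nu>)"
  shows "integrable \<Omega> (\<lambda>\<omega>. (\<omega> i)\<^sup>2)" "(LINT \<omega>|\<Omega>. \<omega> i) = 0" "(LINT \<omega>|\<Omega>. (\<omega> i)\<^sup>2) = \<sigma>\<^sup>2"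
proof -
  interpret P: prob_space \<Omega> unfolding \<Omega>_def by (rule prob_space_PiM[OF \<nu>(1)])
  have rv: "(\<lambda>\<omega>. \<omega> i) \<in> borel_measurable \<Omega>"
    using coordinates_indep unfolding \<Omega>_def[symmetric] by (auto simp: P.indep_vars_def)
  note d = coordinates_distr[of i, folded \<Omega>_def]
  have "integrable (distr \<Omega> borel (\<lambda>\<omega>. \<omega> i)) (\<lambda>e. e\<^sup>2) \<longleftrightarrow> integrable \<Omega> (\<lambda>\<omega>. (\<omega> i)\<^sup>2)"
    by (rule integrable_distr_eq[OF rv]) simp
  then show "integrable \<Omega> (\<lambda>\<omega>. (\<omega> i)\<^sup>2)" unfolding d using mom(1) by blast
  have "(LINT e|distr \<Omega> borel (\<lambda>\<omega>. \<omega> i). e) = (LINT \<omega>|\<Omega>. \<omega> i)"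
    by (rule integral_distr[OF rv]) simp
  then show "(LINT \<omega>|\<Omega>. \<omega> i) = 0" unfolding d mom(2) by simp
  have "(LINT e|distr \<Omega> borel (\<lambda>\<omega>. \<omega> i). e\<^sup>2) = (LINT \<omega>|\<Omega>. (\<omega> i)\<^sup>2)"
    by (rule integral_distr[OF rv]) simp
  then show "(LINT \<omega>|\<Omega>. (\<omega> i)\<^sup>2) = \<sigma>\<^sup>2" unfolding d mom(3) by simp
qed

lemma normalized_sum_law_conv: "weak_conv_m (normalized_sum_law \<nu> \<sigma>) std_normal_distribution"
proof -
  interpret P: prob_space "PiM UNIV (\<lambda>_::nat. \<nu>)" by (rule prob_space_PiM[OF \<nu>(1)])
  show ?thesis
    unfolding normalized_sum_law_def
    by (rule P.central_limit_theorem_zero_mean[OF coordinates_indep coordinate_moments(2) \<sigma>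
        coordinate_moments(1) _ coordinates_distr]) (simp add: coordinate_moments)
qed

text \<open>Exact moments at every \<open>n\<close>, not only in the limit: they feed the Chebyshev
  bounds that must be uniform over the designs.\<close>

lemma normalized_sum_law_moments:
  assumes n: "0 < n"
  shows "integrable (normalized_sum_law \<nu> \<sigma> n) (\<lambda>x. x\<^sup>2)" "(LINT x|normalized_sum_law \<nu> \<sigma> n. x) = 0"
    "(LINT x|normalized_sum_law \<nu> \<sigma> n. x\<^sup>2) = 1"
proof -
  let ?P = "PiM UNIV (\<lambda>_::nat. \<nu>)"
  interpret P: prob_space ?P by (rule prob_space_PiM[OF \<nu>(1)])
  note indep = coordinates_indep
  note co = coordinate_moments
  have rv[measurable]: "(\<lambda>\<omega>. \<omega> i) \<in> borel_measurable ?P" for i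
    using indep by (auto simp: P.indep_vars_def)
  have ind: "P.indep_vars (\<lambda>_. borel) (\<lambda>i \<omega>. \<omega> i / \<sigma>) UNIV"
    by (rule P.indep_vars_compose2[OF indep]) auto
  have int: "integrable ?P (\<lambda>\<omega>. \<omega> i)" for i
    by (rule P.square_integrable_imp_integrable[OF rv co(1)])
  have c: "integrable ?P (\<lambda>\<omega>. (\<omega> i / \<sigma>)\<^sup>2)" "P.expectation (\<lambda>\<omega>. \<omega> i / \<sigma>) = 0"
    "P.expectation (\<lambda>\<omega>. (\<omega> i / \<sigma>)\<^sup>2) = 1" for i
    using co[of i] \<sigma> by (simp_all add: power_divide)
  let ?f = "\<lambda>\<omega>. (\<Sum>i<n. \<omega> i) / sqrt (real n * \<sigma>\<^sup>2)"
  have f: "?f \<omega> = (\<Sum>i<n. \<omega> i / \<sigma>) / sqrt (real n)" for \<omega>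
    using \<sigma> by (simp add: real_sqrt_mult sum_divide_distrib[symmetric])
  note S = P.expectation_sum_squared[OF ind c, of "{..<n}"]
  have "integrable ?P (\<lambda>\<omega>. (?f \<omega>)\<^sup>2)"
    unfolding f power_divide using S(1) by simp
  then show "integrable (normalized_sum_law \<nu> \<sigma> n) (\<lambda>x. x\<^sup>2)"
    unfolding normalized_sum_law_def by (subst integrable_distr_eq) auto
  have "P.expectation (\<lambda>\<omega>. (?f \<omega>)\<^sup>2) = 1"
    unfolding f power_divide using S(2) n by simp
  then show "(LINT x|normalized_sum_law \<nu> \<sigma> n. x\<^sup>2) = 1"
    unfolding normalized_sum_law_def by (subst integral_distr) auto
  have "P.expectation ?f = (\<Sum>i<n. P.expectation (\<lambda>\<omega>. \<omega> i)) / sqrt (real n * \<sigma>\<^sup>2)"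
    by (simp add: Bochner_Integration.integral_sum int)
  then have "P.expectation ?f = 0" using co(2) by simp
  then show "(LINT x|normalized_sum_law \<nu> \<sigma> n. x) = 0"
    unfolding normalized_sum_law_def by (subst integral_distr) auto
qed

text \<open>Both sums have the characteristic function of \<nu> raised to the power
  \<open>card A\<close>, so no enumeration of \<open>A\<close> is required.\<close>

lemma distr_normalized_sum:
  fixes X :: "'i \<Rightarrow> 'a \<Rightarrow> real"
  assumes M: "prob_space M" and indep: "prob_space.indep_vars M (\<lambda>_. borel) X A"
    and d: "\<And>x. x \<in> A \<Longrightarrow> distr M borel (X x) = \<nu>" and A: "finite A"
  shows "distr M borel (\<lambda>\<omega>. (\<Sum>x\<in>A. X x \<omega>) / sqrt (real (card A) * \<sigma>\<^sup>2)) = normalized_sum_law \<nu> \<sigma> (card A)"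
proof -
  interpret M: prob_space M by fact
  interpret P: prob_space "PiM UNIV (\<lambda>_::nat. \<nu>)" by (rule prob_space_PiM[OF \<nu>(1)])
  have [measurable]: "(\<lambda>\<omega>. \<omega> i) \<in> borel_measurable (PiM UNIV (\<lambda>_::nat. \<nu>))" for i
    using coordinates_indep by (auto simp: P.indep_vars_def)
  have rX: "X x \<in> borel_measurable M" if "x \<in> A" for x
    using indep that by (auto simp: M.indep_vars_def)
  have sX[measurable]: "(\<lambda>\<omega>. \<Sum>x\<in>A. X x \<omega>) \<in> borel_measurable M"
    by (intro borel_measurable_sum rX)
  let ?n = "card A"
  have "distr M borel (\<lambda>\<omega>. \<Sum>x\<in>A. X x \<omega>) = distr (PiM UNIV (\<lambda>_::nat. \<nu>)) borel (\<lambda>\<omega>. \<Sum>i<?n. \<omega> i)"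
  proof (rule Levy_uniqueness)
    show "real_distribution (distr M borel (\<lambda>\<omega>. \<Sum>x\<in>A. X x \<omega>))" by (rule M.real_distribution_distr) simp
    show "real_distribution (distr (PiM UNIV (\<lambda>_::nat. \<nu>)) borel (\<lambda>\<omega>. \<Sum>i<?n. \<omega> i))"
      by (rule P.real_distribution_distr) simp
    show "char (distr M borel (\<lambda>\<omega>. \<Sum>x\<in>A. X x \<omega>)) = char (distr (PiM UNIV (\<lambda>_::nat. \<nu>)) borel (\<lambda>\<omega>. \<Sum>i<?n. \<omega> i))"
    proof
      fix t
      have "char (distr M borel (\<lambda>\<omega>. \<Sum>x\<in>A. X x \<omega>)) t = (\<Prod>x\<in>A. char \<nu> t)"
        unfolding M.char_distr_sum[OF indep] by (rule prod.cong) (simp_all add: d)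
      also have "\<dots> = (\<Prod>i<?n. char \<nu> t)" by simp
      also have "\<dots> = char (distr (PiM UNIV (\<lambda>_::nat. \<nu>)) borel (\<lambda>\<omega>. \<Sum>i<?n. \<omega> i)) t"
        by (subst P.char_distr_sum[OF P.indep_vars_subset[OF coordinates_indep]]) (simp_all only: coordinates_distr subset_UNIV)
      finally show "char (distr M borel (\<lambda>\<omega>. \<Sum>x\<in>A. X x \<omega>)) t =
        char (distr (PiM UNIV (\<lambda>_::nat. \<nu>)) borel (\<lambda>\<omega>. \<Sum>i<?n. \<omega> i)) t" .
    qed
  qed
  from transfer_of_distr_eq(1)[OF this, of "\<lambda>s. s / sqrt (real ?n * \<sigma>\<^sup>2)"]
  show ?thesis unfolding normalized_sum_law_def by simp
qed

end

section \<open>Dependence of the limit law on the slope\<close>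

context prob_space
begin

lemma std_normal_moments:
  fixes X :: "'a \<Rightarrow> real"
  assumes "distributed M lborel X std_normal_density"
  shows "integrable M (\<lambda>x. (X x)\<^sup>2)" "expectation X = 0" "expectation (\<lambda>x. (X x)\<^sup>2) = 1"
proof -
  have rv[measurable]: "random_variable borel X" using distributed_measurable[OF assms] by simp
  have d: "distr M borel X = std_normal_distribution"
    using distributed_distr_eq_density[OF assms] by (simp add: distr_cong[OF refl _ refl, of lborel borel])
  show "integrable M (\<lambda>x. (X x)\<^sup>2)"
    using integrable_std_normal_distribution_moment[of 2] unfolding d[symmetric]
    by (subst (asm) integrable_distr_eq) auto
  show "expectation (\<lambda>x. (X x)\<^sup>2) = 1"
    using std_normal_distribution_even_moments[of 1] unfolding d[symmetric]
    by (subst (asm) integral_distr) auto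
  show "expectation X = 0"
    using integral_std_normal_distribution_moment_odd[of 1, OF odd_one] unfolding d[symmetric]
    by (subst (asm) integral_distr) auto
qed

lemma std_normal_interval_pos:
  fixes X :: "'a \<Rightarrow> real"
  assumes d: "distributed M lborel X std_normal_density"
  shows "0 < prob {x\<in>space M. X x \<in> {t..<t + 1}}"
proof -
  have rv[measurable]: "random_variable borel X" using distributed_measurable[OF d] by simp
  have "prob {x\<in>space M. X x \<in> {t..<t + 1}} \<noteq> 0"
  proof
    assume 0: "prob {x\<in>space M. X x \<in> {t..<t + 1}} = 0"
    have "(\<integral>\<^sup>+x. ennreal (std_normal_density x) * indicator {t..<t + 1} x \<partial>lborel) = emeasure M (X -` {t..<t + 1} \<inter> space M)"
      by (rule distributed_emeasure[OF d, symmetric]) simp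
    also have "X -` {t..<t + 1} \<inter> space M = {x\<in>space M. X x \<in> {t..<t + 1}}" by auto
    finally have "AE x in lborel. ennreal (std_normal_density x) * indicator {t..<t + 1} x = 0"
      using 0 by (subst (asm) emeasure_eq_measure, subst nn_integral_0_iff_AE[symmetric]) auto
    then have "AE x in lborel. x \<notin> {t..<t + 1}"
    proof eventually_elim
      case (elim x)
      have "ennreal (std_normal_density x) \<noteq> 0"
        using normal_density_pos[of 1 0 x] by simp
      then show ?case using elim by (auto simp: indicator_def)
    qed
    then have "emeasure lborel {t..<t + 1} = 0"
      by (subst (asm) AE_iff_measurable[of "{t..<t + 1}"]) auto
    then show False by simp
  qed
  then show ?thesis by (simp add: zero_less_measure_iff)
qed

text \<open>Shifting the density by \<open>\<delta>\<close> gains an exponential factor, which compares two Gaussian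
  tails without computing either.\<close>

lemma std_normal_tail_shift:
  fixes X :: "'a \<Rightarrow> real"
  assumes d: "distributed M lborel X std_normal_density" and \<delta>: "0 \<le> \<delta>"
  shows "prob {x\<in>space M. s \<le> X x} \<le> exp (\<delta>\<^sup>2 / 2 - \<delta> * s) * prob {x\<in>space M. s - \<delta> \<le> X x}"
proof -
  have tail: "ennreal (prob {x\<in>space M. t \<le> X x}) = (\<integral>\<^sup>+x. ennreal (std_normal_density x) * indicator {t..} x \<partial>lborel)" for t
  proof -
    have "(\<integral>\<^sup>+x. ennreal (std_normal_density x) * indicator {t..} x \<partial>lborel) = emeasure M (X -` {t..} \<inter> space M)"
      by (rule distributed_emeasure[OF d, symmetric]) simp
    also have "X -` {t..} \<inter> space M = {x\<in>space M. t \<le> X x}" by auto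
    finally show ?thesis by (simp add: emeasure_eq_measure)
  qed
  have "ennreal (prob {x\<in>space M. s \<le> X x}) =
      (\<integral>\<^sup>+x. ennreal (std_normal_density (\<delta> + x)) * indicator {s..} (\<delta> + x) \<partial>lborel)"
    unfolding tail by (subst nn_integral_real_affine[where c = 1 and t = \<delta>]) auto
  also have "\<dots> \<le> (\<integral>\<^sup>+x. ennreal (exp (\<delta>\<^sup>2 / 2 - \<delta> * s)) * (ennreal (std_normal_density x) * indicator {s - \<delta>..} x) \<partial>lborel)"
  proof (rule nn_integral_mono)
    fix x :: real
    show "ennreal (std_normal_density (\<delta> + x)) * indicator {s..} (\<delta> + x)
      \<le> ennreal (exp (\<delta>\<^sup>2 / 2 - \<delta> * s)) * (ennreal (std_normal_density x) * indicator {s - \<delta>..} x)"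
    proof (cases "s - \<delta> \<le> x")
      case True
      \<comment> \<open>The ratio of the shifted density to the original one is exp (- \<delta>^2 /
        2 - \<delta> * x), which does not increase with x; its value at the left end x = s -
        \<delta> is the claimed factor.\<close>
      have "\<delta> * s - \<delta> * \<delta> \<le> \<delta> * x"
        using mult_left_mono[OF True \<delta>] by (simp add: right_diff_distrib)
      moreover have "(\<delta> + x)\<^sup>2 = \<delta> * \<delta> + 2 * (\<delta> * x) + x\<^sup>2" "\<delta>\<^sup>2 = \<delta> * \<delta>"
        by (simp_all add: power2_eq_square algebra_simps)
      ultimately have "- (\<delta> + x)\<^sup>2 / 2 \<le> (\<delta>\<^sup>2 / 2 - \<delta> * s) + - x\<^sup>2 / 2"
        by linarith
      then have "exp (- (\<delta> + x)\<^sup>2 / 2) \<le> exp (\<delta>\<^sup>2 / 2 - \<delta> * s) * exp (- x\<^sup>2 / 2)"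
        unfolding exp_add[symmetric] by simp
      then have "std_normal_density (\<delta> + x) \<le> exp (\<delta>\<^sup>2 / 2 - \<delta> * s) * std_normal_density x"
        unfolding std_normal_density_def by (simp add: divide_right_mono)
      then show ?thesis using True by (simp add: ennreal_mult[symmetric] add.commute)
    next
      case False
      then show ?thesis by simp
    qed
  qed
  also have "\<dots> = ennreal (exp (\<delta>\<^sup>2 / 2 - \<delta> * s)) * ennreal (prob {x\<in>space M. s - \<delta> \<le> X x})"
    unfolding tail by (rule nn_integral_cmult) auto
  finally show ?thesis by (simp add: ennreal_mult[symmetric])
qed

end

text \<open>The noise grows at most linearly, so a steep drift makes the centre alone optimal, with
  level \<sigma> * \<open>z (- 1)\<close>. The factor 4 comes from the left half: for
  \<open>l \<ge> 2\<close> the drift averages at least \<open>a / 2\<close> per point, against a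
  cost of \<open>2 * \<sigma> * H\<close> for noise and level together.\<close>

lemma crit_large_slope:
  assumes \<sigma>: "0 < \<sigma>" and bdd: "walk_bounded H z" and a: "4 * \<sigma> * H < a" "0 < a"
  shows "crit_L \<sigma> a z = \<sigma> * z (- 1)"
proof -
  define c where "c = \<sigma> * z (- 1)"
  have R: "- (H * real r) \<le> right_sum z r" and L: "left_sum z r \<le> H * real r" for r
  proof -
    have "\<bar>right_sum z r\<bar> \<le> H * real r" "\<bar>left_sum z r\<bar> \<le> H * real r"
      using bdd by (simp_all add: walk_bounded_def)
    then show "- (H * real r) \<le> right_sum z r" "left_sum z r \<le> H * real r" by linarith+
  qed
  have "\<bar>left_sum z 1\<bar> \<le> H * real 1" using bdd unfolding walk_bounded_def by blast
  then have z1: "\<bar>z (- 1)\<bar> \<le> H" by (simp add: left_sum_def)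
  then have H: "0 \<le> H" by linarith
  have c: "\<bar>c\<bar> \<le> \<sigma> * H" using z1 \<sigma> by (simp add: c_def abs_mult)
  have 1: "crit_right \<sigma> a z 0 + crit_left \<sigma> a z 1 = c * (real 0 + real 1)"
    by (simp add: crit_right_def crit_left_def right_sum_def left_sum_def c_def)
  have 2: "crit_right \<sigma> a z 0 - c * real 0 < crit_right \<sigma> a z r - c * real r" if "r \<noteq> 0" for r
  proof -
    have r: "1 \<le> real r" using that by simp
    have "\<sigma> * - (H * real r) \<le> \<sigma> * right_sum z r" using R \<sigma> by (intro mult_left_mono) auto
    moreover have "a * real r * 1 \<le> a * real r * ((real r + 1) / 2)" using r a by (intro mult_left_mono) auto
    moreover have "c * real r \<le> \<sigma> * H * real r" using c by (intro mult_right_mono) auto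
    moreover have "0 < (a - 2 * \<sigma> * H) * real r"
      using a r H \<sigma> mult_nonneg_nonneg[of \<sigma> H] by (intro mult_pos_pos) linarith+
    ultimately show ?thesis
      by (simp add: crit_right_def right_sum_def[of z 0] algebra_simps add_divide_distrib)
  qed
  have 3: "crit_left \<sigma> a z l - c * real l < crit_left \<sigma> a z 1 - c * real 1" if "1 \<le> l" "l \<noteq> 1" for l
  proof -
    have l: "2 \<le> real l" using that by simp
    have "\<sigma> * left_sum z l \<le> \<sigma> * (H * real l)" using L \<sigma> by (intro mult_left_mono) auto
    moreover have "a * real l * (1 / 2) \<le> a * real l * ((real l - 1) / 2)" using l a by (intro mult_left_mono) auto
    moreover have "- (\<sigma> * H) * real l \<le> c * real l" using c by (intro mult_right_mono) auto
    moreover have "0 < (a / 2 - 2 * \<sigma> * H) * real l"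
      using a l by (intro mult_pos_pos) linarith+
    ultimately have "crit_left \<sigma> a z l - c * real l < 0"
      by (simp add: crit_left_def algebra_simps add_divide_distrib diff_divide_distrib)
    moreover have "crit_left \<sigma> a z 1 - c * real 1 = 0"
      by (simp add: crit_left_def left_sum_def c_def)
    ultimately show ?thesis by simp
  qed
  have "crit_r \<sigma> a z = 0" "crit_l \<sigma> a z = 1" "crit_G \<sigma> a z = c"
    using crit_eq_of_strict_saddle[OF \<sigma> a(2) bdd _ 1 2 3] by auto
  then show ?thesis by (simp add: crit_L_def c_def)
qed

text \<open>On this event the optimal block contains at least two points while its level is at least
  \<open>a\<close>, so that the normalization by the block length pays off.\<close>

lemma crit_L_lower_bound:
  assumes \<sigma>: "0 < \<sigma>" and \<alpha>: "0 < \<alpha>" and bdd: "walk_bounded H z"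
    and z0: "\<alpha> + 1 \<le> z (- 1)" and z1: "0 \<le> z 1" "z 1 < 1"
    and z: "\<And>i. 2 \<le> i \<Longrightarrow> - (\<alpha> * (real i - 1)) \<le> z (int i)"
  shows "sqrt 2 * \<alpha> \<le> crit_L \<sigma> (\<sigma> * \<alpha>) z / \<sigma>"
proof -
  define a where "a = \<sigma> * \<alpha>"
  have a: "0 < a" using \<sigma> \<alpha> by (simp add: a_def)
  note opt = crit_opt[OF \<sigma> a bdd] and le_sup = crit_obj_le_sup[OF \<sigma> a bdd] and att = crit_sup_attained[OF \<sigma> a bdd]
  let ?r = "crit_r \<sigma> a z" and ?l = "crit_l \<sigma> a z" and ?c = "crit_G \<sigma> a z"
  have left1: "crit_left \<sigma> a z 1 = \<sigma> * z (- 1)" by (simp add: crit_left_def left_sum_def)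
  have right1: "crit_right \<sigma> a z 1 = \<sigma> * z 1 + a" by (simp add: crit_right_def right_sum_def)
  have right0: "crit_right \<sigma> a z 0 = 0" by (simp add: crit_right_def right_sum_def)
  \<comment> \<open>The datum right of the centre lies below the datum at the centre, a violation of
    monotonicity that forces pooling.\<close>
  have y01: "crit_right \<sigma> a z 1 < crit_left \<sigma> a z 1"
  proof -
    have "\<sigma> * (z 1 + \<alpha>) < \<sigma> * z (- 1)" using \<sigma> z0 z1 by (intro mult_strict_left_mono) auto
    then show ?thesis unfolding left1 right1 by (simp add: a_def distrib_left)
  qed
  \<comment> \<open>The assumption on \<open>z (int i)\<close> is calibrated so that each datum at
    offset \<open>i \<ge> 2\<close> is at least \<open>a * i - a * (i - 1) = a\<close>.\<close>
  have right: "a * real r \<le> crit_right \<sigma> a z r" for r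
  proof (induction r)
    case 0 show ?case using right0 by simp
  next
    case (Suc r)
    have "crit_right \<sigma> a z (Suc r) = crit_right \<sigma> a z r + (\<sigma> * z (int (Suc r)) + a * real (Suc r))"
      by (simp add: crit_right_def right_sum_def field_simps)
    moreover have "a \<le> \<sigma> * z (int (Suc r)) + a * real (Suc r)"
    proof (cases "r = 0")
      case True then show ?thesis using z1 \<sigma> by simp
    next
      case False
      have "\<sigma> * (- (\<alpha> * (real (Suc r) - 1))) \<le> \<sigma> * z (int (Suc r))"
        using \<sigma> z[of "Suc r"] False by (intro mult_left_mono) auto
      then show ?thesis by (simp add: a_def algebra_simps)
    qed
    ultimately show ?case using Suc.IH by (simp add: algebra_simps)
  qed
  have left: "a \<le> crit_left \<sigma> a z 1"
    using mult_left_mono[of \<alpha> "z (- 1)" \<sigma>] \<sigma> z0 unfolding left1 by (simp add: a_def)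
  have c: "a \<le> ?c"
  proof -
    have "a * (real ?r + real (1::nat)) \<le> crit_right \<sigma> a z ?r + crit_left \<sigma> a z 1"
      using right[of ?r] left by (simp add: distrib_left)
    then have "a \<le> crit_obj \<sigma> a z ?r 1"
      by (subst crit_obj_average) (simp_all add: pos_le_divide_eq)
    then show ?thesis using le_sup[of 1 ?r] opt(1) by simp
  qed
  \<comment> \<open>If the block ended at the centre, every left half would average at most the
    level, so extending the block by one point could not lower the objective unless that point did;
    it would have to be at least the level, yet it lies below the centre.\<close>
  have "?r \<noteq> 0"
  proof
    assume r0: "?r = 0"
    have Q: "crit_left \<sigma> a z l \<le> ?c * real l" if "1 \<le> l" for l
    proof -
      have "crit_obj \<sigma> a z 0 l \<le> ?c" using le_sup[OF that, of 0] opt(1) r0 by simp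
      then show ?thesis using that right0 by (simp add: crit_obj_average pos_divide_le_eq)
    qed
    obtain l where l: "1 \<le> l" "crit_sup \<sigma> a z 1 = crit_obj \<sigma> a z 1 l" using att by blast
    have "?c \<le> crit_obj \<sigma> a z 1 l" using opt(2)[of 1] l by simp
    then have "?c * (1 + real l) \<le> crit_right \<sigma> a z 1 + crit_left \<sigma> a z l"
      using l by (simp add: crit_obj_average pos_le_divide_eq)
    then have "?c \<le> crit_right \<sigma> a z 1" using Q[OF l(1)] by (simp add: distrib_left)
    then show False using y01 Q[of 1] by simp
  qed
  then have "2 \<le> real ?r + real ?l" using opt(3) by simp
  then have "sqrt 2 * a \<le> sqrt (real ?r + real ?l) * ?c"
    using c a by (intro mult_mono) auto
  then have "sqrt 2 * \<alpha> * \<sigma> \<le> crit_L \<sigma> a z" by (simp add: crit_L_def a_def mult_ac)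
  then show ?thesis unfolding a_def[symmetric] using \<sigma> by (simp add: pos_le_divide_eq)
qed

text \<open>Weierstrass product inequality, by induction on the index set.\<close>

lemma prod_one_minus_ge:
  fixes a :: "'i \<Rightarrow> real"
  assumes "finite A" "\<And>i. i \<in> A \<Longrightarrow> 0 \<le> p i" "\<And>i. i \<in> A \<Longrightarrow> p i \<le> 1" "\<And>i. i \<in> A \<Longrightarrow> 1 - a i \<le> p i"
  shows "1 - (\<Sum>i\<in>A. a i) \<le> (\<Prod>i\<in>A. p i)"
  using assms
proof (induction A rule: finite_induct)
  case (insert i A)
  have P: "0 \<le> (\<Prod>i\<in>A. p i)" "(\<Prod>i\<in>A. p i) \<le> 1"
    using insert.prems by (auto intro!: prod_nonneg prod_le_1)
  have "(1 - p i) * (\<Prod>i\<in>A. p i) \<le> (1 - p i) * 1"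
    using P insert.prems(2)[of i] by (intro mult_left_mono) auto
  moreover have "1 - (\<Sum>i\<in>A. a i) \<le> (\<Prod>i\<in>A. p i)" using insert by auto
  moreover have "1 - a i \<le> p i" using insert.prems(3)[of i] by simp
  ultimately show ?case using insert.hyps by (simp add: algebra_simps)
qed simp

section \<open>Tail probabilities of the limit law for different slopes\<close>

context prob_space
begin

context
  fixes Z :: "int \<Rightarrow> 'a \<Rightarrow> real" and \<sigma> :: real
  assumes indep: "indep_vars (\<lambda>_. borel) Z (UNIV - {0})"
    and normal: "\<And>i. i \<noteq> 0 \<Longrightarrow> distributed M lborel (Z i) std_normal_density"
    and \<sigma>: "0 < \<sigma>"
begin

lemma Z_measurable: "i \<noteq> 0 \<Longrightarrow> random_variable borel (Z i)"
  using indep by (auto simp: indep_vars_def)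

lemma AE_normal_walk_bounded: "AE x in M. \<exists>H. walk_bounded H (\<lambda>i. Z i x)"
  by (rule AE_walk_bounded[OF indep]) (use std_normal_moments[OF normal] in auto)

lemma measurable_crit_L_Z: "(\<lambda>x. crit_L \<sigma> a (\<lambda>i. Z i x)) \<in> borel_measurable M"
  by (rule measurable_crit_L) (rule Z_measurable)

text \<open>For almost every realization the limit variable equals \<sigma> * \<open>Z (- 1)\<close>
  as soon as the slope exceeds \<open>4 * \<sigma> * H\<close>, with \<open>H\<close> depending on
  the realization. Dominated convergence then passes to probabilities.\<close>

lemma crit_L_prob_large_slope:
  "(\<lambda>n::nat. prob {x\<in>space M. s \<le> crit_L \<sigma> (real (Suc n)) (\<lambda>i. Z i x) / \<sigma>}) \<longlonglongrightarrow> prob {x\<in>space M. s \<le> Z (- 1) x}"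
proof -
  note [measurable] = measurable_crit_L_Z Z_measurable
  let ?L = "\<lambda>n x. crit_L \<sigma> (real (Suc n)) (\<lambda>i. Z i x) / \<sigma>"
  have eq: "prob {x\<in>space M. s \<le> f x} = expectation (\<lambda>x. indicator {s..} (f x))"
    if [measurable]: "f \<in> borel_measurable M" for f
  proof -
    have "expectation (\<lambda>x. indicator {s..} (f x) :: real) = expectation (indicator {x\<in>space M. s \<le> f x})"
      by (intro Bochner_Integration.integral_cong) (auto simp: indicator_def)
    then show ?thesis by simp
  qed
  have "(\<lambda>n. expectation (\<lambda>x. indicator {s..} (?L n x))) \<longlonglongrightarrow> expectation (\<lambda>x. indicator {s..} (Z (- 1) x) :: real)"
  proof (rule integral_dominated_convergence[where w = "\<lambda>_. 1"])
    show "AE x in M. (\<lambda>n. indicator {s..} (?L n x)) \<longlonglongrightarrow> (indicator {s..} (Z (- 1) x) :: real)"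
      using AE_normal_walk_bounded
    proof eventually_elim
      case (elim x)
      then obtain H where H: "walk_bounded H (\<lambda>i. Z i x)" by blast
      have "\<forall>\<^sub>F n in sequentially. 4 * \<sigma> * H < real (Suc n)"
        by (rule eventually_compose_filterlim[OF eventually_gt_at_top])
           (rule filterlim_compose[OF filterlim_real_sequentially filterlim_Suc])
      then have "\<forall>\<^sub>F n in sequentially. (indicator {s..} (?L n x) :: real) = indicator {s..} (Z (- 1) x)"
      proof eventually_elim
        case (elim n)
        then show ?case using crit_large_slope[OF \<sigma> H elim] \<sigma> by simp
      qed
      then show ?case by (rule tendsto_eventually)
    qed
  qed auto
  then show ?thesis by (subst (1 2) eq) auto
qed

text \<open>The conditions of \<open>crit_L_lower_bound\<close> concern distinct coordinates and are
  independent. Those at \<open>i \<ge> 2\<close> hold jointly with probability at least 1/2: by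
  Chebyshev the failures sum to at most pi^2 / (6 * \<alpha>^2), and \<alpha> is at least 2.\<close>

lemma crit_L_prob_lower_bound:
  assumes \<alpha>: "2 \<le> \<alpha>"
  shows "1 / 2 * prob {x\<in>space M. \<alpha> + 1 \<le> Z (- 1) x} * prob {x\<in>space M. Z 1 x \<in> {0..<1}}
    \<le> prob {x\<in>space M. sqrt 2 * \<alpha> \<le> crit_L \<sigma> (\<sigma> * \<alpha>) (\<lambda>i. Z i x) / \<sigma>}"
proof -
  note [measurable] = measurable_crit_L_Z Z_measurable
  define B where "B i = (if i = - 1 then {\<alpha> + 1..} else if i = 1 then {0..<1} else {- (\<alpha> * (real_of_int i - 1))..})" for i
  \<comment> \<open>Independence yields products over finite sets only, so the infinitely many
    conditions are reached through a decreasing sequence of events \<open>E n\<close>.\<close>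
  define J where "J n = insert (- 1) (insert 1 (int ` {2..n + 2}))" for n
  define E where "E n = (\<Inter>i\<in>J n. Z i -` B i \<inter> space M)" for n
  have B[measurable]: "B i \<in> sets borel" for i by (simp add: B_def)
  have J0: "i \<noteq> 0" if "i \<in> J n" for i n using that by (auto simp: J_def)
  have Eev[measurable]: "E n \<in> events" for n
    unfolding E_def using J0 by (intro sets.finite_INT measurable_sets[OF Z_measurable B]) (auto simp: J_def)
  let ?q = "prob {x\<in>space M. \<alpha> + 1 \<le> Z (- 1) x}" and ?p = "prob {x\<in>space M. Z 1 x \<in> {0..<1}}"
  have PE: "1 / 2 * ?q * ?p \<le> prob (E n)" for n
  proof -
    let ?P = "\<lambda>i. prob (Z i -` B i \<inter> space M)"
    have "prob (E n) = (\<Prod>i\<in>J n. ?P i)"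
      unfolding E_def by (rule indep_varsD[OF indep]) (use J0 in \<open>auto simp: J_def\<close>)
    also have "\<dots> = ?P (- 1) * (\<Prod>i\<in>insert 1 (int ` {2..n + 2}). ?P i)"
      unfolding J_def by (rule prod.insert) auto
    also have "(\<Prod>i\<in>insert 1 (int ` {2..n + 2}). ?P i) = ?P 1 * (\<Prod>i\<in>int ` {2..n + 2}. ?P i)"
      by (rule prod.insert) auto
    also have "(\<Prod>i\<in>int ` {2..n + 2}. ?P i) = (\<Prod>i=2..n + 2. ?P (int i))"
      by (subst prod.reindex) (auto simp: comp_def)
    also have "?P (- 1) = ?q" by (rule arg_cong[of _ _ prob]) (auto simp: B_def)
    also have "?P 1 = ?p" by (rule arg_cong[of _ _ prob]) (auto simp: B_def)
    finally have "prob (E n) = ?q * (?p * (\<Prod>i=2..n + 2. ?P (int i)))" .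
    moreover have "1 / 2 \<le> (\<Prod>i=2..n + 2. ?P (int i))"
    proof -
      have cheb: "1 - 1 / (\<alpha> * (real i - 1))\<^sup>2 \<le> ?P (int i)" if i: "2 \<le> i" for i
      proof -
        have i0: "int i \<noteq> 0" using i by simp
        note mom = std_normal_moments[OF normal[OF i0]]
        have pos: "0 < \<alpha> * (real i - 1)" using \<alpha> i by (intro mult_pos_pos) auto
        let ?C = "{x\<in>space M. \<alpha> * (real i - 1) \<le> \<bar>Z (int i) x\<bar>}"
        have "prob ?C \<le> expectation (\<lambda>x. (Z (int i) x)\<^sup>2) / (\<alpha> * (real i - 1))\<^sup>2"
          by (rule second_moment_method[OF Z_measurable[OF i0] mom(1) pos])
        then have C: "prob ?C \<le> 1 / (\<alpha> * (real i - 1))\<^sup>2" using mom(3) by simp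
        have [measurable]: "?C \<in> events" using Z_measurable[OF i0] by measurable
        have "1 - prob ?C = prob (space M - ?C)" by (rule prob_compl[symmetric]) simp
        also have "\<dots> \<le> ?P (int i)"
          by (rule finite_measure_mono) (use i measurable_sets[OF Z_measurable[OF i0] B] in \<open>auto simp: B_def\<close>)
        finally show ?thesis using C by linarith
      qed
      have "(\<Sum>i=2..n + 2. 1 / (\<alpha> * (real i - 1))\<^sup>2) \<le> 1 / 2"
      proof -
        have "(\<Sum>i=2..n + 2. 1 / (real i - 1)\<^sup>2) = (\<Sum>i<Suc n. 1 / (real (i + 1))\<^sup>2)"
          by (rule sum.reindex_bij_witness[of _ "\<lambda>i. i + 2" "\<lambda>i. i - 2"]) auto
        also have "\<dots> \<le> (\<Sum>i. 1 / (real (i + 1))\<^sup>2)"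
          by (rule sum_le_suminf) (use sums_summable[OF inverse_squares_sums] in auto)
        also have "\<dots> = pi\<^sup>2 / 6"
          using sums_unique[OF inverse_squares_sums] by simp
        also have "\<dots> \<le> 2"
        proof -
          have "pi\<^sup>2 \<le> 3.2\<^sup>2" using pi_less_4 pi_approx by (intro power_mono) auto
          then show ?thesis by (simp add: power2_eq_square)
        qed
        finally have S: "(\<Sum>i=2..n + 2. 1 / (real i - 1)\<^sup>2) \<le> 2" .
        have "(\<Sum>i=2..n + 2. 1 / (\<alpha> * (real i - 1))\<^sup>2) = 1 / \<alpha>\<^sup>2 * (\<Sum>i=2..n + 2. 1 / (real i - 1)\<^sup>2)"
          unfolding sum_distrib_left by (rule sum.cong) (simp_all add: power_mult_distrib)
        also have "\<dots> \<le> 1 / \<alpha>\<^sup>2 * 2" by (rule mult_left_mono[OF S]) simp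
        also have "\<dots> \<le> 1 / 2"
        proof -
          have "2\<^sup>2 \<le> \<alpha>\<^sup>2" using \<alpha> by (intro power_mono) auto
          then show ?thesis by (simp add: divide_le_eq)
        qed
        finally show ?thesis .
      qed
      then show ?thesis
        using prod_one_minus_ge[of "{2..n + 2}" "\<lambda>i. ?P (int i)" "\<lambda>i. 1 / (\<alpha> * (real i - 1))\<^sup>2"] cheb by auto
    qed
    ultimately show ?thesis
      using mult_left_mono[of "1 / 2" "\<Prod>i=2..n + 2. ?P (int i)" "?q * ?p"] by (simp add: mult_ac)
  qed
  have "(\<lambda>n. prob (E n)) \<longlonglongrightarrow> prob (\<Inter>n. E n)"
  proof (rule finite_Lim_measure_decseq)
    show "decseq E" unfolding decseq_def E_def by (auto simp: J_def)
  qed auto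
  then have "1 / 2 * ?q * ?p \<le> prob (\<Inter>n. E n)"
    by (rule LIMSEQ_le_const) (use PE in auto)
  also have "\<dots> \<le> prob {x\<in>space M. sqrt 2 * \<alpha> \<le> crit_L \<sigma> (\<sigma> * \<alpha>) (\<lambda>i. Z i x) / \<sigma>}"
  proof (rule finite_measure_mono_AE)
    show "AE x in M. x \<in> (\<Inter>n. E n) \<longrightarrow> x \<in> {x\<in>space M. sqrt 2 * \<alpha> \<le> crit_L \<sigma> (\<sigma> * \<alpha>) (\<lambda>i. Z i x) / \<sigma>}"
      using AE_normal_walk_bounded
    proof eventually_elim
      case (elim x)
      then obtain H where H: "walk_bounded H (\<lambda>i. Z i x)" by blast
      show ?case
      proof
        assume xE: "x \<in> (\<Inter>n. E n)"
        have in_E: "x \<in> Z i -` B i \<inter> space M" if "i \<in> J n" for i n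
        proof -
          have "x \<in> E n" using xE by blast
          then show ?thesis unfolding E_def using that by (rule INT_D)
        qed
        have sp: "x \<in> space M" if "i \<in> J n" for i n using in_E[OF that] by simp
        have in_B: "Z i x \<in> B i" if "i \<in> J n" for i n using in_E[OF that] by simp
        have "\<alpha> + 1 \<le> Z (- 1) x" "0 \<le> Z 1 x" "Z 1 x < 1"
          using in_B[of "- 1" 0] in_B[of 1 0] by (auto simp: J_def B_def)
        moreover have "- (\<alpha> * (real i - 1)) \<le> Z (int i) x" if "2 \<le> i" for i
          using in_B[of "int i" i] that by (auto simp: J_def B_def)
        ultimately show "x \<in> {x\<in>space M. sqrt 2 * \<alpha> \<le> crit_L \<sigma> (\<sigma> * \<alpha>) (\<lambda>i. Z i x) / \<sigma>}"
          using crit_L_lower_bound[OF \<sigma> _ H, of \<alpha>] sp[of "- 1" 0] \<alpha> by (auto simp: J_def)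
      qed
    qed
  qed measurable
  finally show ?thesis .
qed

text \<open>A constant law would have to be standard normal, as the large-slope limit shows. At
  slope \<sigma> * n, however, the threshold sqrt 2 * n is exceeded with probability at least a
  constant times the normal tail at n + 1, and the normal tail at sqrt 2 * n is eventually
  smaller.\<close>

lemma crit_L_law_not_constant:
  "\<not> (\<lambda>a. distr M borel (\<lambda>x. crit_L \<sigma> a (\<lambda>i. Z i x) / \<sigma>)) constant_on {0<..}"
proof
  assume "(\<lambda>a. distr M borel (\<lambda>x. crit_L \<sigma> a (\<lambda>i. Z i x) / \<sigma>)) constant_on {0<..}"
  then obtain D where D: "\<And>a. 0 < a \<Longrightarrow> distr M borel (\<lambda>x. crit_L \<sigma> a (\<lambda>i. Z i x) / \<sigma>) = D"
    by (auto simp: constant_on_def)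
  note [measurable] = measurable_crit_L_Z Z_measurable
  have PD: "prob {x\<in>space M. s \<le> crit_L \<sigma> a (\<lambda>i. Z i x) / \<sigma>} = measure D {s..}" if "0 < a" for a s
  proof -
    have "measure D {s..} = prob ((\<lambda>x. crit_L \<sigma> a (\<lambda>i. Z i x) / \<sigma>) -` {s..} \<inter> space M)"
      unfolding D[OF that, symmetric] by (rule measure_distr) auto
    then show ?thesis by (simp add: vimage_def Int_def conj_commute)
  qed
  have DQ: "measure D {s..} = prob {x\<in>space M. s \<le> Z (- 1) x}" for s
  proof -
    have "(\<lambda>n::nat. measure D {s..}) \<longlonglongrightarrow> prob {x\<in>space M. s \<le> Z (- 1) x}"
      using crit_L_prob_large_slope[of s] by (simp add: PD)
    then show ?thesis by (simp add: LIMSEQ_const_iff)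
  qed
  let ?p = "prob {x\<in>space M. Z 1 x \<in> {0..<1}}"
  have p: "0 < ?p" using std_normal_interval_pos[OF normal[of 1], of 0] by simp
  \<comment> \<open>The distance between the two thresholds. With this shift the exponent in
    \<open>std_normal_tail_shift\<close> is ((n + 1)^2 - 2 * n^2) / 2, which tends to minus
    infinity.\<close>
  define \<delta> :: "nat \<Rightarrow> real" where "\<delta> n = sqrt 2 * real n - (real n + 1)" for n
  have "(\<delta> n)\<^sup>2 / 2 - \<delta> n * (sqrt 2 * real n) = (real n + 1)\<^sup>2 / 2 - (real n)\<^sup>2" for n
    unfolding \<delta>_def by (simp add: power2_eq_square field_simps)
  moreover have "(\<lambda>n. exp ((real n + 1)\<^sup>2 / 2 - (real n)\<^sup>2)) \<longlonglongrightarrow> 0"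
    by real_asymp
  ultimately have "(\<lambda>n. exp ((\<delta> n)\<^sup>2 / 2 - \<delta> n * (sqrt 2 * real n))) \<longlonglongrightarrow> 0"
    by simp
  then have "\<forall>\<^sub>F n in sequentially. exp ((\<delta> n)\<^sup>2 / 2 - \<delta> n * (sqrt 2 * real n)) < ?p / 2"
    using p by (intro order_tendstoD(2)) auto
  moreover have "\<forall>\<^sub>F n in sequentially. 0 \<le> \<delta> n"
    unfolding \<delta>_def by real_asymp
  ultimately have "\<forall>\<^sub>F n in sequentially. False"
    using eventually_ge_at_top[of 2]
  proof eventually_elim
    case (elim n)
    let ?q = "prob {x\<in>space M. real n + 1 \<le> Z (- 1) x}"
    have q: "0 < ?q"
    proof -
      have "0 < prob {x\<in>space M. Z (- 1) x \<in> {real n + 1..<real n + 1 + 1}}"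
        by (rule std_normal_interval_pos[OF normal]) simp
      also have "\<dots> \<le> ?q" by (rule finite_measure_mono) auto
      finally show ?thesis .
    qed
    have "1 / 2 * ?q * ?p \<le> measure D {sqrt 2 * real n..}"
      using crit_L_prob_lower_bound[of "real n"] elim \<sigma> by (simp add: PD)
    also have "\<dots> \<le> exp ((\<delta> n)\<^sup>2 / 2 - \<delta> n * (sqrt 2 * real n)) * ?q"
      unfolding DQ using std_normal_tail_shift[OF normal[of "- 1"] elim(2), of "sqrt 2 * real n"]
      by (simp add: \<delta>_def)
    also have "\<dots> < ?p / 2 * ?q" using elim(1) q by (rule mult_strict_right_mono)
    finally show False by simp
  qed
  then show False by simp
qed

end

end

section \<open>Weak convergence\<close>

lemma filterlim_nat_of_real:
  assumes "filterlim (\<lambda>m. real (f m)) at_top F"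
  shows "filterlim f at_top F"
  unfolding filterlim_at_top
proof
  fix Z
  have "\<forall>\<^sub>F m in F. real Z \<le> real (f m)" using assms unfolding filterlim_at_top by blast
  then show "\<forall>\<^sub>F m in F. Z \<le> f m" by simp
qed

text \<open>Local linearity is applied at scale 1 / \<open>n m\<close>; dividing by the scale turns
  its error into the error of the rescaled increment. To bound a value by the real supremum the set
  must be bounded, which monotonicity of \<open>g\<close> provides.\<close>

lemma locally_linear_drift:
  fixes n :: "nat \<Rightarrow> nat"
  assumes lin: "locally_linear_at g c x" and mono: "mono_on {0..1} g" and x: "0 < x" "x < 1"
    and n: "filterlim n at_top sequentially"
  shows "(\<lambda>m. real (n m) * (g (x + s / real (n m)) - g x)) \<longlonglongrightarrow> c * s"
proof -
  \<comment> \<open>The window must contain the point at distance \<open>\<bar>s\<bar>\<close>; the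
    added 1 keeps \<open>L\<close> positive when \<open>s = 0\<close>.\<close>
  define L where "L = \<bar>s\<bar> + 1"
  define A where "A \<delta> = {y\<in>{0..1}. \<bar>y - x\<bar> \<le> L * \<delta>}" for \<delta>
  define f where "f y = \<bar>g y - g x - c * (y - x)\<bar>" for y
  have nreal: "filterlim (\<lambda>m. real (n m)) at_top sequentially"
    by (rule filterlim_compose[OF filterlim_real_sequentially n])
  have inv: "filterlim (\<lambda>m. inverse (real (n m))) (at_right 0) sequentially"
    by (rule filterlim_compose[OF filterlim_inverse_at_right_top nreal])
  have "((\<lambda>\<delta>. (SUP y\<in>A \<delta>. f y) / \<delta>) \<longlongrightarrow> 0) (at_right 0)"
    using lin unfolding locally_linear_at_def A_def f_def L_def by auto
  from filterlim_compose[OF this inv]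
  have lim: "(\<lambda>m. (SUP y\<in>A (inverse (real (n m))). f y) / inverse (real (n m))) \<longlonglongrightarrow> 0" .
  have "(\<lambda>m. x + s * inverse (real (n m))) \<longlonglongrightarrow> x + s * 0"
    by (intro tendsto_intros tendsto_inverse_0_at_top nreal)
  then have lx: "(\<lambda>m. x + s / real (n m)) \<longlonglongrightarrow> x" by (simp add: divide_inverse)
  have bdd: "bdd_above (f ` A \<delta>)" for \<delta>
  proof (rule bdd_aboveI2)
    fix y assume "y \<in> A \<delta>"
    then have y: "y \<in> {0..1}" by (simp add: A_def)
    have "g 0 \<le> g y" "g y \<le> g 1" "g 0 \<le> g x" "g x \<le> g 1"
      by (rule mono_onD[OF mono]; use y x in simp)+
    moreover have "\<bar>c * (y - x)\<bar> \<le> \<bar>c\<bar> * 1"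
      unfolding abs_mult using y x by (intro mult_left_mono) auto
    ultimately show "f y \<le> (g 1 - g 0) + \<bar>c\<bar>" unfolding f_def by (auto simp: abs_le_iff)
  qed
  have "(\<lambda>m. real (n m) * (g (x + s / real (n m)) - g x) - c * s) \<longlonglongrightarrow> 0"
  proof (rule Lim_null_comparison[OF _ lim])
    have "\<forall>\<^sub>F m in sequentially. 0 < n m" using eventually_compose_filterlim[OF eventually_gt_at_top[of 0] n] .
    moreover have "\<forall>\<^sub>F m in sequentially. 0 < x + s / real (n m)" using lx x(1) by (rule order_tendstoD)
    moreover have "\<forall>\<^sub>F m in sequentially. x + s / real (n m) < 1" using lx x(2) by (rule order_tendstoD)
    ultimately show "\<forall>\<^sub>F m in sequentially. norm (real (n m) * (g (x + s / real (n m)) - g x) - c * s)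
      \<le> (SUP y\<in>A (inverse (real (n m))). f y) / inverse (real (n m))"
    proof eventually_elim
      case (elim m)
      let ?y = "x + s / real (n m)"
      have "\<bar>s\<bar> / real (n m) \<le> L * inverse (real (n m))"
        unfolding divide_inverse by (intro mult_right_mono) (auto simp: L_def)
      then have "?y \<in> A (inverse (real (n m)))" using elim by (auto simp: A_def)
      then have "f ?y \<le> (SUP y\<in>A (inverse (real (n m))). f y)" by (rule cSUP_upper[OF _ bdd])
      then have "f ?y / inverse (real (n m)) \<le> (SUP y\<in>A (inverse (real (n m))). f y) / inverse (real (n m))"
        by (intro divide_right_mono) auto
      moreover have "f ?y / inverse (real (n m)) = norm (real (n m) * (g ?y - g x) - c * s)"
      proof -
        have "real (n m) * (g ?y - g x) - c * s = real (n m) * (g ?y - g x - c * (?y - x))"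
          using elim(1) by (simp add: field_simps)
        then show ?thesis using elim(1) by (simp add: f_def abs_mult divide_inverse mult.commute)
      qed
      ultimately show ?case by simp
    qed
  qed
  then show ?thesis by (rule LIM_zero_cancel)
qed

lemma walk_site_inj: "inj_on (walk_site k0) {1..n}"
  by (auto simp: inj_on_def walk_site_def split: if_splits)

lemma walk_site_nonzero: "walk_site k0 k \<noteq> 0"
  by (auto simp: walk_site_def)

text \<open>Convergence for fixed realizations requires one growth constant \<open>H\<close> for all
  designs, which cannot be had almost surely. It is therefore granted off an event of small
  probability, uniformly in \<open>m\<close>; on the rest, almost sure convergence of indicators and
  dominated convergence finish the argument.\<close>

lemma coupled_block_statistic_weak_conv:
  fixes \<Lambda> :: "real measure" and Y :: "nat \<Rightarrow> real \<Rightarrow> real" and Y' :: "real \<Rightarrow> real"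
  defines "\<Omega> \<equiv> PiM (UNIV - {0::int}) (\<lambda>_. \<Lambda>)"
  assumes \<Lambda>: "prob_space \<Lambda>"
    and Y: "\<And>m. Y m \<in> borel_measurable \<Lambda>" "Y' \<in> borel_measurable \<Lambda>"
    and conv: "\<And>x. x \<in> space \<Lambda> \<Longrightarrow> (\<lambda>m. Y m x) \<longlonglongrightarrow> Y' x"
    and mom: "\<And>m. integrable \<Lambda> (\<lambda>x. (Y m x)\<^sup>2)" "\<And>m. (LINT x|\<Lambda>. Y m x) = 0" "\<And>m. (LINT x|\<Lambda>. (Y m x)\<^sup>2) = 1"
    and Y': "distr \<Lambda> borel Y' = std_normal_distribution"
    and \<sigma>: "0 < \<sigma>" and a: "0 < a"
    and k0: "filterlim k0 at_top sequentially" "filterlim (\<lambda>m. n m - k0 m) at_top sequentially"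
      "\<And>m. k0 m \<in> {1..n m}"
    and dmono: "\<And>m i k. 1 \<le> i \<Longrightarrow> i \<le> k \<Longrightarrow> k \<le> n m \<Longrightarrow> d m i \<le> d m k"
    and d0: "\<And>m. d m (k0 m) = 0"
    and dR: "\<And>r. (\<lambda>m. d m (k0 m + r)) \<longlonglongrightarrow> a * real r"
    and dL: "\<And>l. (\<lambda>m. d m (k0 m - l)) \<longlonglongrightarrow> - a * real l"
    and noise: "\<And>m. AE \<omega> in \<Omega>. isotonic_noise (n m) \<sigma> (d m) (\<lambda>k. Y m (\<omega> (walk_site (k0 m) k)))"
  shows "weak_conv_m
    (\<lambda>m. distr \<Omega> borel (\<lambda>\<omega>. block_statistic (n m) (k0 m) \<sigma> (d m) (\<lambda>k. Y m (\<omega> (walk_site (k0 m) k)))))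
    (distr \<Omega> borel (\<lambda>\<omega>. crit_L \<sigma> a (\<lambda>i. Y' (\<omega> i))))"
proof -
  interpret \<Lambda>: prob_space \<Lambda> by fact
  interpret \<Omega>: prob_space \<Omega> unfolding \<Omega>_def by (rule prob_space_PiM[OF \<Lambda>])
  have ne: "UNIV - {0::int} \<noteq> {}" by (rule ccontr) (use one_neq_zero[where 'a = int] in blast)
  have indep: "\<Omega>.indep_vars (\<lambda>_. borel) (\<lambda>i \<omega>. f (\<omega> i)) (UNIV - {0})"
    if "f \<in> borel_measurable \<Lambda>" for f :: "real \<Rightarrow> real"
    by (rule \<Omega>.indep_vars_compose2[OF indep_vars_PiM_coordinates[OF \<Lambda> ne, folded \<Omega>_def]])
       (use that in auto)
  have coord: "distr \<Omega> \<Lambda> (\<lambda>\<omega>. \<omega> i) = \<Lambda>" and coordm: "(\<lambda>\<omega>. \<omega> i) \<in> measurable \<Omega> \<Lambda>" if "i \<noteq> 0" for i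
  proof -
    have i: "i \<in> UNIV - {0}" using that by simp
    show "distr \<Omega> \<Lambda> (\<lambda>\<omega>. \<omega> i) = \<Lambda>" unfolding \<Omega>_def by (rule distr_PiM_component[OF \<Lambda> i])
    show "(\<lambda>\<omega>. \<omega> i) \<in> measurable \<Omega> \<Lambda>" unfolding \<Omega>_def by (rule measurable_component_singleton[OF i])
  qed
  have fm: "(\<lambda>\<omega>. f (\<omega> i)) \<in> borel_measurable \<Omega>" if "f \<in> borel_measurable \<Lambda>" "i \<noteq> 0" for f :: "real \<Rightarrow> real" and i
    by (rule measurable_compose[OF coordm[OF that(2)] that(1)])
  have int_eq: "\<Omega>.expectation (\<lambda>\<omega>. f (\<omega> i)) = (LINT x|\<Lambda>. f x)"
    "integrable \<Omega> (\<lambda>\<omega>. f (\<omega> i)) \<longleftrightarrow> integrable \<Lambda> f"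
    if "f \<in> borel_measurable \<Lambda>" "i \<noteq> 0" for f :: "real \<Rightarrow> real" and i
  proof -
    show "\<Omega>.expectation (\<lambda>\<omega>. f (\<omega> i)) = (LINT x|\<Lambda>. f x)"
      using integral_distr[OF coordm[OF that(2)] that(1)] unfolding coord[OF that(2)] by (rule sym)
    show "integrable \<Omega> (\<lambda>\<omega>. f (\<omega> i)) \<longleftrightarrow> integrable \<Lambda> f"
      using integrable_distr_eq[OF coordm[OF that(2)] that(1)] unfolding coord[OF that(2)] by (rule sym)
  qed
  have momY: "integrable \<Omega> (\<lambda>\<omega>. (Y m (\<omega> i))\<^sup>2)" "\<Omega>.expectation (\<lambda>\<omega>. Y m (\<omega> i)) = 0"
    "\<Omega>.expectation (\<lambda>\<omega>. (Y m (\<omega> i))\<^sup>2) = 1" if "i \<noteq> 0" for m i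
  proof -
    have Y2: "(\<lambda>x. (Y m x)\<^sup>2) \<in> borel_measurable \<Lambda>" by (intro borel_measurable_power Y)
    show "integrable \<Omega> (\<lambda>\<omega>. (Y m (\<omega> i))\<^sup>2)"
      using int_eq(2)[OF Y2 that] mom(1) by (rule iffD2)
    show "\<Omega>.expectation (\<lambda>\<omega>. Y m (\<omega> i)) = 0"
      using int_eq(1)[OF Y(1) that] mom(2) by (rule trans)
    show "\<Omega>.expectation (\<lambda>\<omega>. (Y m (\<omega> i))\<^sup>2) = 1"
      using int_eq(1)[OF Y2 that] mom(3) by (rule trans)
  qed
  have normal: "distributed \<Omega> lborel (\<lambda>\<omega>. Y' (\<omega> i)) std_normal_density" if i: "i \<noteq> 0" for i
  proof -
    have "distr \<Omega> borel (\<lambda>\<omega>. Y' (\<omega> i)) = distr (distr \<Omega> \<Lambda> (\<lambda>\<omega>. \<omega> i)) borel Y'"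
      using distr_distr[OF Y(2) coordm[OF i]] by (simp add: comp_def)
    then have "distr \<Omega> borel (\<lambda>\<omega>. Y' (\<omega> i)) = std_normal_distribution"
      unfolding coord[OF i] Y' .
    moreover have "distr \<Omega> lborel (\<lambda>\<omega>. Y' (\<omega> i)) = distr \<Omega> borel (\<lambda>\<omega>. Y' (\<omega> i))"
      by (rule distr_cong) auto
    ultimately show ?thesis
      unfolding distributed_def using fm[OF Y(2) i] by simp
  qed
  let ?W = "\<lambda>m \<omega> k. Y m (\<omega> (walk_site (k0 m) k))"
  let ?T = "\<lambda>m \<omega>. block_statistic (n m) (k0 m) \<sigma> (d m) (?W m \<omega>)"
  let ?L = "\<lambda>\<omega>. crit_L \<sigma> a (\<lambda>i. Y' (\<omega> i))"
  let ?t = "\<lambda>m \<omega>. \<sigma> * (\<Sum>k=1..n m. ?W m \<omega> k) / real (n m)"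
  have T[measurable]: "?T m \<in> borel_measurable \<Omega>" for m
    by (rule block_statistic_measurable[OF fm[OF Y(1) walk_site_nonzero] k0(3)])
  have L[measurable]: "?L \<in> borel_measurable \<Omega>"
    by (rule measurable_crit_L) (rule fm[OF Y(2)])
  have t[measurable]: "?t m \<in> borel_measurable \<Omega>" for m
    by (intro borel_measurable_divide borel_measurable_times borel_measurable_sum borel_measurable_const
        fm[OF Y(1) walk_site_nonzero])
  note bounded = \<Omega>.prob_not_walk_bounded[OF indep[OF Y(1)] momY]
  \<comment> \<open>The average noise has standard deviation of order n^(-1/2). The exponent -1/4
    still tends to 0 and leaves room for Chebyshev, which gives the bound n^(-1/2).\<close>
  define \<eta> where "\<eta> m = \<sigma> * real (n m) powr (- 1 / 4)" for m
  have nlim: "filterlim n at_top sequentially"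
    by (rule filterlim_at_top_mono[OF k0(1)]) (use k0(3) in \<open>auto simp: Ball_def intro!: always_eventually\<close>)
  have nreal: "filterlim (\<lambda>m. real (n m)) at_top sequentially"
    by (rule filterlim_compose[OF filterlim_real_sequentially nlim])
  have \<eta>: "\<eta> \<longlonglongrightarrow> 0"
  proof -
    have "(\<lambda>m. real (n m) powr (- 1 / 4)) \<longlonglongrightarrow> 0"
      by (rule tendsto_neg_powr[OF _ nreal]) simp
    from tendsto_mult_right_zero[OF this, of \<sigma>] show ?thesis by (simp add: \<eta>_def[abs_def])
  qed
  have npos: "0 < real (n m)" for m using k0(3)[of m] by auto
  have mean_small: "\<Omega>.prob {\<omega>\<in>space \<Omega>. \<eta> m \<le> \<bar>?t m \<omega>\<bar>} \<le> real (n m) powr (- 1 / 2)" for m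
  proof -
    let ?J = "walk_site (k0 m) ` {1..n m}"
    have J: "finite ?J" "?J \<subseteq> UNIV - {0}" "card ?J = n m"
      using card_image[OF walk_site_inj, of "k0 m" "n m"] by (auto simp: walk_site_nonzero)
    have sum: "(\<Sum>k=1..n m. ?W m \<omega> k) = (\<Sum>i\<in>?J. Y m (\<omega> i))" for \<omega>
      by (subst sum.reindex[OF walk_site_inj]) (simp add: comp_def)
    note S = \<Omega>.expectation_sum_squared[OF indep[OF Y(1)[of m]] momY[of _ m] J(1,2), folded sum, unfolded J(3)]
    have sq: "(?t m \<omega>)\<^sup>2 = (\<sigma> / real (n m))\<^sup>2 * (\<Sum>k=1..n m. ?W m \<omega> k)\<^sup>2" for \<omega>
      by (simp add: power_mult_distrib power_divide)
    have S': "integrable \<Omega> (\<lambda>\<omega>. (\<Sum>k=1..n m. ?W m \<omega> k)\<^sup>2)"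
      "\<Omega>.expectation (\<lambda>\<omega>. (\<Sum>k=1..n m. ?W m \<omega> k)\<^sup>2) = real (n m)"
      using S by auto
    have pos: "0 < \<eta> m" using \<sigma> npos[of m] by (simp add: \<eta>_def)
    have "\<Omega>.prob {\<omega>\<in>space \<Omega>. \<eta> m \<le> \<bar>?t m \<omega>\<bar>} \<le> \<Omega>.expectation (\<lambda>\<omega>. (?t m \<omega>)\<^sup>2) / (\<eta> m)\<^sup>2"
      by (rule \<Omega>.second_moment_method[OF t _ pos]) (unfold sq, intro integrable_mult_right S'(1))
    also have "\<Omega>.expectation (\<lambda>\<omega>. (?t m \<omega>)\<^sup>2) = (\<sigma> / real (n m))\<^sup>2 * real (n m)"
      unfolding sq by (simp only: integral_mult_right_zero S'(2))
    also have "\<dots> / (\<eta> m)\<^sup>2 = real (n m) powr (- 1 / 2)"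
    proof -
      have e: "(\<eta> m)\<^sup>2 = \<sigma>\<^sup>2 * real (n m) powr (- 1 / 2)"
        by (simp add: \<eta>_def power_mult_distrib power2_eq_square powr_add[symmetric])
      have "real (n m) powr (- 1 / 2) * real (n m) powr (- 1 / 2) = real (n m) powr (- 1)"
        by (simp add: powr_add[symmetric])
      also have "\<dots> = 1 / real (n m)" using npos[of m] by (simp add: powr_minus_divide)
      finally have h: "real (n m) powr (- 1 / 2) * real (n m) powr (- 1 / 2) = 1 / real (n m)" .
      have "(\<sigma> / real (n m))\<^sup>2 * real (n m) = \<sigma>\<^sup>2 * (1 / real (n m))"
        using npos[of m] by (simp add: power2_eq_square)
      also have "\<dots> = (\<sigma>\<^sup>2 * real (n m) powr (- 1 / 2)) * real (n m) powr (- 1 / 2)"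
        unfolding h[symmetric] by simp
      finally show ?thesis unfolding e using \<sigma> npos[of m] by simp
    qed
    finally show ?thesis .
  qed
  show ?thesis
  proof (rule \<Omega>.weak_conv_of_conv_in_probability[OF T L])
    fix e :: real assume e: "0 < e"
    let ?B = "\<lambda>m. {\<omega>\<in>space \<Omega>. e \<le> \<bar>?T m \<omega> - ?L \<omega>\<bar>}"
    show "(\<lambda>m. \<Omega>.prob (?B m)) \<longlonglongrightarrow> 0"
    proof (rule LIMSEQ_I)
      fix \<delta> :: real assume \<delta>: "0 < \<delta>"
      \<comment> \<open>Solves \<open>40 * (pi^2 / 6) / H^2 = \<delta> / 4\<close>, the bound on the
        probability that the walk violates linear growth.\<close>
      define H where "H = sqrt (40 * (pi\<^sup>2 / 6) * (4 / \<delta>))"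
      have H: "0 < H" and H2: "40 * (pi\<^sup>2 / 6) / H\<^sup>2 = \<delta> / 4"
        using \<delta> by (simp_all add: H_def)
      let ?U = "\<lambda>m. {\<omega>\<in>space \<Omega>. \<not> walk_bounded H (\<lambda>i. Y m (\<omega> i))}"
      let ?V = "\<lambda>m. {\<omega>\<in>space \<Omega>. \<eta> m \<le> \<bar>?t m \<omega>\<bar>}"
      have Um[measurable]: "?U m \<in> \<Omega>.events" for m by (rule bounded(1)) (use H in auto)
      have Vm[measurable]: "?V m \<in> \<Omega>.events" for m using t by measurable
      have Bm[measurable]: "?B m \<in> \<Omega>.events" for m using T L by measurable
      have U: "\<Omega>.prob (?U m) \<le> \<delta> / 4" for m
        unfolding H2[symmetric] by (rule bounded(2)) (use H in auto)
      \<comment> \<open>The deviation event outside the two exceptional ones. Almost every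
        realization belongs to only finitely many of these.\<close>
      let ?G = "\<lambda>m. ?B m - (?U m \<union> ?V m)"
      have Gm[measurable]: "?G m \<in> \<Omega>.events" for m by measurable
      have "(\<lambda>m. \<Omega>.expectation (indicator (?G m) :: _ \<Rightarrow> real)) \<longlonglongrightarrow> \<Omega>.expectation (\<lambda>\<omega>. 0 :: real)"
      proof (rule integral_dominated_convergence[where w = "\<lambda>_. 1"])
        have "AE \<omega> in \<Omega>. \<forall>m. isotonic_noise (n m) \<sigma> (d m) (?W m \<omega>)"
          using noise by (simp add: AE_all_countable)
        moreover have "AE \<omega> in \<Omega>. \<exists>H. walk_bounded H (\<lambda>i. Y' (\<omega> i))"
          by (rule \<Omega>.AE_normal_walk_bounded[OF indep[OF Y(2)] normal \<sigma>])
        moreover have "AE \<omega> in \<Omega>. crit_no_ties \<sigma> a (\<lambda>i. Y' (\<omega> i))"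
          by (rule \<Omega>.AE_crit_no_ties[OF indep[OF Y(2)] normal \<sigma>])
        moreover have "AE \<omega> in \<Omega>. \<omega> \<in> space \<Omega>" by simp
        ultimately show "AE \<omega> in \<Omega>. (\<lambda>m. indicator (?G m) \<omega> :: real) \<longlonglongrightarrow> 0"
        proof eventually_elim
          case (elim \<omega>)
          obtain H0 where H0: "walk_bounded H0 (\<lambda>i. Y' (\<omega> i))" using elim(2) by blast
          have w: "(\<lambda>m. Y m (\<omega> i)) \<longlonglongrightarrow> Y' (\<omega> i)" if "i \<noteq> 0" for i
            using conv elim(4) that by (auto simp: \<Omega>_def space_PiM PiE_def)
          have "\<forall>\<^sub>F m in sequentially. \<forall>h t. walk_bounded H (\<lambda>i. Y m (\<omega> i)) \<longrightarrow> \<bar>t\<bar> \<le> \<eta> m \<longrightarrow>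
            isotonic_kkt (n m) (\<lambda>k. \<sigma> * Y m (\<omega> (walk_site (k0 m) k)) + d m k - t) h \<longrightarrow>
            \<bar>sqrt (real (card {k\<in>{1..n m}. h k = h (k0 m)})) * h (k0 m) - ?L \<omega>\<bar> < e"
            by (rule isotonic_statistic_convergence[OF \<sigma> a H0 elim(3) w k0 dmono d0 dR dL \<eta> e])
          then have "\<forall>\<^sub>F m in sequentially. (indicator (?G m) \<omega> :: real) = 0"
          proof eventually_elim
            case (elim m)
            show ?case
            proof (cases "\<omega> \<in> ?U m \<union> ?V m")
              case True then show ?thesis by (simp add: indicator_def)
            next
              case False
              have in_space: "\<omega> \<in> space \<Omega>" by fact
              have "walk_bounded H (\<lambda>i. Y m (\<omega> i))" "\<bar>?t m \<omega>\<bar> \<le> \<eta> m"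
                using False in_space by auto
              moreover have "isotonic_kkt (n m) (\<lambda>k. \<sigma> * Y m (\<omega> (walk_site (k0 m) k)) + d m k - ?t m \<omega>)
                (min_max_average (n m) (noisy_drift (n m) \<sigma> (d m) (?W m \<omega>)))"
                using \<open>\<forall>m. isotonic_noise (n m) \<sigma> (d m) (?W m \<omega>)\<close>
                unfolding isotonic_noise_def noisy_drift_def[abs_def] by blast
              ultimately have "\<bar>?T m \<omega> - ?L \<omega>\<bar> < e"
                using elim unfolding block_statistic_def Let_def by blast
              then show ?thesis by (simp add: indicator_def)
            qed
          qed
          then show ?case by (rule tendsto_eventually)
        qed
        show "(indicator (?G m) :: _ \<Rightarrow> real) \<in> borel_measurable \<Omega>" for m
          by (rule borel_measurable_indicator[OF Gm])
        show "AE \<omega> in \<Omega>. norm (indicator (?G m) \<omega> :: real) \<le> 1" for m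
          by (rule AE_I2) (simp only: real_norm_def indicator_abs_le_1)
      qed simp_all
      moreover have "\<Omega>.expectation (indicator (?G m) :: _ \<Rightarrow> real) = \<Omega>.prob (?G m)" for m
        using sets.sets_into_space[OF Gm[of m]] by (simp only: Bochner_Integration.integral_indicator Int_absorb2)
      ultimately have "(\<lambda>m. \<Omega>.prob (?G m)) \<longlonglongrightarrow> 0" by (simp only: Bochner_Integration.integral_zero)
      moreover have "(\<lambda>m. real (n m) powr (- 1 / 2)) \<longlonglongrightarrow> 0"
        by (rule tendsto_neg_powr[OF _ nreal]) simp
      ultimately have "(\<lambda>m. \<Omega>.prob (?G m) + real (n m) powr (- 1 / 2)) \<longlonglongrightarrow> 0 + 0"
        by (rule tendsto_add)
      then have "\<forall>\<^sub>F m in sequentially. \<Omega>.prob (?G m) + real (n m) powr (- 1 / 2) < \<delta> / 2"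
        using \<delta> by (intro order_tendstoD(2)) auto
      then obtain m0 where m0: "\<And>m. m0 \<le> m \<Longrightarrow> \<Omega>.prob (?G m) + real (n m) powr (- 1 / 2) < \<delta> / 2"
        unfolding eventually_sequentially by blast
      show "\<exists>no. \<forall>m\<ge>no. norm (\<Omega>.prob (?B m) - 0) < \<delta>"
      proof (intro exI allI impI)
        fix m assume m: "m0 \<le> m"
        have "\<Omega>.prob (?B m) \<le> \<Omega>.prob (?G m \<union> (?U m \<union> ?V m))"
          by (rule \<Omega>.finite_measure_mono) (blast, measurable)
        also have "\<dots> \<le> \<Omega>.prob (?G m) + \<Omega>.prob (?U m \<union> ?V m)" by (rule measure_Un_le) measurable
        also have "\<Omega>.prob (?U m \<union> ?V m) \<le> \<Omega>.prob (?U m) + \<Omega>.prob (?V m)" by (rule measure_Un_le) measurable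
        also have "\<dots> \<le> \<delta> / 4 + real (n m) powr (- 1 / 2)" by (intro add_mono U mean_small)
        finally have "\<Omega>.prob (?B m) < \<delta>" using m0[OF m] \<delta> by linarith
        then show "norm (\<Omega>.prob (?B m) - 0) < \<delta>" by simp
      qed
    qed
  qed
qed

section \<open>Coupling of the designs with the limit problem\<close>

theorem proposition3p4:
  fixes N :: "nat \<Rightarrow> 'd::finite \<Rightarrow> nat"
    and \<beta> :: "'d \<Rightarrow> real" and x0 :: "real^'d"
    and M :: "nat \<Rightarrow> 'a measure" and \<epsilon> :: "nat \<Rightarrow> real^'d \<Rightarrow> 'a \<Rightarrow> real"
    and \<nu> :: "real measure" and \<sigma> \<mu> :: real
    and g :: "'d \<Rightarrow> real \<Rightarrow> real" and g' :: "'d \<Rightarrow> real"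
    and \<mu>hat :: "nat \<Rightarrow> 'a \<Rightarrow> real" and fhat :: "nat \<Rightarrow> 'a \<Rightarrow> 'd \<Rightarrow> real \<Rightarrow> real"
    and P :: "'b measure" and Z :: "int \<Rightarrow> 'b \<Rightarrow> real"
    and j :: 'd
  assumes \<beta>_range: "\<And>l. 0 < \<beta> l \<and> \<beta> l < 1"
    and \<beta>_sum: "(\<Sum>l\<in>UNIV. \<beta> l) = 1"
    and N_lim: "\<And>l. filterlim (\<lambda>m. N m l) at_top sequentially"
    and N_powr: "\<And>m l. real (N m l) = real (\<Prod>k\<in>UNIV. N m k) powr \<beta> l"
    and x0_range: "\<And>l. 0 < x0 $ l \<and> x0 $ l < 1"
    and x0_design: "\<And>m. x0 \<in> lattice_design (N m)"
    and prob_M: "\<And>m. prob_space (M m)"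
    and noise_indep:
      "\<And>m. prob_space.indep_vars (M m) (\<lambda>_. borel) (\<epsilon> m) (lattice_design (N m))"
    and noise_distr:
      "\<And>m x. x \<in> lattice_design (N m) \<Longrightarrow> distr (M m) borel (\<epsilon> m x) = \<nu>"
    and noise_law: "prob_space \<nu>" "sets \<nu> = sets borel"
    and noise_moments: "integrable \<nu> (\<lambda>e. e\<^sup>2)" "(LINT e|\<nu>. e) = 0" "(LINT e|\<nu>. e\<^sup>2) = \<sigma>\<^sup>2"
    and \<sigma>_pos: "\<sigma> > 0"
    and g_mono: "\<And>l. mono_on {0..1} (g l)"
    and g_diff: "\<And>l. locally_linear_at (g l) (g' l) (x0 $ l)"
    and g'_pos: "\<And>l. g' l > 0"
    and lse: "\<And>m \<omega>. \<omega> \<in> space (M m) \<Longrightarrow>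
      additive_isotonic_lse (N m) (additive_response (N m) \<mu> g (\<lambda>x. \<epsilon> m x \<omega>))
        (\<mu>hat m \<omega>) (fhat m \<omega>)"
    and prob_P: "prob_space P"
    and Z_indep: "prob_space.indep_vars P (\<lambda>_. borel) Z (UNIV - {0})"
    and Z_normal: "\<And>i. i \<noteq> 0 \<Longrightarrow> distributed P lborel (Z i) std_normal_density"
    and \<beta>_j: "\<beta> j = 1 / 3"
  shows "converges_in_distribution M
      (\<lambda>m \<omega>. sqrt (block_count (N m) j (fhat m \<omega> j) (x0 $ j))
        * (fhat m \<omega> j (x0 $ j) - centered (N m j) (g j) (x0 $ j)))
      P (\<lambda>\<omega>. crit_L \<sigma> (g' j) (\<lambda>i. Z i \<omega>))
    \<and> \<not> (\<lambda>a. distr P borel (\<lambda>\<omega>. crit_L \<sigma> a (\<lambda>i. Z i \<omega>) / \<sigma>)) constant_on {0<..}"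
proof
  let ?x = "x0 $ j"
  let ?K = "UNIV - {0::int}"
  interpret P: prob_space P by (rule prob_P)
  show "\<not> (\<lambda>a. distr P borel (\<lambda>\<omega>. crit_L \<sigma> a (\<lambda>i. Z i \<omega>) / \<sigma>)) constant_on {0<..}"
    by (rule P.crit_L_law_not_constant[OF Z_indep Z_normal \<sigma>_pos])
  define n where "n m = N m j" for m
  have Npos: "1 \<le> N m l" for m l
  proof -
    have "x0 $ l \<in> grid (N m l)" using x0_design[of m] by (simp add: lattice_design_def)
    then show ?thesis by (auto simp: grid_def)
  qed
  have "\<exists>k\<in>{1..n m}. ?x = real k / real (n m)" for m
    using x0_design[of m] by (auto simp: lattice_design_def grid_def n_def dest!: spec[of _ j])
  then obtain k0 where k0: "\<And>m. k0 m \<in> {1..n m}" and x: "\<And>m. ?x = real (k0 m) / real (n m)"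
    by metis
  have npos: "0 < real (n m)" for m using k0[of m] by auto
  \<comment> \<open>The critical exponent enters here. As n_j is exactly n^(1/3), every row has
    exactly n_j^2 points, so a row sum divided by \<sigma> * n_j has unit variance.\<close>
  have cube: "(\<Prod>l\<in>UNIV. N m l) = N m j ^ 3" for m
  proof -
    have pos: "0 < real (\<Prod>l\<in>UNIV. N m l)" using Npos by (intro of_nat_0_less_iff[THEN iffD2] prod_pos) (simp add: Suc_le_eq)
    have "real (N m j) ^ 3 = (real (\<Prod>l\<in>UNIV. N m l) powr (1 / 3)) powr 3"
      using N_powr[of m j] pos by (simp add: \<beta>_j powr_realpow)
    also have "\<dots> = real (\<Prod>l\<in>UNIV. N m l)" using pos by (simp add: powr_powr)
    finally show ?thesis by (metis of_nat_eq_iff of_nat_power)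
  qed
  define d where "d m k = real (n m) * (g j (real k / real (n m)) - g j ?x)" for m k
  define W where "W m k \<omega> = (\<Sum>x\<in>lattice_row (N m) j k. \<epsilon> m x \<omega>) / (\<sigma> * real (n m))" for m k \<omega>
  let ?T = "\<lambda>m \<omega>. sqrt (block_count (N m) j (fhat m \<omega> j) ?x) * (fhat m \<omega> j ?x - centered (N m j) (g j) ?x)"
  \<comment> \<open>Whatever minimizer is chosen, the statistic coincides pointwise with a
    measurable function of the row sums; its measurability follows from this.\<close>
  have stat: "isotonic_noise (n m) \<sigma> (d m) (\<lambda>k. W m k \<omega>)"
    "?T m \<omega> = block_statistic (n m) (k0 m) \<sigma> (d m) (\<lambda>k. W m k \<omega>)" if \<omega>: "\<omega> \<in> space (M m)" for m \<omega>
  proof -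
    let ?y = "noisy_drift (n m) \<sigma> (d m) (\<lambda>k. W m k \<omega>)"
    have "\<exists>h. isotonic_kkt (N m j) ?y h \<and> ?T m \<omega> = sqrt (real (card {k\<in>{1..N m j}. h k = h (k0 m)})) * h (k0 m)"
      by (rule block_statistic_isotonic[OF lse[OF \<omega>] Npos cube _ _ \<sigma>_pos, where W = "\<lambda>k. W m k \<omega>"])
         (use k0[of m] x[of m] in \<open>simp_all add: noisy_drift_def W_def d_def n_def\<close>)
    then obtain h where h: "isotonic_kkt (n m) ?y h"
      "?T m \<omega> = sqrt (real (card {k\<in>{1..n m}. h k = h (k0 m)})) * h (k0 m)"
      unfolding n_def by blast
    have eq: "h k = min_max_average (n m) ?y k" if "k \<in> {1..n m}" for k
      by (rule isotonic_kkt_min_max[OF h(1) that])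
    show "isotonic_noise (n m) \<sigma> (d m) (\<lambda>k. W m k \<omega>)"
      unfolding isotonic_noise_def by (rule isotonic_kkt_cong[OF h(1) refl eq])
    have "{k\<in>{1..n m}. h k = h (k0 m)} = {k\<in>{1..n m}. min_max_average (n m) ?y k = min_max_average (n m) ?y (k0 m)}"
      using eq k0[of m] by auto
    then show "?T m \<omega> = block_statistic (n m) (k0 m) \<sigma> (d m) (\<lambda>k. W m k \<omega>)"
      unfolding h(2) block_statistic_def Let_def using eq[OF k0[of m]] by simp
  qed
  have card_row: "card (lattice_row (N m) j k) = (n m)\<^sup>2" if "k \<in> {1..n m}" for m k
  proof -
    have "n m * card (lattice_row (N m) j k) = n m * (n m)\<^sup>2"
      using card_lattice_row[where N = "N m" and j = j and k = k] that cube[of m]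
      by (simp add: n_def power3_eq_cube power2_eq_square)
    then show ?thesis using npos[of m] by (metis mult_left_cancel of_nat_0_less_iff less_numeral_extra(3))
  qed
  have row_sub: "lattice_row (N m) j k \<subseteq> lattice_design (N m)" for m k by (auto simp: lattice_row_def)
  have W_law: "distr (M m) borel (W m k) = normalized_sum_law \<nu> \<sigma> ((n m)\<^sup>2)" if k: "k \<in> {1..n m}" for m k
  proof -
    have "prob_space.indep_vars (M m) (\<lambda>_. borel) (\<epsilon> m) (lattice_row (N m) j k)"
      by (rule prob_space.indep_vars_subset[OF prob_M noise_indep row_sub])
    from distr_normalized_sum[OF noise_law noise_moments \<sigma>_pos prob_M this noise_distr[OF subsetD[OF row_sub[of m k]]] finite_lattice_row]
    have "distr (M m) borel (\<lambda>\<omega>. (\<Sum>x\<in>lattice_row (N m) j k. \<epsilon> m x \<omega>) / sqrt (real ((n m)\<^sup>2) * \<sigma>\<^sup>2)) =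
        normalized_sum_law \<nu> \<sigma> ((n m)\<^sup>2)"
      unfolding card_row[OF k] by simp
    moreover have "sqrt (real ((n m)\<^sup>2) * \<sigma>\<^sup>2) = \<sigma> * real (n m)"
      using \<sigma>_pos by (simp add: real_sqrt_mult mult.commute)
    ultimately show ?thesis unfolding W_def[abs_def] by simp
  qed
  have W_indep: "prob_space.indep_vars (M m) (\<lambda>_. borel) (W m) {1..n m}" for m
  proof -
    interpret Mm: prob_space "M m" by (rule prob_M)
    have "Mm.indep_vars (\<lambda>k. PiM (lattice_row (N m) j k) (\<lambda>_. borel))
        (\<lambda>k \<omega>. restrict (\<lambda>x. \<epsilon> m x \<omega>) (lattice_row (N m) j k)) {1..n m}"
      using disjoint_lattice_rows row_sub unfolding n_def by (intro Mm.indep_vars_restrict[OF noise_indep]) auto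
    from Mm.indep_vars_compose2[OF this, of "\<lambda>k w. (\<Sum>x\<in>lattice_row (N m) j k. w x) / (\<sigma> * real (n m))" "\<lambda>_. borel"]
    have "Mm.indep_vars (\<lambda>_. borel) (\<lambda>k \<omega>. (\<Sum>x\<in>lattice_row (N m) j k.
        restrict (\<lambda>x. \<epsilon> m x \<omega>) (lattice_row (N m) j k) x) / (\<sigma> * real (n m))) {1..n m}"
      by (simp add: measurable_component_singleton)
    then show ?thesis unfolding W_def[abs_def] by simp
  qed
  have "weak_conv_m (\<lambda>m. normalized_sum_law \<nu> \<sigma> ((n m)\<^sup>2)) std_normal_distribution"
  proof -
    have "filterlim (\<lambda>m. (n m)\<^sup>2) at_top sequentially"
      by (rule filterlim_at_top_mono[OF N_lim[of j]])
         (auto simp: n_def power2_eq_square intro!: always_eventually)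
    then show ?thesis
      using normalized_sum_law_conv[OF noise_law noise_moments \<sigma>_pos]
      unfolding weak_conv_m_def weak_conv_def by (auto intro: filterlim_compose)
  qed
  \<comment> \<open>All rows of one design share this law, so a coupling of real random variables,
    copied independently to every coordinate, serves all rows.\<close>
  from Skorohod[OF normalized_sum_law_real_distribution[OF noise_law noise_moments \<sigma>_pos] real_dist_normal_dist this]
  obtain \<Lambda> :: "real measure" and Y Y' where \<Lambda>: "prob_space \<Lambda>"
    and sk: "\<forall>m. Y m \<in> borel_measurable \<Lambda>" "\<forall>m. distr \<Lambda> borel (Y m) = normalized_sum_law \<nu> \<sigma> ((n m)\<^sup>2)"
      "Y' \<in> measurable \<Lambda> lborel" "distr \<Lambda> borel Y' = std_normal_distribution"
      "\<forall>x\<in>space \<Lambda>. (\<lambda>m. Y m x) \<longlonglongrightarrow> Y' x"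
    by blast
  have Y: "Y m \<in> borel_measurable \<Lambda>" "distr \<Lambda> borel (Y m) = normalized_sum_law \<nu> \<sigma> ((n m)\<^sup>2)" for m
    using sk(1,2) by blast+
  have Y': "Y' \<in> borel_measurable \<Lambda>" "distr \<Lambda> borel Y' = std_normal_distribution"
    using sk(3,4) by simp_all
  have Y_conv: "(\<lambda>m. Y m x) \<longlonglongrightarrow> Y' x" if "x \<in> space \<Lambda>" for x
    using sk(5) that by blast
  \<comment> \<open>Coordinates are indexed by position relative to the centre. A row at a fixed
    offset thus reads the same coordinate in every design, and coordinatewise convergence makes
    sense although the centre moves.\<close>
  define \<Omega> where "\<Omega> = PiM ?K (\<lambda>_. \<Lambda>)"
  have prob_\<Omega>: "prob_space \<Omega>" unfolding \<Omega>_def by (rule prob_space_PiM[OF \<Lambda>])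
  interpret \<Omega>: prob_space \<Omega> by (rule prob_\<Omega>)
  have coord: "distr \<Omega> borel (\<lambda>\<omega>. f (\<omega> i)) = distr \<Lambda> borel f" "(\<lambda>\<omega>. f (\<omega> i)) \<in> borel_measurable \<Omega>"
    if "f \<in> borel_measurable \<Lambda>" "i \<noteq> 0" for f :: "real \<Rightarrow> real" and i
  proof -
    have i: "i \<in> ?K" using that(2) by simp
    have m: "(\<lambda>\<omega>. \<omega> i) \<in> measurable \<Omega> \<Lambda>"
      unfolding \<Omega>_def by (rule measurable_component_singleton[OF i])
    have "distr \<Omega> \<Lambda> (\<lambda>\<omega>. \<omega> i) = \<Lambda>"
      unfolding \<Omega>_def by (rule distr_PiM_component[OF \<Lambda> i])
    then show "distr \<Omega> borel (\<lambda>\<omega>. f (\<omega> i)) = distr \<Lambda> borel f"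
      using distr_distr[OF that(1) m] by (simp add: comp_def)
    show "(\<lambda>\<omega>. f (\<omega> i)) \<in> borel_measurable \<Omega>" by (rule measurable_compose[OF m that(1)])
  qed
  have ne: "?K \<noteq> {}" by (rule ccontr) (use one_neq_zero[where 'a = int] in blast)
  note coord_indep = indep_vars_PiM_coordinates[OF \<Lambda> ne, folded \<Omega>_def]
  have Y_mom: "integrable \<Lambda> (\<lambda>x. (Y m x)\<^sup>2)" "(LINT x|\<Lambda>. Y m x) = 0" "(LINT x|\<Lambda>. (Y m x)\<^sup>2) = 1" for m
  proof -
    have "0 < (n m)\<^sup>2" using npos[of m] by simp
    note mom = normalized_sum_law_moments[OF noise_law noise_moments \<sigma>_pos this, folded Y(2)]
    show "integrable \<Lambda> (\<lambda>x. (Y m x)\<^sup>2)" using mom(1) by (subst (asm) integrable_distr_eq[OF Y(1)]) auto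
    show "(LINT x|\<Lambda>. Y m x) = 0" using mom(2) by (subst (asm) integral_distr[OF Y(1)]) auto
    show "(LINT x|\<Lambda>. (Y m x)\<^sup>2) = 1" using mom(3) by (subst (asm) integral_distr[OF Y(1)]) auto
  qed
  let ?V = "\<lambda>m k \<omega>. Y m (\<omega> (walk_site (k0 m) k))"
  have V_indep: "\<Omega>.indep_vars (\<lambda>_. borel) (?V m) {1..n m}" for m
  proof -
    let ?s = "\<lambda>k. {walk_site (k0 m) k}"
    have disj: "disjoint_family_on ?s {1..n m}"
    proof (unfold disjoint_family_on_def, intro ballI impI)
      fix k k' assume k: "k \<in> {1..n m}" "k' \<in> {1..n m}" "k \<noteq> k'"
      then have "walk_site (k0 m) k \<noteq> walk_site (k0 m) k'" using inj_onD[OF walk_site_inj _ k(1,2)] by blast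
      then show "?s k \<inter> ?s k' = {}" by blast
    qed
    have ind: "\<Omega>.indep_vars (\<lambda>k. PiM (?s k) (\<lambda>_. \<Lambda>)) (\<lambda>k \<omega>. restrict (\<lambda>i. \<omega> i) (?s k)) {1..n m}"
      by (rule \<Omega>.indep_vars_restrict[OF coord_indep _ disj]) (simp add: walk_site_nonzero)
    have meas: "(\<lambda>w. Y m (w (walk_site (k0 m) k))) \<in> borel_measurable (PiM (?s k) (\<lambda>_. \<Lambda>))" for k
    proof -
      have "(\<lambda>w. w (walk_site (k0 m) k)) \<in> measurable (PiM (?s k) (\<lambda>_. \<Lambda>)) \<Lambda>"
        by (rule measurable_component_singleton) simp
      then show ?thesis by (rule measurable_compose[OF _ Y(1)])
    qed
    have "\<Omega>.indep_vars (\<lambda>_. borel)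
        (\<lambda>k \<omega>. Y m (restrict (\<lambda>i. \<omega> i) (?s k) (walk_site (k0 m) k))) {1..n m}"
      by (rule \<Omega>.indep_vars_compose2[OF ind, of "\<lambda>k w. Y m (w (walk_site (k0 m) k))" "\<lambda>_. borel", OF meas])
    then show ?thesis by (simp only: restrict_apply singletonI if_True)
  qed
  have joint: "distr (M m) (PiM {1..n m} (\<lambda>_. borel)) (\<lambda>\<omega>. \<lambda>k\<in>{1..n m}. W m k \<omega>) =
      distr \<Omega> (PiM {1..n m} (\<lambda>_. borel)) (\<lambda>\<omega>. \<lambda>k\<in>{1..n m}. ?V m k \<omega>)" for m
  proof (rule distr_eq_of_indep_same_marginals[OF prob_M W_indep prob_\<Omega> V_indep])
    show "distr (M m) borel (W m k) = distr \<Omega> borel (?V m k)" if "k \<in> {1..n m}" for k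
      unfolding W_law[OF that] coord(1)[OF Y(1) walk_site_nonzero] Y(2) ..
    show "{1..n m} \<noteq> {}" using k0[of m] by blast
  qed
  have WV: "(\<lambda>\<omega>. \<lambda>k\<in>{1..n m}. W m k \<omega>) \<in> measurable (M m) (PiM {1..n m} (\<lambda>_. borel))"
    "(\<lambda>\<omega>. \<lambda>k\<in>{1..n m}. ?V m k \<omega>) \<in> measurable \<Omega> (PiM {1..n m} (\<lambda>_. borel))" for m
  proof -
    interpret Mm: prob_space "M m" by (rule prob_M)
    show "(\<lambda>\<omega>. \<lambda>k\<in>{1..n m}. W m k \<omega>) \<in> measurable (M m) (PiM {1..n m} (\<lambda>_. borel))"
      by (rule measurable_restrict) (use W_indep[of m] in \<open>simp add: Mm.indep_vars_def\<close>)
    show "(\<lambda>\<omega>. \<lambda>k\<in>{1..n m}. ?V m k \<omega>) \<in> measurable \<Omega> (PiM {1..n m} (\<lambda>_. borel))"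
      by (rule measurable_restrict) (rule coord(2)[OF Y(1) walk_site_nonzero])
  qed
  let ?S = "\<lambda>m. block_statistic (n m) (k0 m) \<sigma> (d m)"
  have S_meas: "?S m \<in> borel_measurable (PiM {1..n m} (\<lambda>_. borel))" for m
    by (rule block_statistic_measurable[OF _ k0]) (rule measurable_component_singleton)
  have S_restrict: "?S m (\<lambda>k\<in>{1..n m}. w k) = ?S m w" for m w
    by (rule block_statistic_cong[OF _ k0]) simp
  have law: "distr (M m) borel (\<lambda>\<omega>. ?S m (\<lambda>k. W m k \<omega>)) = distr \<Omega> borel (\<lambda>\<omega>. ?S m (\<lambda>k. ?V m k \<omega>))" for m
    using transfer_of_distr_eq(1)[OF joint WV S_meas] unfolding S_restrict .
  \<comment> \<open>Solvability holds everywhere for the row sums of the original model; as a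
    measurable event it passes to the coupled noise, almost surely, by equality of the joint
    laws.\<close>
  have noise: "AE \<omega> in \<Omega>. isotonic_noise (n m) \<sigma> (d m) (\<lambda>k. ?V m k \<omega>)" for m
  proof -
    have "AE \<omega> in \<Omega>. isotonic_noise (n m) \<sigma> (d m) (\<lambda>k\<in>{1..n m}. ?V m k \<omega>)"
    proof (rule transfer_of_distr_eq(2)[OF joint WV])
      show "Measurable.pred (PiM {1..n m} (\<lambda>_. borel)) (\<lambda>w. isotonic_noise (n m) \<sigma> (d m) w)"
        by (rule isotonic_noise_measurable) (rule measurable_component_singleton)
      show "AE \<omega> in M m. isotonic_noise (n m) \<sigma> (d m) (\<lambda>k\<in>{1..n m}. W m k \<omega>)"
        by (rule AE_I2) (rule isotonic_noise_cong[OF stat(1)], auto)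
    qed
    then show ?thesis
      by eventually_elim (erule isotonic_noise_cong, simp)
  qed
  have nlim: "filterlim n at_top sequentially" using N_lim[of j] by (simp add: n_def[abs_def])
  have nreal: "filterlim (\<lambda>m. real (n m)) at_top sequentially"
    by (rule filterlim_compose[OF filterlim_real_sequentially nlim])
  have xr: "0 < ?x" "?x < 1" using x0_range[of j] by auto
  have k0_eq: "real (k0 m) = ?x * real (n m)" for m using x[of m] npos[of m] by simp
  have k0_lim: "filterlim k0 at_top sequentially"
  proof -
    have "filterlim (\<lambda>m. real (k0 m)) at_top sequentially"
      unfolding k0_eq by (rule filterlim_tendsto_pos_mult_at_top[OF tendsto_const xr(1) nreal])
    then show ?thesis by (rule filterlim_nat_of_real)
  qed
  have nk0_lim: "filterlim (\<lambda>m. n m - k0 m) at_top sequentially"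
  proof -
    have "real (n m - k0 m) = (1 - ?x) * real (n m)" for m
      using k0[of m] by (simp add: of_nat_diff k0_eq left_diff_distrib)
    moreover have "filterlim (\<lambda>m. (1 - ?x) * real (n m)) at_top sequentially"
      by (rule filterlim_tendsto_pos_mult_at_top[OF tendsto_const _ nreal]) (use xr in simp)
    ultimately have "filterlim (\<lambda>m. real (n m - k0 m)) at_top sequentially" by simp
    then show ?thesis by (rule filterlim_nat_of_real)
  qed
  have d_mono: "d m i \<le> d m k" if "1 \<le> i" "i \<le> k" "k \<le> n m" for m i k
    unfolding d_def using that npos[of m]
    by (intro mult_left_mono diff_right_mono mono_onD[OF g_mono[of j]]) (auto simp: divide_right_mono)
  have d0: "d m (k0 m) = 0" for m unfolding d_def x[of m, symmetric] by simp
  note drift = locally_linear_drift[OF g_diff[of j] g_mono[of j] xr nlim]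
  have dR: "(\<lambda>m. d m (k0 m + r)) \<longlonglongrightarrow> g' j * real r" for r
  proof -
    have "d m (k0 m + r) = real (n m) * (g j (?x + real r / real (n m)) - g j ?x)" for m
      unfolding d_def by (simp add: x[of m] add_divide_distrib)
    then show ?thesis using drift[of "real r"] by simp
  qed
  have dL: "(\<lambda>m. d m (k0 m - l)) \<longlonglongrightarrow> - g' j * real l" for l
  proof -
    have "\<forall>\<^sub>F m in sequentially. l \<le> k0 m" using k0_lim by (simp add: filterlim_at_top)
    then have "\<forall>\<^sub>F m in sequentially. real (n m) * (g j (?x + - real l / real (n m)) - g j ?x) = d m (k0 m - l)"
    proof eventually_elim
      case (elim m)
      then have "real (k0 m - l) / real (n m) = ?x + - real l / real (n m)"
        by (simp add: x[of m] of_nat_diff diff_divide_distrib)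
      then show ?case unfolding d_def by simp
    qed
    from Lim_transform_eventually[OF drift this] show ?thesis by simp
  qed
  have conv: "weak_conv_m (\<lambda>m. distr \<Omega> borel (\<lambda>\<omega>. ?S m (\<lambda>k. ?V m k \<omega>)))
      (distr \<Omega> borel (\<lambda>\<omega>. crit_L \<sigma> (g' j) (\<lambda>i. Y' (\<omega> i))))"
    unfolding \<Omega>_def
    by (rule coupled_block_statistic_weak_conv[OF \<Lambda> Y(1) Y'(1) Y_conv Y_mom Y'(2) \<sigma>_pos g'_pos k0_lim nk0_lim
        k0 d_mono d0 dR dL noise[unfolded \<Omega>_def]])
  have T_meas: "?T m \<in> borel_measurable (M m)" for m
  proof -
    have "(\<lambda>\<omega>. ?S m (\<lambda>k\<in>{1..n m}. W m k \<omega>)) \<in> borel_measurable (M m)"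
      by (rule measurable_compose[OF WV(1) S_meas])
    then show ?thesis unfolding S_restrict by (subst measurable_cong[OF stat(2)])
  qed
  have T_law: "distr (M m) borel (?T m) = distr \<Omega> borel (\<lambda>\<omega>. ?S m (\<lambda>k. ?V m k \<omega>))" for m
    unfolding law[symmetric] by (rule distr_cong[OF refl refl stat(2)])
  have L_meas: "(\<lambda>\<omega>. crit_L \<sigma> (g' j) (\<lambda>i. Z i \<omega>)) \<in> borel_measurable P"
    by (rule P.measurable_crit_L_Z[OF Z_indep Z_normal \<sigma>_pos])
  have L_law: "distr P borel (\<lambda>\<omega>. crit_L \<sigma> (g' j) (\<lambda>i. Z i \<omega>)) =
      distr \<Omega> borel (\<lambda>\<omega>. crit_L \<sigma> (g' j) (\<lambda>i. Y' (\<omega> i)))"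
  proof -
    have Y'_indep: "\<Omega>.indep_vars (\<lambda>_. borel) (\<lambda>i \<omega>. Y' (\<omega> i)) ?K"
      by (rule \<Omega>.indep_vars_compose2[OF coord_indep Y'(1)])
    have Z_law: "distr P borel (Z i) = std_normal_distribution" if "i \<noteq> 0" for i
    proof -
      have "distr P borel (Z i) = distr P lborel (Z i)" by (rule distr_cong) auto
      then show ?thesis using distributed_distr_eq_density[OF Z_normal[OF that]] by simp
    qed
    have eq: "distr P (PiM ?K (\<lambda>_. borel)) (\<lambda>\<omega>. \<lambda>i\<in>?K. Z i \<omega>) = distr \<Omega> (PiM ?K (\<lambda>_. borel)) (\<lambda>\<omega>. \<lambda>i\<in>?K. Y' (\<omega> i))"
      by (rule distr_eq_of_indep_same_marginals[OF prob_P Z_indep prob_\<Omega> Y'_indep])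
         (use ne in \<open>auto simp: Z_law coord(1)[OF Y'(1)] Y'(2)\<close>)
    have meas: "(\<lambda>\<omega>. \<lambda>i\<in>?K. Z i \<omega>) \<in> measurable P (PiM ?K (\<lambda>_. borel))"
      "(\<lambda>\<omega>. \<lambda>i\<in>?K. Y' (\<omega> i)) \<in> measurable \<Omega> (PiM ?K (\<lambda>_. borel))"
      by (rule measurable_restrict, use Z_indep in \<open>simp add: P.indep_vars_def\<close>)
         (rule measurable_restrict, use Y'_indep in \<open>simp add: \<Omega>.indep_vars_def\<close>)
    have c: "crit_L \<sigma> (g' j) \<in> borel_measurable (PiM ?K (\<lambda>_. borel))"
      by (rule measurable_crit_L) (rule measurable_component_singleton, simp)
    have r: "crit_L \<sigma> (g' j) (\<lambda>i\<in>?K. z i) = crit_L \<sigma> (g' j) z" for z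
      by (rule crit_L_cong) simp
    show ?thesis using transfer_of_distr_eq(1)[OF eq meas c] unfolding r .
  qed
  show "converges_in_distribution M ?T P (\<lambda>\<omega>. crit_L \<sigma> (g' j) (\<lambda>i. Z i \<omega>))"
    unfolding converges_in_distribution_def T_law L_law using T_meas L_meas conv by blast
qed

end
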